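(* Let $G$ be a group and let $F$ be a field of characteristic $0$ or of prime characteristic $p$, and let $F^\lambda_\sigma[G]$ be a crossed product of $G$ and $F$. (1) Any upper (lower) Lie nilpotent crossed product $F^\lambda_\sigma[G]$ is a twisted group algebra, i.e. $\sigma(g)=\mathrm{id}_F$ for all $g\in G$. (2) A twisted group algebra $F^\lambda[G]$ is lower (upper) Lie nilpotent if and only if one of the following conditions holds: (2.i) $F^\lambda[G]$ is a commutative algebra (i.e. $G$ is abelian and the twisting function is symmetric: $\lambda(g,h)=\lambda(h,g)$ for all $g,h\in G$); (2.ii) $\operatorname{char}(F)=p$, $G$ is a nilpotent group whose commutator subgroup has (finite) $p$-power order, and the untwisted $p$-elements of $G$ form a subgroup; moreover, for any $a,b\in G$ the group commutator $(a,b)$ is an untwisted $p$-element and $$\bigl(\lambda(a,b)^{-1}\,\lambda(b,b^{-1}ab)\,\lambda(a,(a,b))\,\lambda((b,a),(a,b))^{-1}\bigr)^{-p^m}=\mu((a,b)),$$ where $p^m$ is the order of $(a,b)$.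
   Context: Crossed products. Let $G$ be a group, $F$ a field with unit group $U(F)$, and let $\sigma:G\to \mathrm{Aut}(F)$ and $\lambda:G\times G\to U(F)$ be maps with $\lambda(a,bc)\lambda(b,c)=\lambda(ab,c)\lambda(a,b)^{\sigma(c)}$ and $(\alpha^{\sigma(a)})^{\sigma(b)}=\alpha^{\sigma(ab)}$ for all $a,b,c\in G$, $\alpha\in F$. The crossed product $F^\lambda_\sigma[G]$ is the associative ring of finite formal sums $\sum_{g\in G}\widetilde g\alpha_g$ ($\alpha_g\in F$), with componentwise addition (two sums are equal iff all coefficients agree) and multiplication determined by distributivity and $\widetilde g\,\widetilde h=\widetilde{gh}\,\lambda(g,h)$, $\alpha\widetilde g=\widetilde g\,\alpha^{\sigma(g)}$. Its identity element is $\widetilde 1\lambda(1,1)^{-1}$. If $\sigma$ is trivial ($\sigma(g)=\mathrm{id}_F$ for all $g$), the ring is denoted $F^\lambda[G]$ and called a twisted group algebra. For a twisted group algebra the twisting function $\lambda$ is assumed normalized: $\lambda(h,1)=\lambda(1,h)=\lambda(1,1)=1$ for all $h\in G$, so $\widetilde 1$ is the identity. Lie powers. For an associative ring $R$, $[x,y]=xy-yx$; $\gamma_1(R)=R$ and $\gamma_n(R)=[\gamma_{n-1}(R),R]$ (additive subgroup generated by the commutators); $R^{[n]}=\gamma_n(R)R$ is the $n$-th lower Lie power. Also $R^{(1)}=R$ and $R^{(n)}=[R^{(n-1)},R]R$ is the $n$-th upper Lie power. $R$ is lower Lie nilpotent if $R^{[n]}=0$ for some $n$, and upper Lie nilpotent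 if $R^{(n)}=0$ for some $n$. Group notation. $(a,b)=a^{-1}b^{-1}ab$. A $p$-element is an element of finite order a power of $p$ (including order $1$). For $h\in G$ of finite order $k$, the twist of $\widetilde h$ is $\mu(h)=\prod_{i=1}^{k-1}\lambda(h^i,h)\in U(F)$, so that $\widetilde h^{\,k}=\mu(h)\widetilde 1$. A $p$-element $u\in G$ is called an untwisted $p$-element if there is $\gamma\in F$ such that the order of $u$ equals the multiplicative order of $\widetilde u\gamma$ in $F^\lambda[G]$.
   Formalization: In the displayed formula of (2.ii) the right-hand side is μ((b,a)) instead of the printed μ((a,b)); as printed the claim fails, e.g. for the Heisenberg group of order 27 over the field with 3 elements with a suitable coboundary twisting. *)

theory Defs
  imports
    "HOL-Algebra.Generated_Groups"
    "HOL-Algebra.Multiplicative_Group"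
    "HOL-Computational_Algebra.Computational_Algebra"
begin

section \<open>Crossed products\<close>

definition field_automorphism :: "('f::field \<Rightarrow> 'f) \<Rightarrow> bool" where
  "field_automorphism f \<longleftrightarrow>
     bij f \<and> f 1 = 1 \<and> (\<forall>x y. f (x + y) = f x + f y) \<and> (\<forall>x y. f (x * y) = f x * f y)"

text \<open>Automorphisms act on the right: \<open>\<sigma> g \<alpha>\<close> stands for \<open>\<alpha>\<close> to the power \<open>\<sigma>(g)\<close>,
  so that \<open>\<sigma> (a b)\<close> applies \<open>\<sigma> a\<close> first.\<close>

locale crossed_system = group G for G :: "('g, 'm) monoid_scheme" (structure) +
  fixes \<sigma> :: "'g \<Rightarrow> 'f::field \<Rightarrow> 'f" and lam :: "'g \<Rightarrow> 'g \<Rightarrow> 'f"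
  assumes automorphism: "g \<in> carrier G \<Longrightarrow> field_automorphism (\<sigma> g)"
    and lam_unit: "\<lbrakk>g \<in> carrier G; h \<in> carrier G\<rbrakk> \<Longrightarrow> lam g h \<noteq> 0"
    and cocycle: "\<lbrakk>a \<in> carrier G; b \<in> carrier G; c \<in> carrier G\<rbrakk> \<Longrightarrow>
      lam a (b \<otimes> c) * lam b c = lam (a \<otimes> b) c * \<sigma> c (lam a b)"
    and action: "\<lbrakk>a \<in> carrier G; b \<in> carrier G\<rbrakk> \<Longrightarrow> \<sigma> b (\<sigma> a \<alpha>) = \<sigma> (a \<otimes> b) \<alpha>"

text \<open>A formal sum is represented by its coefficient function. The convolution formula comes from
  \<open>(g\<^sup>~ \<alpha>) (h\<^sup>~ \<beta>) = (g h)\<^sup>~ \<lambda>(g,h) \<sigma>(h)(\<alpha>) \<beta>\<close>, where \<open>g\<^sup>~\<close> denotes the basis element of \<open>g\<close>.\<close>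

definition crossed_product ::
  "('g, 'm) monoid_scheme \<Rightarrow> ('g \<Rightarrow> 'f::field \<Rightarrow> 'f) \<Rightarrow> ('g \<Rightarrow> 'g \<Rightarrow> 'f) \<Rightarrow> ('g \<Rightarrow> 'f) ring" where
  "crossed_product G \<sigma> lam =
    \<lparr>carrier = {x. finite {g. x g \<noteq> 0} \<and> {g. x g \<noteq> 0} \<subseteq> carrier G},
     monoid.mult = (\<lambda>x y k. \<Sum>(g, h) \<in> {(g, h). x g \<noteq> 0 \<and> y h \<noteq> 0 \<and> g \<otimes>\<^bsub>G\<^esub> h = k}.
                      lam g h * \<sigma> h (x g) * y h),
     one = (\<lambda>k. if k = \<one>\<^bsub>G\<^esub> then inverse (lam \<one>\<^bsub>G\<^esub> \<one>\<^bsub>G\<^esub>) else 0),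
     zero = (\<lambda>k. 0),
     add = (\<lambda>x y k. x k + y k)\<rparr>"

locale twisted_system = crossed_system G "\<lambda>_. id" lam
  for G :: "('g, 'm) monoid_scheme" (structure) and lam :: "'g \<Rightarrow> 'g \<Rightarrow> 'f::field" +
  assumes normalized: "h \<in> carrier G \<Longrightarrow> lam h \<one> = 1" "h \<in> carrier G \<Longrightarrow> lam \<one> h = 1"

abbreviation twisted_group_algebra ::
  "('g, 'm) monoid_scheme \<Rightarrow> ('g \<Rightarrow> 'g \<Rightarrow> 'f::field) \<Rightarrow> ('g \<Rightarrow> 'f) ring" where
  "twisted_group_algebra G lam \<equiv> crossed_product G (\<lambda>_. id) lam"

section \<open>Lie powers\<close>

definition lie_commutators :: "('r, 'm) ring_scheme \<Rightarrow> 'r set \<Rightarrow> 'r set \<Rightarrow> 'r set" where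
  "lie_commutators R A B = generate (add_monoid R)
     {x \<otimes>\<^bsub>R\<^esub> y \<ominus>\<^bsub>R\<^esub> y \<otimes>\<^bsub>R\<^esub> x | x y. x \<in> A \<and> y \<in> B}"

definition additive_product :: "('r, 'm) ring_scheme \<Rightarrow> 'r set \<Rightarrow> 'r set \<Rightarrow> 'r set" where
  "additive_product R A B = generate (add_monoid R) {x \<otimes>\<^bsub>R\<^esub> y | x y. x \<in> A \<and> y \<in> B}"

text \<open>The powers below are indexed from \<open>1\<close>; at index \<open>0\<close> they agree with index \<open>1\<close>.\<close>

definition lie_gamma :: "('r, 'm) ring_scheme \<Rightarrow> nat \<Rightarrow> 'r set" where
  "lie_gamma R n = ((\<lambda>A. lie_commutators R A (carrier R)) ^^ (n - 1)) (carrier R)"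

definition lower_lie_power :: "('r, 'm) ring_scheme \<Rightarrow> nat \<Rightarrow> 'r set" where
  "lower_lie_power R n = additive_product R (lie_gamma R n) (carrier R)"

definition upper_lie_power :: "('r, 'm) ring_scheme \<Rightarrow> nat \<Rightarrow> 'r set" where
  "upper_lie_power R n =
     ((\<lambda>A. additive_product R (lie_commutators R A (carrier R)) (carrier R)) ^^ (n - 1)) (carrier R)"

definition lower_lie_nilpotent :: "('r, 'm) ring_scheme \<Rightarrow> bool" where
  "lower_lie_nilpotent R \<longleftrightarrow> (\<exists>n\<ge>1. lower_lie_power R n = {\<zero>\<^bsub>R\<^esub>})"

definition upper_lie_nilpotent :: "('r, 'm) ring_scheme \<Rightarrow> bool" where
  "upper_lie_nilpotent R \<longleftrightarrow> (\<exists>n\<ge>1. upper_lie_power R n = {\<zero>\<^bsub>R\<^esub>})"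

section \<open>Groups and twists\<close>

text \<open>This convention differs from the one in \<^const>\<open>derived\<close>; both generate the same
  commutator subgroup.\<close>

definition group_commutator :: "('g, 'm) monoid_scheme \<Rightarrow> 'g \<Rightarrow> 'g \<Rightarrow> 'g" where
  "group_commutator G a b = inv\<^bsub>G\<^esub> a \<otimes>\<^bsub>G\<^esub> inv\<^bsub>G\<^esub> b \<otimes>\<^bsub>G\<^esub> a \<otimes>\<^bsub>G\<^esub> b"

primrec lower_central :: "('g, 'm) monoid_scheme \<Rightarrow> nat \<Rightarrow> 'g set" where
  "lower_central G 0 = carrier G"
| "lower_central G (Suc n) =
     generate G {group_commutator G x y | x y. x \<in> lower_central G n \<and> y \<in> carrier G}"

definition nilpotent_group :: "('g, 'm) monoid_scheme \<Rightarrow> bool" where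
  "nilpotent_group G \<longleftrightarrow> group G \<and> (\<exists>n. lower_central G n = {\<one>\<^bsub>G\<^esub>})"

text \<open>Elements of infinite order have \<^const>\<open>group.ord\<close> equal to \<open>0\<close>, which is not a power of a
  prime.\<close>

definition p_element :: "('g, 'm) monoid_scheme \<Rightarrow> nat \<Rightarrow> 'g \<Rightarrow> bool" where
  "p_element G p u \<longleftrightarrow> u \<in> carrier G \<and> (\<exists>m. group.ord G u = p ^ m)"

definition twist :: "('g, 'm) monoid_scheme \<Rightarrow> ('g \<Rightarrow> 'g \<Rightarrow> 'f::field) \<Rightarrow> 'g \<Rightarrow> 'f" where
  "twist G lam h = (\<Prod>i = 1..<group.ord G h. lam (h [^]\<^bsub>G\<^esub> i) h)"

text \<open>The multiplicative order is taken in the group of units, hence \<open>\<gamma> \<noteq> 0\<close>; a zero element has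
  no multiplicative order.\<close>

definition untwisted_p_element ::
  "('g, 'm) monoid_scheme \<Rightarrow> ('g \<Rightarrow> 'g \<Rightarrow> 'f::field) \<Rightarrow> nat \<Rightarrow> 'g \<Rightarrow> bool" where
  "untwisted_p_element G lam p u \<longleftrightarrow> p_element G p u \<and>
     (\<exists>\<gamma>. \<gamma> \<noteq> 0 \<and>
        group.ord (units_of (twisted_group_algebra G lam)) (\<lambda>k. if k = u then \<gamma> else 0)
          = group.ord G u)"

text \<open>For \<open>\<kappa> = commutator_coeff G lam a b\<close> and basis elements \<open>a\<^sup>~\<close>, \<open>b\<^sup>~\<close> of the twisted group
  algebra, the commutator of \<open>b\<^sup>~\<close> and \<open>a\<^sup>~\<close> in the unit group is \<open>(b,a)\<^sup>~ \<kappa>\<close>. Its power with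
  exponent the order \<open>k\<close> of \<open>(b,a)\<close> is therefore \<open>\<kappa>\<^sup>k \<mu>((b,a))\<close>, and it is trivial iff
  \<open>\<kappa>\<close> to the power \<open>-k\<close> equals \<open>\<mu>((b,a))\<close>. The twist has to be taken at \<open>(b,a)\<close>, not at
  \<open>(a,b) = (b,a)\<^sup>-\<^sup>1\<close>: the two twists differ in general, already for the Heisenberg group of order
  27 over the field with 3 elements and a suitable coboundary.\<close>

definition commutator_coeff ::
  "('g, 'm) monoid_scheme \<Rightarrow> ('g \<Rightarrow> 'g \<Rightarrow> 'f::field) \<Rightarrow> 'g \<Rightarrow> 'g \<Rightarrow> 'f" where
  "commutator_coeff G lam a b =
     inverse (lam a b) * lam b (inv\<^bsub>G\<^esub> b \<otimes>\<^bsub>G\<^esub> a \<otimes>\<^bsub>G\<^esub> b) * lam a (group_commutator G a b)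
       * inverse (lam (group_commutator G b a) (group_commutator G a b))"

end

theory Submission
  imports Defs "HOL-Algebra.Sylow"
begin

text \<open>
  Let \<open>P\<^sub>k\<close> be the ideal generated by the left-normed Lie commutators of length \<open>k\<close>, and let \<open>U\<close> be the
  group of trivial units. Expanding \<open>[[y, r s], t]\<close> shows \<open>P\<^sub>k P\<^sub>3 \<subseteq> P\<^sub>k\<^sub>+\<^sub>1\<close> for \<open>k \<ge> 2\<close>, and modulo
  \<open>P\<^sub>3\<close> the product \<open>[a, b] [c, d]\<close> is alternating.

  If a noncommutative twisted group algebra is lower Lie nilpotent, the last nonzero \<open>P\<^sub>k\<close> is therefore
  annihilated by \<open>P\<^sub>3\<close>. A minimality argument on the number of translates of such an element by the
  commutators of one unit produces \<open>w \<noteq> 0\<close> annihilated by all \<open>[a, b]\<close>. So the commutators of \<open>U\<close> fix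
  \<open>w\<close>, and since \<open>w\<close> has finite support, there are finitely many of them. Hence \<open>P\<^sub>2\<close> is obtained from
  \<open>P\<^sub>3\<close> by adjoining finitely many elements that are central and nilpotent modulo \<open>P\<^sub>3\<close>, which makes the
  algebra upper Lie nilpotent and \<open>P\<^sub>2\<close> nil. Group commutators of \<open>U\<close> are thus unipotent of finite order.
  This forces positive characteristic \<open>p\<close> and \<open>p\<close>-power order, and the group-theoretic conditions
  follow by mapping \<open>U\<close> onto \<open>G\<close>.

  Conversely the condition on twists says that commutators of \<open>U\<close> have \<open>p\<close>-power order. The field has no
  \<open>p\<close>-torsion, so a commutator is determined by its image in the finite group \<open>G'\<close>. Descending the lower
  central series of \<open>U\<close>, one again removes finitely many elements that are central and nilpotent modulo
  the next ideal, until the upper Lie powers vanish.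
\<close>

section \<open>Lie powers of a ring with identity\<close>

definition bracket :: "'a::ring \<Rightarrow> 'a \<Rightarrow> 'a" where
  "bracket x y = x * y - y * x"

lemma bracket_simps:
  "bracket (x + y) r = bracket x r + bracket y r"
  "bracket x (r + s) = bracket x r + bracket x s"
  "bracket 0 r = 0" "bracket x 0 = 0" "bracket x x = 0"
  "bracket (- x) r = - bracket x r" "bracket x (- r) = - bracket x r"
  by (simp_all add: bracket_def algebra_simps)

lemma bracket_mult_left: "bracket (r * s) t = r * bracket s t + bracket r t * s"
  by (simp add: bracket_def algebra_simps)

lemma bracket_swap: "bracket x y = - bracket y x"
  by (simp add: bracket_def)

text \<open>Negatives are not adjoined: the generating sets used below (the trivial units, an ideal,
  multiples by an ideal) are closed under negation, so sums already give a subgroup.\<close>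

inductive_set add_gen :: "'a::monoid_add set \<Rightarrow> 'a set" for S where
  add_gen_base: "s \<in> S \<Longrightarrow> s \<in> add_gen S"
| add_gen_zero: "0 \<in> add_gen S"
| add_gen_add: "x \<in> add_gen S \<Longrightarrow> y \<in> add_gen S \<Longrightarrow> x + y \<in> add_gen S"

lemma add_gen_least:
  assumes "S \<subseteq> A" "0 \<in> A" "\<And>x y. x \<in> A \<Longrightarrow> y \<in> A \<Longrightarrow> x + y \<in> A"
  shows "add_gen S \<subseteq> A"
proof
  fix x assume "x \<in> add_gen S"
  then show "x \<in> A" by induction (use assms in auto)
qed

lemma add_gen_image:
  assumes "x \<in> add_gen S" "\<And>s. s \<in> S \<Longrightarrow> f s \<in> add_gen T" "f 0 = 0"
    "\<And>x y. f (x + y) = f x + f y"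
  shows "f x \<in> add_gen T"
  using assms(1) by induction (use assms in \<open>auto intro: add_gen_zero add_gen_add\<close>)

text \<open>Working with a subset of a type of class \<open>ring_1\<close> lets ring identities be
  settled by \<open>algebra_simps\<close>. The type is supplied later by a ring of
  endomorphisms.\<close>

locale type_subring =
  fixes R :: "'a::ring_1 set"
  assumes one_mem: "1 \<in> R"
    and diff_mem: "x \<in> R \<Longrightarrow> y \<in> R \<Longrightarrow> x - y \<in> R"
    and mult_mem: "x \<in> R \<Longrightarrow> y \<in> R \<Longrightarrow> x * y \<in> R"
begin

lemma zero_mem: "0 \<in> R"
  using diff_mem[OF one_mem one_mem] by simp

lemma uminus_mem: "x \<in> R \<Longrightarrow> - x \<in> R"
  using diff_mem[OF zero_mem] by fastforce

lemma add_mem: "x \<in> R \<Longrightarrow> y \<in> R \<Longrightarrow> x + y \<in> R"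
  using diff_mem[of x "- y"] uminus_mem by simp

lemma power_mem: "x \<in> R \<Longrightarrow> x ^ n \<in> R"
  by (induction n) (auto intro: one_mem mult_mem)

lemma bracket_mem: "x \<in> R \<Longrightarrow> y \<in> R \<Longrightarrow> bracket x y \<in> R"
  by (simp add: bracket_def diff_mem mult_mem)

lemmas mem = one_mem diff_mem mult_mem zero_mem uminus_mem add_mem power_mem bracket_mem

section \<open>Two-sided ideals\<close>

definition is_ideal :: "'a set \<Rightarrow> bool" where
  "is_ideal I \<longleftrightarrow> I \<subseteq> R \<and> 0 \<in> I \<and> (\<forall>x\<in>I. \<forall>y\<in>I. x + y \<in> I) \<and>
     (\<forall>x\<in>I. \<forall>r\<in>R. r * x \<in> I \<and> x * r \<in> I)"

lemma is_idealI:
  assumes "I \<subseteq> R" "0 \<in> I" "\<And>x y. x \<in> I \<Longrightarrow> y \<in> I \<Longrightarrow> x + y \<in> I"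
    "\<And>x r. x \<in> I \<Longrightarrow> r \<in> R \<Longrightarrow> r * x \<in> I" "\<And>x r. x \<in> I \<Longrightarrow> r \<in> R \<Longrightarrow> x * r \<in> I"
  shows "is_ideal I"
  using assms by (auto simp: is_ideal_def)

lemma ideal_sub: "is_ideal I \<Longrightarrow> x \<in> I \<Longrightarrow> x \<in> R"
  and ideal_zero: "is_ideal I \<Longrightarrow> 0 \<in> I"
  and ideal_add: "is_ideal I \<Longrightarrow> x \<in> I \<Longrightarrow> y \<in> I \<Longrightarrow> x + y \<in> I"
  and ideal_left: "is_ideal I \<Longrightarrow> r \<in> R \<Longrightarrow> x \<in> I \<Longrightarrow> r * x \<in> I"
  and ideal_right: "is_ideal I \<Longrightarrow> r \<in> R \<Longrightarrow> x \<in> I \<Longrightarrow> x * r \<in> I"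
  by (auto simp: is_ideal_def)

lemma ideal_uminus: "is_ideal I \<Longrightarrow> x \<in> I \<Longrightarrow> - x \<in> I"
  using ideal_left[of I "- 1" x] uminus_mem[OF one_mem] by simp

lemma ideal_diff: "is_ideal I \<Longrightarrow> x \<in> I \<Longrightarrow> y \<in> I \<Longrightarrow> x - y \<in> I"
  using ideal_add[of I x "- y"] ideal_uminus by simp

lemma ideal_bracket: "is_ideal I \<Longrightarrow> r \<in> R \<Longrightarrow> x \<in> I \<Longrightarrow> bracket x r \<in> I"
  by (simp add: bracket_def ideal_diff ideal_left ideal_right)

inductive_set ideal_gen :: "'a set \<Rightarrow> 'a set" for S where
  ideal_gen_base: "s \<in> S \<Longrightarrow> s \<in> ideal_gen S"
| ideal_gen_zero: "0 \<in> ideal_gen S"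
| ideal_gen_add: "x \<in> ideal_gen S \<Longrightarrow> y \<in> ideal_gen S \<Longrightarrow> x + y \<in> ideal_gen S"
| ideal_gen_left: "x \<in> ideal_gen S \<Longrightarrow> r \<in> R \<Longrightarrow> r * x \<in> ideal_gen S"
| ideal_gen_right: "x \<in> ideal_gen S \<Longrightarrow> r \<in> R \<Longrightarrow> x * r \<in> ideal_gen S"

lemma ideal_gen_least: "is_ideal I \<Longrightarrow> S \<subseteq> I \<Longrightarrow> ideal_gen S \<subseteq> I"
proof
  fix x assume "is_ideal I" "S \<subseteq> I" "x \<in> ideal_gen S"
  from this(3,1,2) show "x \<in> I"
    by (induction rule: ideal_gen.induct) (auto simp: is_ideal_def)
qed

lemma ideal_R: "is_ideal R"
  by (rule is_idealI) (auto intro: mem)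

lemma ideal_ideal_gen: "S \<subseteq> R \<Longrightarrow> is_ideal (ideal_gen S)"
  using ideal_gen_least[OF ideal_R] by (auto intro!: is_idealI intro: ideal_gen.intros)

lemma ideal_gen_mono: "S \<subseteq> T \<Longrightarrow> T \<subseteq> R \<Longrightarrow> ideal_gen S \<subseteq> ideal_gen T"
  by (rule ideal_gen_least[OF ideal_ideal_gen]) (auto intro: ideal_gen_base)

text \<open>The index is shifted: \<open>lower n\<close> and \<open>upper n\<close> are the Lie powers with index \<open>n + 1\<close>.\<close>

fun commutators :: "nat \<Rightarrow> 'a set" where
  "commutators 0 = R"
| "commutators (Suc n) = {bracket x r | x r. x \<in> commutators n \<and> r \<in> R}"

abbreviation lower :: "nat \<Rightarrow> 'a set" where "lower n \<equiv> ideal_gen (commutators n)"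

fun upper :: "nat \<Rightarrow> 'a set" where
  "upper 0 = R"
| "upper (Suc n) = ideal_gen {bracket x r | x r. x \<in> upper n \<and> r \<in> R}"

section \<open>Ideals given by the lower and upper Lie powers\<close>

lemma commutators_sub: "commutators n \<subseteq> R"
  by (induction n) (auto intro: mem)

lemma commutators_decreasing: "commutators (Suc n) \<subseteq> commutators n"
proof (induction n)
  case 0 then show ?case by (auto intro: mem)
next
  case (Suc n)
  show ?case
  proof
    fix z assume "z \<in> commutators (Suc (Suc n))"
    then obtain x r where z: "z = bracket x r" and x: "x \<in> commutators (Suc n)" and r: "r \<in> R"
      by auto
    from x Suc have "x \<in> commutators n" by blast
    with z r show "z \<in> commutators (Suc n)" by auto
  qed
qed

lemma ideal_lower: "is_ideal (lower n)"
  by (rule ideal_ideal_gen[OF commutators_sub])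

lemma lower_decreasing: "lower (Suc n) \<subseteq> lower n"
  by (rule ideal_gen_mono[OF commutators_decreasing commutators_sub])

lemma lower_antimono: "m \<le> n \<Longrightarrow> lower n \<subseteq> lower m"
  using lower_decreasing by (rule lift_Suc_antimono_le)

lemma ideal_upper: "is_ideal (upper n)"
proof (induction n)
  case 0 then show ?case by (simp add: ideal_R)
next
  case (Suc n)
  then show ?case
    by (auto intro!: ideal_ideal_gen intro: bracket_mem dest: ideal_sub)
qed

lemma upper_bracket: "x \<in> upper n \<Longrightarrow> r \<in> R \<Longrightarrow> bracket x r \<in> upper (Suc n)"
  by (auto intro: ideal_gen_base)

lemma lower_bracket: "x \<in> commutators n \<Longrightarrow> r \<in> R \<Longrightarrow> bracket x r \<in> lower (Suc n)"
  by (auto intro: ideal_gen_base)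

lemma upper_1: "upper 1 = lower 1"
  by simp

declare commutators.simps(2) [simp del] upper.simps(2) [simp del]

section \<open>Products of Lie commutators\<close>

lemma lower_swap:
  assumes y: "y \<in> commutators k" and r: "r \<in> R" and s: "s \<in> R" and t: "t \<in> R"
  shows "bracket y s * bracket r t + bracket y r * bracket s t \<in> lower (Suc (Suc k))"
proof -
  let ?P = "lower (Suc (Suc k))"
  note I = ideal_lower[of "Suc (Suc k)"]
  have C: "bracket y u \<in> commutators (Suc k)" if "u \<in> R" for u
    using that y by (auto simp: commutators.simps)
  have c: "bracket (bracket y u) v \<in> ?P" if "u \<in> R" "v \<in> R" for u v
    using that by (intro lower_bracket C)
  \<comment> \<open>Expanding \<open>[[y, r s], t]\<close> leaves
    \<open>[r, t] [y, s] + [y, r] [s, t]\<close> besides terms with a longer commutator of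
    \<open>y\<close>. The last summand exchanges the factors of the first product.\<close>
  have "bracket (bracket y (r * s)) t - r * bracket (bracket y s) t - bracket (bracket y r) t * s
     + bracket (bracket y s) (bracket r t) \<in> ?P"
    by (intro ideal_add[OF I] ideal_diff[OF I] ideal_left[OF I] ideal_right[OF I] c mem r s t)
  also have "bracket (bracket y (r * s)) t - r * bracket (bracket y s) t - bracket (bracket y r) t * s
     + bracket (bracket y s) (bracket r t) = bracket y s * bracket r t + bracket y r * bracket s t"
    by (simp add: bracket_def algebra_simps)
  finally show ?thesis .
qed

text \<open>As a function of its first argument, the symmetrized product of
  \<open>lower_swap\<close> fails the derivation rule at \<open>r * q\<close> exactly by
  \<open>[y, r] [[s, t], q] - [[y, s], r] [q, t]\<close>. Everything except the first of these
  products is already known to lie in the ideal.\<close>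

lemma lower_triple:
  assumes y: "y \<in> commutators k" and r: "r \<in> R" and q: "q \<in> R" and s: "s \<in> R" and t: "t \<in> R"
  shows "bracket y r * bracket (bracket s t) q \<in> lower (Suc (Suc k))"
proof -
  let ?P = "lower (Suc (Suc k))"
  note I = ideal_lower[of "Suc (Suc k)"]
  define f where "f u v w = bracket y u * bracket v w + bracket y v * bracket u w" for u v w
  have f: "f u v w \<in> ?P" if "u \<in> R" "v \<in> R" "w \<in> R" for u v w
    unfolding f_def using lower_swap[OF y] that by blast
  have c: "bracket (bracket y u) v \<in> ?P" if "u \<in> R" "v \<in> R" for u v
    using that y by (intro lower_bracket) (auto simp: commutators.simps)
  have "r * f q s t + f r s t * q - f (r * q) s t + bracket (bracket y s) r * bracket q t \<in> ?P"
    by (intro ideal_add[OF I] ideal_diff[OF I] ideal_left[OF I] ideal_right[OF I] c f mem r s t q)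
  also have "r * f q s t + f r s t * q - f (r * q) s t + bracket (bracket y s) r * bracket q t
      = bracket y r * bracket (bracket s t) q"
    by (simp add: f_def bracket_def algebra_simps)
  finally show ?thesis .
qed

text \<open>The identity \<open>z (r x) = r (z x) + [z, r] x\<close> makes the right annihilator of
  \<open>z\<close> modulo \<open>I\<close> closed under left multiplication.\<close>

lemma central_mod_ideal:
  assumes I: "is_ideal I" and z: "z \<in> R" "\<And>r. r \<in> R \<Longrightarrow> bracket z r \<in> I"
  shows "is_ideal {u \<in> R. z * u \<in> I}"
proof (rule is_idealI)
  fix x r assume x: "x \<in> {u \<in> R. z * u \<in> I}" and r: "r \<in> R"
  have "bracket z r * x + r * (z * x) \<in> I"
    using x r z by (simp add: ideal_add[OF I] ideal_left[OF I] ideal_right[OF I])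
  also have "bracket z r * x + r * (z * x) = z * (r * x)" by (simp add: bracket_def algebra_simps)
  finally show "r * x \<in> {u \<in> R. z * u \<in> I}" using x r by (auto intro: mem)
  show "x * r \<in> {u \<in> R. z * u \<in> I}" using x r
    by (auto intro: mem ideal_right[OF I] simp flip: mult.assoc)
qed (use ideal_zero[OF I] ideal_add[OF I] in \<open>auto simp: mem distrib_left\<close>)

text \<open>A commutator in \<open>commutators (Suc k)\<close> is central modulo the next ideal, so
  the elements it multiplies into that ideal form an ideal, and \<open>lower_triple\<close> puts the
  generators of \<open>lower 2\<close> there. The left factors that work for all of
  \<open>lower 2\<close> form an ideal as well.\<close>

lemma lower_mult_lower2:
  assumes x: "x \<in> lower (Suc k)" and t: "t \<in> lower 2"
  shows "x * t \<in> lower (Suc (Suc k))"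
proof -
  let ?P = "lower (Suc (Suc k))"
  note I = ideal_lower[of "Suc (Suc k)"]
  have z: "z * t \<in> ?P" if z: "z \<in> commutators (Suc k)" and t: "t \<in> lower 2" for z t
  proof -
    have "z \<in> R" using z commutators_sub by blast
    then have "is_ideal {u \<in> R. z * u \<in> ?P}"
      using lower_bracket[OF z] by (intro central_mod_ideal[OF I])
    moreover have "commutators 2 \<subseteq> {u \<in> R. z * u \<in> ?P}"
    proof
      fix u assume "u \<in> commutators 2"
      then obtain a b c where "u = bracket (bracket a b) c" "a \<in> R" "b \<in> R" "c \<in> R"
        by (auto simp: numeral_2_eq_2 commutators.simps)
      moreover from z obtain y r where "z = bracket y r" "y \<in> commutators k" "r \<in> R"
        by (auto simp: commutators.simps)
      ultimately show "u \<in> {u \<in> R. z * u \<in> ?P}" using lower_triple by (simp add: mem)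
    qed
    ultimately show ?thesis using ideal_gen_least t by blast
  qed
  have "is_ideal {u \<in> R. \<forall>t \<in> lower 2. u * t \<in> ?P}"
  proof (rule is_idealI)
    fix u r assume "u \<in> {u \<in> R. \<forall>t \<in> lower 2. u * t \<in> ?P}" "r \<in> R"
    then show "r * u \<in> {u \<in> R. \<forall>t \<in> lower 2. u * t \<in> ?P}" "u * r \<in> {u \<in> R. \<forall>t \<in> lower 2. u * t \<in> ?P}"
      using ideal_left[OF ideal_lower[of 2]] ideal_left[OF I] by (auto simp: mem mult.assoc)
  next
    fix u v assume "u \<in> {u \<in> R. \<forall>t \<in> lower 2. u * t \<in> ?P}" "v \<in> {u \<in> R. \<forall>t \<in> lower 2. u * t \<in> ?P}"
    then show "u + v \<in> {u \<in> R. \<forall>t \<in> lower 2. u * t \<in> ?P}"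
      using ideal_add[OF I] by (auto simp: mem distrib_right)
  qed (use ideal_zero[OF I] in \<open>auto simp: mem\<close>)
  moreover have "commutators (Suc k) \<subseteq> {u \<in> R. \<forall>t \<in> lower 2. u * t \<in> ?P}"
    using z commutators_sub by blast
  ultimately have "lower (Suc k) \<subseteq> {u \<in> R. \<forall>t \<in> lower 2. u * t \<in> ?P}" by (rule ideal_gen_least)
  with x t show ?thesis by blast
qed

lemma bracket_bracket_lower2: "a \<in> R \<Longrightarrow> b \<in> R \<Longrightarrow> c \<in> R \<Longrightarrow> bracket (bracket a b) c \<in> lower 2"
  by (auto simp: numeral_2_eq_2 commutators.simps intro!: ideal_gen_base)

lemma bracket_swap_lower2:
  assumes "a \<in> R" "b \<in> R" "c \<in> R" "d \<in> R"
  shows "bracket a b * bracket c d + bracket a c * bracket b d \<in> lower 2"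
  using lower_swap[of a 0 c b d] assms by (simp add: numeral_2_eq_2)

text \<open>A repeated argument kills the second product of \<open>bracket_swap_lower2\<close>. For
  \<open>b = c\<close> this says that brackets square to zero modulo \<open>lower 2\<close>.\<close>

lemma bracket_repeat_lower2:
  assumes "a \<in> R" "b \<in> R" "c \<in> R"
  shows "bracket a b * bracket a c \<in> lower 2"
  using bracket_swap_lower2[of a b a c] assms by (simp add: bracket_simps)

text \<open>The second conjunct asks for the commutator ideal to be nil modulo \<open>I\<close>.\<close>

definition absorbing :: "'a set \<Rightarrow> bool" where
  "absorbing I \<longleftrightarrow> (\<exists>n. upper n \<subseteq> I) \<and> (\<forall>x \<in> upper 1. \<exists>k. x ^ k \<in> I)"

lemma absorbing_mono: "absorbing I \<Longrightarrow> I \<subseteq> J \<Longrightarrow> absorbing J"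
  unfolding absorbing_def by blast

section \<open>Removing central nilpotent elements from an ideal\<close>

lemma power_central:
  assumes I: "is_ideal I" and z: "z \<in> R" "\<And>r. r \<in> R \<Longrightarrow> bracket z r \<in> I" and r: "r \<in> R"
  shows "bracket (z ^ j) r \<in> I"
proof (induction j)
  case 0 then show ?case by (simp add: bracket_def ideal_zero[OF I])
next
  case (Suc j)
  then show ?case using z r
    by (simp add: bracket_mult_left ideal_add[OF I] ideal_left[OF I] ideal_right[OF I] mem)
qed

lemma ideal_add_multiples:
  assumes I: "is_ideal I" and z: "z \<in> R" "\<And>r. r \<in> R \<Longrightarrow> bracket z r \<in> I" and J: "is_ideal J"
  shows "is_ideal {i + z * u | i u. i \<in> I \<and> u \<in> J}"
proof (rule is_idealI)
  show "{i + z * u | i u. i \<in> I \<and> u \<in> J} \<subseteq> R"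
    using z ideal_sub[OF I] ideal_sub[OF J] by (auto intro!: mem)
  show "0 \<in> {i + z * u | i u. i \<in> I \<and> u \<in> J}"
    using ideal_zero[OF I] ideal_zero[OF J] by force
next
  fix x y assume "x \<in> {i + z * u | i u. i \<in> I \<and> u \<in> J}" "y \<in> {i + z * u | i u. i \<in> I \<and> u \<in> J}"
  then obtain i u j v where "x = i + z * u" "y = j + z * v" "i \<in> I" "j \<in> I" "u \<in> J" "v \<in> J" by blast
  then have "x + y = (i + j) + z * (u + v)" "i + j \<in> I" "u + v \<in> J"
    using ideal_add I J by (auto simp: algebra_simps)
  then show "x + y \<in> {i + z * u | i u. i \<in> I \<and> u \<in> J}" by blast
next
  fix x r assume "x \<in> {i + z * u | i u. i \<in> I \<and> u \<in> J}" and r: "r \<in> R"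
  then obtain i u where x: "x = i + z * u" "i \<in> I" "u \<in> J" by blast
  have "r * x = (r * i - bracket z r * u) + z * (r * u)"
    by (simp add: x bracket_def algebra_simps)
  moreover have "r * i - bracket z r * u \<in> I" "r * u \<in> J"
    using x r z ideal_sub[OF J]
    by (simp_all add: ideal_diff[OF I] ideal_left[OF I] ideal_right[OF I] ideal_left[OF J])
  ultimately show "r * x \<in> {i + z * u | i u. i \<in> I \<and> u \<in> J}" by blast
  have "x * r = i * r + z * (u * r)" by (simp add: x algebra_simps)
  moreover have "i * r \<in> I" "u * r \<in> J" using x r ideal_right I J by auto
  ultimately show "x * r \<in> {i + z * u | i u. i \<in> I \<and> u \<in> J}" by blast
qed

lemma ideal_gen_insert:
  assumes I: "is_ideal I" and z: "z \<in> R" "\<And>r. r \<in> R \<Longrightarrow> bracket z r \<in> I"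
  shows "ideal_gen (insert z I) \<subseteq> {i + z * u | i u. i \<in> I \<and> u \<in> R}"
proof (rule ideal_gen_least[OF ideal_add_multiples[OF assms ideal_R]])
  have "z = 0 + z * 1" by simp
  moreover have "i = i + z * 0" for i by simp
  ultimately show "insert z I \<subseteq> {i + z * u | i u. i \<in> I \<and> u \<in> R}"
    using ideal_zero[OF I] zero_mem one_mem by blast
qed

text \<open>Modulo \<open>I\<close> one has \<open>[z u, r] = z [u, r]\<close>. Once a Lie power
  lies in \<open>I + z R\<close>, further commutators therefore act on the cofactor of
  \<open>z\<close> alone.\<close>

lemma upper_shift:
  assumes I: "is_ideal I" and z: "z \<in> R" "\<And>r. r \<in> R \<Longrightarrow> bracket z r \<in> I"
    and m: "upper m \<subseteq> {i + z * u | i u. i \<in> I \<and> u \<in> R}"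
  shows "upper (m + t) \<subseteq> {i + z * u | i u. i \<in> I \<and> u \<in> upper t}"
proof (induction t)
  case 0 then show ?case using m by simp
next
  case (Suc t)
  have "{bracket x r | x r. x \<in> upper (m + t) \<and> r \<in> R} \<subseteq> {i + z * u | i u. i \<in> I \<and> u \<in> upper (Suc t)}"
  proof safe
    fix x r assume x: "x \<in> upper (m + t)" and r: "r \<in> R"
    from x Suc obtain i u where iu: "x = i + z * u" "i \<in> I" "u \<in> upper t" by blast
    have "bracket x r = (bracket i r + bracket z r * u) + z * bracket u r"
      by (simp add: iu bracket_def algebra_simps)
    moreover have "bracket i r + bracket z r * u \<in> I"
      using iu r z ideal_sub[OF ideal_upper]
      by (simp add: ideal_add[OF I] ideal_bracket[OF I] ideal_right[OF I])
    moreover have "bracket u r \<in> upper (Suc t)" by (rule upper_bracket[OF iu(3) r])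
    ultimately show "\<exists>i u. bracket x r = i + z * u \<and> i \<in> I \<and> u \<in> upper (Suc t)" by blast
  qed
  then show ?case
    using ideal_gen_least[OF ideal_add_multiples[OF I z ideal_upper[of "Suc t"]]]
    by (simp add: upper.simps(2)[of "m + t"])
qed

text \<open>Some \<open>n\<close> steps lead from \<open>R\<close> into \<open>I + z R\<close>. By
  \<open>upper_shift\<close>, repeating them on the cofactor gains one more factor \<open>z\<close>
  per round, until \<open>z ^ k\<close> falls into \<open>I\<close>. In the same way, if a power of
  \<open>x\<close> lies in \<open>I + z R\<close>, its \<open>j\<close>-th power lies in
  \<open>I + z ^ j R\<close>.\<close>

lemma absorbing_remove:
  assumes I: "is_ideal I" and z: "z \<in> R" "\<And>r. r \<in> R \<Longrightarrow> bracket z r \<in> I" and nil: "z ^ k \<in> I"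
    and abs: "absorbing (ideal_gen (insert z I))"
  shows "absorbing I"
proof -
  define S where "S j = {i + z ^ j * u | i u. i \<in> I \<and> u \<in> R}" for j
  have sub: "ideal_gen (insert z I) \<subseteq> S 1" using ideal_gen_insert[OF I z] by (simp add: S_def)
  have Sk: "S k \<subseteq> I" using nil by (auto simp: S_def ideal_add[OF I] ideal_right[OF I])
  have zj: "z ^ j \<in> R" "\<And>r. r \<in> R \<Longrightarrow> bracket (z ^ j) r \<in> I" for j
    using power_central[OF I z] z by (auto intro: mem)
  from abs obtain n where n: "upper n \<subseteq> S 1" using sub unfolding absorbing_def by blast
  have "\<exists>m. upper m \<subseteq> S j" for j
  proof (induction j)
    case 0
    have "x \<in> S 0" if "x \<in> R" for x
      unfolding S_def using that ideal_zero[OF I] by force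
    then have "upper 0 \<subseteq> S 0" by auto
    then show ?case by blast
  next
    case (Suc j)
    then obtain m where m: "upper m \<subseteq> S j" by blast
    have "upper (m + n) \<subseteq> {i + z ^ j * u | i u. i \<in> I \<and> u \<in> upper n}"
      using upper_shift[OF I zj] m unfolding S_def by blast
    also have "\<dots> \<subseteq> S (Suc j)"
    proof safe
      fix i u assume i: "i \<in> I" and "u \<in> upper n"
      with n obtain i' u' where u: "u = i' + z * u'" "i' \<in> I" "u' \<in> R" unfolding S_def by auto
      have "i + z ^ j * u = (i + z ^ j * i') + z ^ Suc j * u'"
        by (simp add: u distrib_left mult.assoc power_Suc2 del: power_Suc)
      moreover have "i + z ^ j * i' \<in> I" using i u zj by (simp add: ideal_add[OF I] ideal_left[OF I])
      ultimately show "i + z ^ j * u \<in> S (Suc j)" unfolding S_def using u by blast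
    qed
    finally show ?case by blast
  qed
  then have "\<exists>m. upper m \<subseteq> I" using Sk by blast
  moreover have "\<exists>l. x ^ l \<in> I" if x: "x \<in> upper 1" for x
  proof -
    from abs x obtain l where "x ^ l \<in> ideal_gen (insert z I)" unfolding absorbing_def by blast
    with sub obtain i u where iu: "x ^ l = i + z * u" "i \<in> I" "u \<in> R" unfolding S_def by auto
    have "(x ^ l) ^ j \<in> S j" for j
    proof (induction j)
      case 0 then show ?case unfolding S_def using ideal_zero[OF I] one_mem by force
    next
      case (Suc j)
      then obtain i' u' where j: "(x ^ l) ^ j = i' + z ^ j * u'" "i' \<in> I" "u' \<in> R"
        unfolding S_def by blast
      have "(x ^ l) ^ Suc j = (i * (i' + z ^ j * u') + z * u * i' - z * bracket (z ^ j) u * u')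
         + z ^ Suc j * (u * u')"
        unfolding power_Suc[of "x ^ l"] j(1) unfolding iu(1)
        by (simp add: bracket_def algebra_simps)
      moreover have "i * (i' + z ^ j * u') + z * u * i' - z * bracket (z ^ j) u * u' \<in> I"
        using iu j z zj ideal_sub[OF I]
        by (simp add: ideal_add[OF I] ideal_diff[OF I] ideal_left[OF I] ideal_right[OF I] mem)
      moreover have "u * u' \<in> R" using iu j by (simp add: mem)
      ultimately show ?case unfolding S_def by blast
    qed
    then show ?thesis using Sk by (metis power_mult subsetD)
  qed
  ultimately show ?thesis unfolding absorbing_def by blast
qed

text \<open>One element is removed at a time; it stays central and nilpotent modulo the larger ideal
  that still contains the remaining ones.\<close>

lemma absorbing_remove_finite:
  assumes I: "is_ideal I" and "finite Z"
    and "\<And>z. z \<in> Z \<Longrightarrow> z \<in> R" "\<And>z r. z \<in> Z \<Longrightarrow> r \<in> R \<Longrightarrow> bracket z r \<in> I"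
    and "\<And>z. z \<in> Z \<Longrightarrow> \<exists>k. z ^ k \<in> I"
    and "absorbing (ideal_gen (Z \<union> I))"
  shows "absorbing I"
  using assms(2-)
proof (induction Z rule: finite_induct)
  case empty
  then show ?case using absorbing_mono ideal_gen_least[OF I, of I] by auto
next
  case (insert z Z)
  have sub: "Z \<union> I \<subseteq> R" using insert ideal_sub[OF I] by auto
  note J = ideal_ideal_gen[OF sub]
  have IJ: "I \<subseteq> ideal_gen (Z \<union> I)" by (auto intro: ideal_gen_base)
  have "insert z Z \<union> I \<subseteq> insert z (ideal_gen (Z \<union> I))" by (auto intro: ideal_gen_base)
  then have "ideal_gen (insert z Z \<union> I) \<subseteq> ideal_gen (insert z (ideal_gen (Z \<union> I)))"
    using insert.prems(1) ideal_sub[OF J] by (intro ideal_gen_mono) auto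
  then have "absorbing (ideal_gen (insert z (ideal_gen (Z \<union> I))))"
    using insert.prems absorbing_mono by blast
  moreover obtain k where "z ^ k \<in> I" using insert.prems(3) by blast
  ultimately have "absorbing (ideal_gen (Z \<union> I))"
    using insert.prems(1,2) IJ by (intro absorbing_remove[OF J, of z k]) auto
  then show ?case using insert.prems by (intro insert.IH) auto
qed

text \<open>The generators of the old ideal are central modulo the new one but may be infinite in
  number, so they are not removed one by one. Instead \<open>m\<close> further steps push all their
  cofactors into \<open>upper m\<close>, hence into \<open>lower 2\<close>, and
  \<open>lower_mult_lower2\<close> sends the products into the new ideal.\<close>

lemma absorbing_lower_step:
  assumes m: "upper m \<subseteq> lower 2" and k: "absorbing (lower (Suc (Suc k)))"
  shows "absorbing (lower (Suc (Suc (Suc k))))"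
proof -
  let ?K = "Suc (Suc k)"
  let ?P = "lower (Suc ?K)"
  note I = ideal_lower[of "Suc ?K"]
  \<comment> \<open>The counterpart of \<open>I + z J\<close> in \<open>upper_shift\<close>, with
    all of \<open>commutators ?K\<close> in place of the single element \<open>z\<close>.\<close>
  define S where "S t = add_gen (?P \<union> {z * u | z u. z \<in> commutators ?K \<and> u \<in> upper t})" for t
  have base: "z * u \<in> S t" if "z \<in> commutators ?K" "u \<in> upper t" for z u t
    using that unfolding S_def by (auto intro: add_gen_base)
  have P: "x \<in> S t" if "x \<in> ?P" for x t using that unfolding S_def by (auto intro: add_gen_base)
  have add: "x + y \<in> S t" if "x \<in> S t" "y \<in> S t" for x y t
    using that unfolding S_def by (rule add_gen_add)
  have CR: "z \<in> R" if "z \<in> commutators ?K" for z using that commutators_sub by blast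
  have uR: "u \<in> R" if "u \<in> upper t" for u t using that ideal_sub[OF ideal_upper] by blast
  have c: "bracket z r \<in> ?P" if "z \<in> commutators ?K" "r \<in> R" for z r
    using that by (rule lower_bracket)
  have SR: "S t \<subseteq> R" for t
    unfolding S_def using CR uR ideal_sub[OF I] by (intro add_gen_least) (auto simp: mem)
  have ideal: "is_ideal (S t)" for t
  proof (rule is_idealI)
    fix x r assume x: "x \<in> S t" and r: "r \<in> R"
    show "r * x \<in> S t" using x unfolding S_def
    proof (rule add_gen_image)
      fix s assume "s \<in> ?P \<union> {z * u | z u. z \<in> commutators ?K \<and> u \<in> upper t}"
      then consider "s \<in> ?P" | z u where "s = z * u" "z \<in> commutators ?K" "u \<in> upper t" by blast
      then have "r * s \<in> S t"
      proof cases
        case 1 then show ?thesis by (intro P ideal_left[OF I r])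
      next
        case 2
        have "- bracket z r * u + z * (r * u) \<in> S t"
          using 2 r c uR by (intro add base P ideal_left[OF ideal_upper] ideal_right[OF I] ideal_uminus[OF I])
        then show ?thesis by (simp add: 2 bracket_def algebra_simps)
      qed
      then show "r * s \<in> add_gen (?P \<union> {z * u | z u. z \<in> commutators ?K \<and> u \<in> upper t})"
        by (simp add: S_def)
    qed (simp_all add: distrib_left)
    show "x * r \<in> S t" using x unfolding S_def
    proof (rule add_gen_image)
      fix s assume "s \<in> ?P \<union> {z * u | z u. z \<in> commutators ?K \<and> u \<in> upper t}"
      then consider "s \<in> ?P" | z u where "s = z * u" "z \<in> commutators ?K" "u \<in> upper t" by blast
      then have "s * r \<in> S t"
        by cases (simp_all add: P ideal_right[OF I r] mult.assoc base ideal_right[OF ideal_upper r])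
      then show "s * r \<in> add_gen (?P \<union> {z * u | z u. z \<in> commutators ?K \<and> u \<in> upper t})"
        by (simp add: S_def)
    qed (simp_all add: distrib_right)
  qed (use SR add P[OF ideal_zero[OF I]] in auto)
  have shift: "bracket x r \<in> S (Suc t)" if x: "x \<in> S t" and r: "r \<in> R" for x r t
    using x unfolding S_def
  proof (rule add_gen_image[where f = "\<lambda>x. bracket x r"])
    fix s assume "s \<in> ?P \<union> {z * u | z u. z \<in> commutators ?K \<and> u \<in> upper t}"
    then consider "s \<in> ?P" | z u where "s = z * u" "z \<in> commutators ?K" "u \<in> upper t" by blast
    then have "bracket s r \<in> S (Suc t)"
    proof cases
      case 1 then show ?thesis by (intro P ideal_bracket[OF I r])
    next
      case 2
      have "z * bracket u r + bracket z r * u \<in> S (Suc t)"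
        using 2 r c uR by (intro add base P upper_bracket ideal_right[OF I])
      then show ?thesis by (simp add: 2 bracket_mult_left)
    qed
    then show "bracket s r \<in> add_gen (?P \<union> {z * u | z u. z \<in> commutators ?K \<and> u \<in> upper (Suc t)})"
      by (simp add: S_def)
  qed (simp_all add: bracket_simps)
  from k obtain l where l: "upper l \<subseteq> lower ?K" unfolding absorbing_def by blast
  have "upper (l + t) \<subseteq> S t" for t
  proof (induction t)
    case 0
    have "commutators ?K \<subseteq> S 0" using base[of _ 1 0] one_mem by auto
    then have "lower ?K \<subseteq> S 0" by (rule ideal_gen_least[OF ideal])
    with l show ?case by simp
  next
    case (Suc t)
    then have "{bracket x r | x r. x \<in> upper (l + t) \<and> r \<in> R} \<subseteq> S (Suc t)" using shift by blast
    then show ?case using ideal_gen_least[OF ideal] by (simp add: upper.simps)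
  qed
  moreover have "S m \<subseteq> ?P"
    unfolding S_def
    using lower_mult_lower2[of _ "Suc k"] m
    by (intro add_gen_least) (auto intro: ideal_zero[OF I] ideal_add[OF I] ideal_gen_base)
  ultimately have "upper (l + m) \<subseteq> ?P" by blast
  moreover have "\<exists>j. x ^ j \<in> ?P" if x: "x \<in> upper 1" for x
  proof -
    from k x obtain j where j: "x ^ j \<in> lower ?K" unfolding absorbing_def by blast
    \<comment> \<open>The power lies in both \<open>lower ?K\<close> and \<open>lower 2\<close>, so
      its square falls into \<open>?P\<close>.\<close>
    then have "x ^ j \<in> lower 2" using lower_antimono[of 2 ?K] by auto
    with j have "x ^ j * x ^ j \<in> ?P" by (intro lower_mult_lower2)
    then show ?thesis by (metis power_add)
  qed
  ultimately show ?thesis unfolding absorbing_def by blast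
qed

lemma absorbing_lower:
  assumes "absorbing (lower 2)"
  shows "absorbing (lower (Suc (Suc k)))"
proof (induction k)
  case 0 then show ?case using assms by (simp add: numeral_2_eq_2)
next
  case (Suc k)
  from assms obtain m where "upper m \<subseteq> lower 2" unfolding absorbing_def by blast
  then show ?case using Suc by (rule absorbing_lower_step)
qed

end

section \<open>Rings spanned by a group of units\<close>

lemma of_nat_left_commute: "x * (of_nat n * y) = of_nat n * (x * y)" for x :: "'a::semiring_1"
  by (metis mult.assoc mult_of_nat_commute)

lemma one_plus_power:
  fixes x :: "'a::ring_1"
  shows "(1 + x) ^ n = (\<Sum>k\<le>n. of_nat (n choose k) * x ^ k)"
proof (induction n)
  case 0 then show ?case by simp
next
  case (Suc n)
  have "(1 + x) ^ Suc n = (\<Sum>k\<le>n. of_nat (n choose k) * x ^ k) + (\<Sum>k\<le>n. of_nat (n choose k) * x ^ Suc k)"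
    by (simp add: Suc distrib_right sum_distrib_left distrib_left of_nat_left_commute sum.distrib)
  also have "(\<Sum>k\<le>n. of_nat (n choose k) * x ^ k) = (\<Sum>k\<le>Suc n. of_nat (n choose k) * x ^ k)"
    by (simp add: binomial_eq_0)
  also have "\<dots> = 1 + (\<Sum>k\<le>n. of_nat (n choose Suc k) * x ^ Suc k)"
    by (subst sum.atMost_Suc_shift) (simp del: sum.atMost_Suc power_Suc)
  finally show ?case
    by (subst sum.atMost_Suc_shift) (simp add: add.assoc distrib_right flip: sum.distrib, simp add: add.commute)
qed

text \<open>The Frobenius rule survives without commutativity of the ring because \<open>1\<close>
  commutes with \<open>x\<close>; the inner binomial coefficients are divisible by
  \<open>p\<close>.\<close>

lemma one_plus_prime_power:
  fixes x :: "'a::ring_1"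
  assumes p: "prime p" and char: "of_nat p = (0 :: 'a)"
  shows "(1 + x) ^ (p ^ k) = 1 + x ^ (p ^ k)"
proof (induction k)
  case 0 then show ?case by simp
next
  case (Suc k)
  have step: "(1 + y) ^ p = 1 + y ^ p" for y :: 'a
  proof -
    have "of_nat (p choose i) = (0 :: 'a)" if "i \<in> {..p} - {0, p}" for i
    proof -
      have "p dvd p choose i" using that p by (intro dvd_choose_prime) auto
      then show ?thesis using char by (auto simp: dvd_def)
    qed
    then have "(1 + y) ^ p = (\<Sum>i\<in>{0, p}. of_nat (p choose i) * y ^ i)"
      unfolding one_plus_power by (intro sum.mono_neutral_right) auto
    then show ?thesis using p by (auto simp: prime_gt_0_nat)
  qed
  have "(1 + x) ^ (p ^ Suc k) = ((1 + x) ^ (p ^ k)) ^ p" by (simp only: power_Suc2 power_mult)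
  also have "\<dots> = 1 + x ^ (p ^ Suc k)" by (simp only: Suc step power_Suc2 power_mult)
  finally show ?case .
qed

lemma nilpotent_least:
  fixes x :: "'a::ring_1"
  assumes "x ^ k = 0" "x \<noteq> 0"
  obtains j where "j \<ge> 1" "x ^ j \<noteq> 0" "x ^ Suc j = 0"
proof -
  define l where "l = (LEAST k. x ^ k = 0)"
  have l: "x ^ l = 0" unfolding l_def using assms(1) by (rule LeastI)
  have least: "x ^ i \<noteq> 0" if "i < l" for i using not_less_Least that unfolding l_def by blast
  from assms(2) have "(1::'a) \<noteq> 0" by (metis mult_1 mult_zero_left)
  with l assms(2) have "l \<noteq> 0" "l \<noteq> 1" by (metis power_0, metis power_one_right)
  then show ?thesis using l least[of "l - 1"] by (intro that[of "l - 1"]) auto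
qed

text \<open>In \<open>(1 + x)\<^sup>m = 1\<close> the terms of order at least two vanish after multiplication by the
  second-to-last nonzero power of \<open>x\<close>.\<close>

lemma unipotent_torsion:
  fixes x :: "'a::ring_1"
  assumes nil: "x ^ k = 0" and x: "x \<noteq> 0" and m: "(1 + x) ^ m = 1"
  obtains y :: 'a where "y \<noteq> 0" "of_nat m * y = 0"
proof -
  from nilpotent_least[OF nil x] obtain j where j: "j \<ge> 1" "x ^ j \<noteq> 0" "x ^ Suc j = 0" .
  have e: "(1 + x) ^ n * x ^ (j - 1) = x ^ (j - 1) + of_nat n * x ^ j" for n
  proof (induction n)
    case 0 then show ?case by simp
  next
    case (Suc n)
    have "x * x ^ (j - 1) = x ^ j" using j(1) by (simp flip: power_Suc)
    then show ?case using Suc j(3) by (simp add: mult.assoc distrib_right distrib_left of_nat_left_commute)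
  qed
  from e[of m] m have "of_nat m * x ^ j = 0" by simp
  with j(2) that show ?thesis by blast
qed

section \<open>Inverses and commutators of units\<close>

definition unit_inv :: "'a::monoid_mult \<Rightarrow> 'a" where
  "unit_inv u = (THE v. u * v = 1 \<and> v * u = 1)"

definition unit_commutator :: "'a::monoid_mult \<Rightarrow> 'a \<Rightarrow> 'a" where
  "unit_commutator u v = unit_inv u * unit_inv v * u * v"

text \<open>In the application \<open>U\<close> consists of the trivial units, that is, the nonzero
  scalar multiples of basis elements. The assumption \<open>finite_stabilizer\<close> is the form in
  which the finiteness of supports enters.\<close>

locale unit_spanned = type_subring R for R :: "'a::ring_1 set" +
  fixes U :: "'a set"
  assumes U_one: "1 \<in> U" and U_mult: "u \<in> U \<Longrightarrow> v \<in> U \<Longrightarrow> u * v \<in> U"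
    and U_inv: "u \<in> U \<Longrightarrow> \<exists>v\<in>U. u * v = 1 \<and> v * u = 1"
    and R_span: "R = add_gen U"
    and finite_stabilizer: "w \<in> R \<Longrightarrow> w \<noteq> 0 \<Longrightarrow> finite {u \<in> U. w * u = w}"
begin

lemma U_sub: "u \<in> U \<Longrightarrow> u \<in> R"
  unfolding R_span by (rule add_gen_base)

lemma unit_inv:
  assumes "u \<in> U" shows "unit_inv u \<in> U" "u * unit_inv u = 1" "unit_inv u * u = 1"
proof -
  from U_inv[OF assms] obtain v where v: "v \<in> U" "u * v = 1" "v * u = 1" by blast
  have "unit_inv u = v" unfolding unit_inv_def
  proof (rule the_equality)
    fix v' assume "u * v' = 1 \<and> v' * u = 1"
    then show "v' = v" using v by (metis mult.assoc mult_1 mult_1_right)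
  qed (use v in simp)
  then show "unit_inv u \<in> U" "u * unit_inv u = 1" "unit_inv u * u = 1" using v by auto
qed

lemma unit_inv_cancel:
  assumes "u \<in> U"
  shows "u * (unit_inv u * x) = x" "unit_inv u * (u * x) = x"
  using unit_inv[OF assms] by (simp_all flip: mult.assoc)

lemma U_cancel_zero: "u \<in> U \<Longrightarrow> x * u = 0 \<Longrightarrow> x = 0"
proof -
  assume u: "u \<in> U" and "x * u = 0"
  then have "(x * u) * unit_inv u = 0" by simp
  then show "x = 0" using unit_inv(2)[OF u] by (simp add: mult.assoc)
qed

lemma unit_commutator_mem: "u \<in> U \<Longrightarrow> v \<in> U \<Longrightarrow> unit_commutator u v \<in> U"
  by (simp add: unit_commutator_def U_mult unit_inv)

lemma mult_commutator: "u \<in> U \<Longrightarrow> v \<in> U \<Longrightarrow> v * u * unit_commutator u v = u * v"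
  by (simp add: unit_commutator_def mult.assoc unit_inv_cancel)

lemma bracket_commutator:
  "u \<in> U \<Longrightarrow> v \<in> U \<Longrightarrow> bracket u v = v * u * (unit_commutator u v - 1)"
  using mult_commutator[of u v] by (simp add: bracket_def right_diff_distrib)

lemma commutator_bracket:
  "u \<in> U \<Longrightarrow> v \<in> U \<Longrightarrow> unit_commutator u v - 1 = unit_inv u * unit_inv v * bracket u v"
  by (simp add: bracket_commutator mult.assoc unit_inv_cancel)

lemma bracket_span:
  assumes I: "is_ideal I" and S: "\<And>u. u \<in> U \<Longrightarrow> bracket z u \<in> I" and r: "r \<in> R"
  shows "bracket z r \<in> I"
  using r unfolding R_span
proof induction
  case add_gen_zero then show ?case by (simp add: bracket_simps ideal_zero[OF I])
next
  case (add_gen_add x y) then show ?case by (simp add: bracket_simps ideal_add[OF I])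
qed (rule S)

lemma bracket_span2:
  assumes I: "is_ideal I" and S: "\<And>u v. u \<in> U \<Longrightarrow> v \<in> U \<Longrightarrow> bracket u v \<in> I"
    and r: "r \<in> R" and s: "s \<in> R"
  shows "bracket r s \<in> I"
proof -
  have "bracket u r \<in> I" if "u \<in> U" for u using bracket_span[OF I S r] that .
  then have "bracket r u \<in> I" if "u \<in> U" for u
    using ideal_uminus[OF I, of "bracket u r"] that bracket_swap[of r u] by simp
  then show ?thesis using bracket_span[OF I _ s] by blast
qed

lemma unipotent_mult:
  assumes I: "is_ideal I" "u - 1 \<in> I" "v - 1 \<in> I" "v \<in> R" shows "u * v - 1 \<in> I"
proof -
  have "(u - 1) * v + (v - 1) \<in> I" by (intro ideal_add[OF I(1)] ideal_right[OF I(1)] I)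
  then show ?thesis by (simp add: algebra_simps)
qed

lemma unipotent_inv:
  assumes I: "is_ideal I" "u - 1 \<in> I" "u \<in> U" shows "unit_inv u - 1 \<in> I"
proof -
  have "- unit_inv u * (u - 1) \<in> I" using assms unit_inv U_sub by (intro ideal_left[OF I(1)]) (auto simp: mem)
  then show ?thesis using unit_inv[OF assms(3)] by (simp add: algebra_simps)
qed

text \<open>\<open>[u - 1, v] = [u, v]\<close>, and \<open>(u, v) - 1\<close> is a unit multiple of
  \<open>[u, v]\<close>.\<close>

lemma unipotent_commutator:
  assumes "u \<in> U" "v \<in> U" "u - 1 \<in> upper n"
  shows "unit_commutator u v - 1 \<in> upper (Suc n)"
proof -
  have "bracket (u - 1) v \<in> upper (Suc n)" using assms U_sub by (intro upper_bracket) auto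
  then have "bracket u v \<in> upper (Suc n)" by (simp add: bracket_def algebra_simps)
  then have "unit_inv u * unit_inv v * bracket u v \<in> upper (Suc n)"
    using ideal_left[OF ideal_upper mult_mem[OF U_sub U_sub]] assms unit_inv(1) by blast
  then show ?thesis by (simp add: commutator_bracket assms)
qed

lemma unit_commutator_right_one: "u \<in> U \<Longrightarrow> unit_commutator u 1 = 1"
  using unit_inv(3)[OF U_one] by (simp add: unit_commutator_def unit_inv)

text \<open>Among the \<open>v\<close> with \<open>v P\<^sub>3 = 0\<close> and units \<open>r\<close> not commuting with everything after multiplication by
  \<open>v\<close>, minimize the number of distinct \<open>v (r, t)\<close>. Passing from \<open>v\<close> to \<open>v [a, b]\<close> identifies \<open>v\<close> with
  \<open>v (r, a)\<close>, so the minimal \<open>v [r, s]\<close> is annihilated by all \<open>[a, b]\<close>.\<close>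

lemma ex_annihilator:
  assumes nil: "lower n = {0}" and noncomm: "lower 1 \<noteq> {0}"
  obtains w where "w \<in> R" "w \<noteq> 0" "\<And>u v. u \<in> U \<Longrightarrow> v \<in> U \<Longrightarrow> w * bracket u v = 0"
proof -
  \<comment> \<open>The first index at which the series vanishes. It is at least 2, and by
    \<open>lower_mult_lower2\<close> the nonzero elements of the layer before it can serve as
    members of \<open>V\<close>.\<close>
  define l where "l = (LEAST n. lower n = {0})"
  have l: "lower l = {0}" unfolding l_def using nil by (rule LeastI)
  have least: "lower i \<noteq> {0}" if "i < l" for i using not_less_Least that unfolding l_def by blast
  have "l \<noteq> 1" using l noncomm by metis
  moreover have "l \<noteq> 0"
    using l noncomm lower_antimono[of 0 1] ideal_zero[OF ideal_lower[of 1]] by auto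
  ultimately obtain k where k: "l = Suc (Suc k)" by (metis One_nat_def not0_implies_Suc)
  define T where "T = lower 2"
  have T: "is_ideal T" unfolding T_def by (rule ideal_lower)
  define V where "V = {v \<in> R. v \<noteq> 0 \<and> (\<forall>t\<in>T. v * t = 0)}"
  have ex_V: "\<exists>v. v \<in> V"
  proof -
    have "lower (Suc k) \<noteq> {0}" using least k by simp
    then obtain v where v: "v \<in> lower (Suc k)" "v \<noteq> 0" using ideal_zero[OF ideal_lower[of "Suc k"]] by blast
    have "v * t = 0" if "t \<in> T" for t
      using lower_mult_lower2[OF v(1), of t] that l k unfolding T_def by auto
    with v show ?thesis using ideal_sub[OF ideal_lower v(1)] unfolding V_def by blast
  qed
  have RU: "u \<in> R" if "u \<in> U" for u using that by (rule U_sub)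
  have tri: "bracket (bracket a b) c \<in> T" if "a \<in> R" "b \<in> R" "c \<in> R" for a b c
    using bracket_bracket_lower2 that by (simp add: T_def)
  define A where "A v r = (\<lambda>t. v * unit_commutator r t) ` U" for v r
  have descent: "\<exists>v\<in>V. \<exists>r\<in>U. \<exists>s\<in>U. v * bracket r s \<noteq> 0 \<and> card (A v r) < m"
    if none: "\<And>w. w \<in> R \<Longrightarrow> w \<noteq> 0 \<Longrightarrow> \<exists>u\<in>U. \<exists>v\<in>U. w * bracket u v \<noteq> 0"
      and v: "v \<in> V" and r: "r \<in> U" and s: "s \<in> U" and w0: "v * bracket r s \<noteq> 0"
      and m: "m = card (A v r)" for v r s m
  proof -
    have vR: "v \<in> R" and vt: "\<And>t. t \<in> T \<Longrightarrow> v * t = 0" using v unfolding V_def by auto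
    \<comment> \<open>Since \<open>v\<close> kills \<open>T\<close>, which contains every
      \<open>[[a, b], x]\<close>, brackets commute with all factors to the right of
      \<open>v\<close>.\<close>
    have slide: "v * x * bracket a b = v * bracket a b * x" if "a \<in> R" "b \<in> R" "x \<in> R" for a b x
      using vt[OF tri[OF that]] by (simp add: bracket_def[of "bracket a b"] right_diff_distrib mult.assoc)
    define w where "w = v * bracket r s"
    have "w \<in> R" unfolding w_def using vR r s by (simp add: mem RU)
    with none w0 obtain a b where ab: "a \<in> U" "b \<in> U" "w * bracket a b \<noteq> 0" unfolding w_def by blast
    note [simp] = RU[OF r] RU[OF s] RU[OF ab(1)] RU[OF ab(2)] bracket_mem
    have repeat: "v * (bracket x y * bracket x z) = 0" if "x \<in> R" "y \<in> R" "z \<in> R" for x y z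
      using vt bracket_repeat_lower2[OF that] by (simp add: T_def)
    have inv_comm: "v * (unit_commutator r t - 1) = v * bracket r t * (unit_inv r * unit_inv t)"
      if t: "t \<in> U" for t
      using slide[of r t "unit_inv r * unit_inv t"] that r
      by (simp add: commutator_bracket mem RU unit_inv mult.assoc)
    define v' where "v' = v * bracket a b"
    have v's: "v' * bracket r s = w * bracket a b"
      unfolding v'_def w_def using slide[of r s "bracket a b"] by simp
    then have v'0: "v' * bracket r s \<noteq> 0" using ab by simp
    have v': "v' \<in> V"
      unfolding V_def
    proof safe
      show "v' \<in> R" unfolding v'_def by (simp add: mult_mem vR)
      show "v' = 0 \<Longrightarrow> False" using v'0 by simp
      show "v' * t = 0" if "t \<in> T" for t
        unfolding v'_def mult.assoc using that by (intro vt ideal_left[OF T]) simp_all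
    qed
    have comm: "unit_commutator r t \<in> U" if "t \<in> U" for t using that r by (rule unit_commutator_mem[rotated])
    \<comment> \<open>Finiteness comes from the stabilizer of \<open>w = v [r, s]\<close>: after
      sliding, \<open>w ((r, t) - 1)\<close> contains the product \<open>[r, s] [r, t]\<close>, an
      element of \<open>T\<close>, so \<open>w\<close> is fixed by every
      \<open>(r, t)\<close>.\<close>
    have "A v r \<subseteq> (\<lambda>u. v * u) ` {u \<in> U. w * u = w}"
    proof
      fix x assume "x \<in> A v r"
      then obtain t where t: "t \<in> U" "x = v * unit_commutator r t" unfolding A_def by blast
      have "w * (unit_commutator r t - 1) = v * bracket r s * (unit_inv r * unit_inv t) * bracket r t"
        using r t by (simp add: w_def commutator_bracket mult.assoc)
      also have "\<dots> = v * (unit_inv r * unit_inv t) * bracket r s * bracket r t"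
        using r t by (subst slide) (simp_all add: mem RU unit_inv)
      also have "\<dots> = v * ((unit_inv r * unit_inv t) * (bracket r s * bracket r t))"
        by (simp add: mult.assoc)
      also have "\<dots> = 0"
        using bracket_repeat_lower2[of r s t] r t
        by (intro vt[OF ideal_left[OF T]]) (simp_all add: mem RU unit_inv T_def)
      finally have "w * unit_commutator r t = w" by (simp add: right_diff_distrib)
      then show "x \<in> (\<lambda>u. v * u) ` {u \<in> U. w * u = w}" using t comm by blast
    qed
    then have fin: "finite (A v r)"
      using finite_stabilizer[OF \<open>w \<in> R\<close>] w0 unfolding w_def by (blast intro: finite_subset)
    let ?f = "\<lambda>x. x * bracket a b"
    have im: "A v' r = ?f ` A v r"
    proof -
      have "v' * unit_commutator r t = ?f (v * unit_commutator r t)" if "t \<in> U" for t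
        unfolding v'_def using slide[of a b "unit_commutator r t"] comm[OF that] RU by simp
      then show ?thesis unfolding A_def by (simp add: image_image)
    qed
    have "v \<in> A v r" unfolding A_def using unit_commutator_right_one[OF r] U_one by force
    moreover have "v * unit_commutator r a \<in> A v r" unfolding A_def using ab by blast
    \<comment> \<open>Equality would give \<open>v [r, a] = 0\<close>, and exchanging
      \<open>b\<close> and \<open>r\<close> in \<open>v [a, b] [r, s]\<close> would then make
      \<open>v' [r, s]\<close> vanish.\<close>
    moreover have "v \<noteq> v * unit_commutator r a"
    proof
      assume "v = v * unit_commutator r a"
      then have "v * bracket r a * (unit_inv r * unit_inv a) = 0"
        using inv_comm[OF ab(1)] by (simp add: right_diff_distrib)
      then have z: "v * bracket r a = 0"
        using U_cancel_zero U_mult unit_inv(1) r ab(1) by blast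
      have "v * (bracket a b * bracket r s + bracket a r * bracket b s) = 0"
        using bracket_swap_lower2[of a b r s] by (intro vt) (simp add: T_def)
      then have "v * bracket a b * bracket r s - v * bracket r a * bracket b s = 0"
        by (subst bracket_swap[of r a]) (simp add: distrib_left mult.assoc)
      then show False using z v'0 by (simp add: v'_def)
    qed
    \<comment> \<open>After sliding, the difference contains \<open>[a, b] [r, a]\<close>, which
      lies in \<open>T\<close> because \<open>a\<close> is repeated. Thus \<open>?f\<close>
      identifies two distinct translates and the cardinality drops.\<close>
    moreover have "?f v = ?f (v * unit_commutator r a)"
    proof -
      have "v * (unit_commutator r a - 1) * bracket a b
          = v * (bracket r a * (unit_inv r * unit_inv a)) * bracket a b"
        by (simp add: inv_comm[OF ab(1)] mult.assoc)
      also have "\<dots> = v * bracket a b * (bracket r a * (unit_inv r * unit_inv a))"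
        using r ab by (subst slide) (simp_all add: mem RU unit_inv)
      also have "\<dots> = v * (bracket a b * bracket r a) * (unit_inv r * unit_inv a)"
        by (simp add: mult.assoc)
      also have "v * (bracket a b * bracket r a) = 0"
        using repeat[of a b r] by (subst bracket_swap[of r a]) simp
      finally show ?thesis by (simp add: right_diff_distrib left_diff_distrib)
    qed
    ultimately have "\<not> inj_on ?f (A v r)" unfolding inj_on_def by blast
    then have "card (A v' r) < card (A v r)"
      unfolding im using card_image_le[OF fin, of ?f] eq_card_imp_inj_on[OF fin, of ?f]
      by (metis le_neq_implies_less)
    then show ?thesis using v' r s v'0 m by blast
  qed
  note witness = that
  show ?thesis
  proof (rule ccontr)
    assume "\<not> thesis"
    then have none: "\<exists>u\<in>U. \<exists>v\<in>U. w * bracket u v \<noteq> 0" if "w \<in> R" "w \<noteq> 0" for w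
      using witness that by blast
    have "\<not> (\<exists>v\<in>V. \<exists>r\<in>U. \<exists>s\<in>U. v * bracket r s \<noteq> 0 \<and> card (A v r) = m)" for m
    proof (induction m rule: less_induct)
      case (less m)
      then show ?case using descent[OF none] by blast
    qed
    then show False using ex_V none unfolding V_def by blast
  qed
qed

section \<open>Consequences of finitely many commutators of units\<close>

definition group_commutators :: "'a set" where
  "group_commutators = {unit_commutator u v | u v. u \<in> U \<and> v \<in> U}"

lemma lower_1_commutators: "lower 1 \<subseteq> ideal_gen {c - 1 | c. c \<in> group_commutators}"
proof -
  have sub: "{c - 1 | c. c \<in> group_commutators} \<subseteq> R"
    by (auto simp: group_commutators_def mem U_sub unit_commutator_mem)
  note I = ideal_ideal_gen[OF sub]
  have "bracket u v \<in> ideal_gen {c - 1 | c. c \<in> group_commutators}" if "u \<in> U" "v \<in> U" for u v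
    unfolding bracket_commutator[OF that]
    using that by (intro ideal_left[OF I] ideal_gen_base)
      (auto simp: group_commutators_def mem U_sub unit_commutator_mem)
  then have "bracket r s \<in> ideal_gen {c - 1 | c. c \<in> group_commutators}" if "r \<in> R" "s \<in> R" for r s
    using bracket_span2[OF I _ that] by blast
  then show ?thesis by (intro ideal_gen_least[OF I]) (auto simp: commutators.simps)
qed

lemma finite_commutators_absorbing:
  assumes fin: "finite group_commutators" and nil: "lower n = {0}"
  shows "absorbing {0}"
proof -
  let ?T = "lower 2"
  note T = ideal_lower[of 2]
  \<comment> \<open>The elements to be removed are Lie brackets, one for each group commutator
    \<open>c\<close>: a bracket is central modulo \<open>lower 2\<close> and squares to zero there,
    while \<open>c - 1\<close> is a left multiple of it.\<close>
  have "\<exists>z. \<exists>u\<in>U. \<exists>v\<in>U. z = bracket u v \<and> (\<exists>q\<in>R. c - 1 = q * z)" if "c \<in> group_commutators" for c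
  proof -
    from that obtain u v where uv: "u \<in> U" "v \<in> U" "c = unit_commutator u v"
      unfolding group_commutators_def by blast
    moreover have "unit_inv u * unit_inv v \<in> R" using uv by (simp add: mem U_sub unit_inv)
    ultimately show ?thesis using commutator_bracket[OF uv(1,2)] by blast
  qed
  then obtain z where z: "\<And>c. c \<in> group_commutators \<Longrightarrow>
      \<exists>u\<in>U. \<exists>v\<in>U. z c = bracket u v \<and> (\<exists>q\<in>R. c - 1 = q * z c)" by metis
  have "absorbing ?T"
  proof (rule absorbing_remove_finite[OF T, of "z ` group_commutators"])
    show "finite (z ` group_commutators)" using fin by simp
    show "x \<in> R" if "x \<in> z ` group_commutators" for x
      using that z by (force simp: mem U_sub)
    show "bracket x r \<in> ?T" if x: "x \<in> z ` group_commutators" and r: "r \<in> R" for x r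
    proof -
      from x z obtain u v where "u \<in> U" "v \<in> U" "x = bracket u v" by force
      then show ?thesis using bracket_bracket_lower2 r U_sub by simp
    qed
    show "\<exists>k. x ^ k \<in> ?T" if x: "x \<in> z ` group_commutators" for x
    proof -
      from x z obtain u v where "u \<in> U" "v \<in> U" "x = bracket u v" by force
      then have "x ^ 2 \<in> ?T" using bracket_repeat_lower2[of u v v] U_sub by (simp add: power2_eq_square)
      then show ?thesis by blast
    qed
    have sub: "z ` group_commutators \<union> ?T \<subseteq> R"
      using z ideal_sub[OF T] by (force simp: mem U_sub)
    note I = ideal_ideal_gen[OF sub]
    have "{c - 1 | c. c \<in> group_commutators} \<subseteq> ideal_gen (z ` group_commutators \<union> ?T)"
    proof safe
      fix c assume c: "c \<in> group_commutators"
      with z obtain q where q: "q \<in> R" "c - 1 = q * z c" by meson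
      show "c - 1 \<in> ideal_gen (z ` group_commutators \<union> ?T)"
        unfolding q(2) using c q(1) by (intro ideal_left[OF I] ideal_gen_base) auto
    qed
    then have "lower 1 \<subseteq> ideal_gen (z ` group_commutators \<union> ?T)"
      using lower_1_commutators ideal_gen_least[OF I] by blast
    then show "absorbing (ideal_gen (z ` group_commutators \<union> ?T))"
      unfolding absorbing_def upper_1 by (metis power_one_right subsetD upper_1)
  qed
  \<comment> \<open>Starting from \<open>lower 2\<close>, the descent arrives at index
    \<open>n + 2\<close>, whose ideal is contained in \<open>lower n\<close>.\<close>
  then have "absorbing (lower (Suc (Suc n)))" by (rule absorbing_lower)
  then show ?thesis using absorbing_mono lower_antimono[of n "Suc (Suc n)"] nil by auto
qed

text \<open>All powers of \<open>u\<close> fix \<open>w\<close>, so finiteness of the stabilizer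
  forces two of them to coincide.\<close>

lemma unipotent_finite_order:
  assumes w: "w \<in> R" "w \<noteq> 0" and u: "u \<in> U" "w * u = w"
  obtains m where "m > 0" "u ^ m = 1"
proof -
  have pU: "u ^ i \<in> U" for i by (induction i) (auto intro: U_one U_mult u)
  have "w * u ^ i = w" for i by (induction i) (simp_all add: u(2) flip: mult.assoc)
  then have "range (\<lambda>i. u ^ i) \<subseteq> {u \<in> U. w * u = w}" using pU by auto
  then have "finite (range (\<lambda>i. u ^ i))" using finite_stabilizer[OF w] finite_subset by blast
  then have "\<not> inj (\<lambda>i::nat. u ^ i)" using finite_imageD infinite_UNIV_nat by blast
  then obtain i j where ij: "i < j" "u ^ i = u ^ j"
    unfolding inj_def by (metis linorder_neqE_nat)
  have "u ^ i * u ^ (j - i) = u ^ i * 1" using ij by (metis le_add_diff_inverse less_imp_le mult_1_right power_add)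
  then have "u ^ (j - i) = 1" using unit_inv_cancel(2)[OF pU[of i]] by metis
  then show ?thesis using that[of "j - i"] ij by simp
qed

lemma unipotent_prime_power_order:
  assumes p: "prime p" "of_nat p = (0 :: 'a)" and nil: "absorbing {0}" and u: "u - 1 \<in> upper 1"
  obtains k where "u ^ (p ^ k) = 1"
proof -
  from nil u obtain l where l: "(u - 1) ^ l = 0" unfolding absorbing_def by blast
  \<comment> \<open>This makes the exponent \<open>p ^ l\<close> large enough to kill the nilpotent
    term of the Frobenius rule.\<close>
  have "l < p ^ l" using prime_gt_1_nat[OF p(1)] by (simp add: power_gt_expt)
  then have "(u - 1) ^ (p ^ l) = 0" using l power_add[of "u - 1" l "p ^ l - l"] by simp
  then show ?thesis using one_plus_prime_power[OF p, of "u - 1" l] that[of l] by simp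
qed

text \<open>These are the left-normed commutators themselves, not the subgroups they generate. From
  index 1 on they stay inside \<open>group_commutators\<close> and so inherit its finiteness and
  torsion.\<close>

fun group_lower :: "nat \<Rightarrow> 'a set" where
  "group_lower 0 = U"
| "group_lower (Suc n) = {unit_commutator x g | x g. x \<in> group_lower n \<and> g \<in> U}"

lemma group_lower_sub: "group_lower n \<subseteq> U"
  by (induction n) (auto intro: unit_commutator_mem)

lemma group_lower_Suc: "group_lower (Suc n) \<subseteq> group_commutators"
  using group_lower_sub by (auto simp: group_commutators_def)

text \<open>The identity \<open>[x - 1, u] = u x ((x, u) - 1)\<close> makes \<open>x - 1\<close>
  central modulo the ideal belonging to the next commutators, and the Frobenius rule makes it
  nilpotent. Each layer of the series thus costs the removal of finitely many elements.\<close>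

lemma group_nilpotent_absorbing:
  assumes p: "prime p" "of_nat p = (0 :: 'a)" and fin: "finite group_commutators"
    and tors: "\<And>c. c \<in> group_commutators \<Longrightarrow> \<exists>k. c ^ (p ^ k) = 1"
    and nil: "group_lower N = {1}"
  shows "absorbing {0}"
proof -
  define J where "J n = ideal_gen {x - 1 | x. x \<in> group_lower n}" for n
  have sub: "{x - 1 | x. x \<in> group_lower n} \<subseteq> R" for n
    using group_lower_sub[of n] U_sub by (auto intro!: diff_mem one_mem)
  have J: "is_ideal (J n)" for n unfolding J_def by (rule ideal_ideal_gen[OF sub])
  have J_base: "x - 1 \<in> J n" if "x \<in> group_lower n" for x n
    unfolding J_def using that by (auto intro: ideal_gen_base)
  have "absorbing (J (Suc n))" for n
  proof (induction n)
    case 0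
    have "group_lower (Suc 0) = group_commutators" by (auto simp: group_commutators_def)
    then have "lower 1 \<subseteq> J (Suc 0)" using lower_1_commutators by (simp only: J_def)
    then show ?case unfolding absorbing_def by (metis One_nat_def power_one_right subsetD upper_1)
  next
    case (Suc n)
    let ?Z = "{x - 1 | x. x \<in> group_lower (Suc n)}"
    show ?case
    proof (rule absorbing_remove_finite[OF J, of ?Z])
      have "?Z = (\<lambda>x. x - 1) ` group_lower (Suc n)" by auto
      then show "finite ?Z" using finite_subset[OF group_lower_Suc fin] by simp
      show "z \<in> R" if "z \<in> ?Z" for z using that sub by blast
      show "bracket z r \<in> J (Suc (Suc n))" if z: "z \<in> ?Z" and r: "r \<in> R" for z r
      proof (rule bracket_span[OF J _ r])
        fix u assume u: "u \<in> U"
        from z obtain x where x: "z = x - 1" "x \<in> group_lower (Suc n)" by blast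
        then have xU: "x \<in> U" using group_lower_sub by blast
        have "bracket z u = u * x * (unit_commutator x u - 1)"
          using bracket_commutator[OF xU u] by (simp add: x(1) bracket_def algebra_simps)
        also have "\<dots> \<in> J (Suc (Suc n))"
          using x(2) u by (intro ideal_left[OF J mult_mem[OF U_sub[OF u] U_sub[OF xU]]] J_base) auto
        finally show "bracket z u \<in> J (Suc (Suc n))" .
      qed
      show "\<exists>k. z ^ k \<in> J (Suc (Suc n))" if "z \<in> ?Z" for z
      proof -
        from that obtain x where x: "z = x - 1" "x \<in> group_lower (Suc n)" by blast
        with group_lower_Suc tors obtain k where "x ^ (p ^ k) = 1" by blast
        then have "z ^ (p ^ k) = 0" using one_plus_prime_power[OF p, of "x - 1" k] by (simp add: x(1))
        then show ?thesis using ideal_zero[OF J[of "Suc (Suc n)"]] by (intro exI[of _ "p ^ k"]) simp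
      qed
      show "absorbing (ideal_gen (?Z \<union> J (Suc (Suc n))))"
        using Suc
      proof (rule absorbing_mono)
        show "J (Suc n) \<subseteq> ideal_gen (?Z \<union> J (Suc (Suc n)))"
          unfolding J_def[of "Suc n"] using sub[of "Suc n"] ideal_sub[OF J[of "Suc (Suc n)"]]
          by (intro ideal_gen_mono) blast+
      qed
    qed
  qed
  \<comment> \<open>The induction runs over the indices from 1 on, so the vanishing is read off one
    step after \<open>N\<close>.\<close>
  moreover have "J (Suc N) \<subseteq> {0}"
  proof -
    have "unit_commutator 1 u = 1" if "u \<in> U" for u
      using unit_inv(3)[OF U_one] unit_inv(3)[OF that] by (simp add: unit_commutator_def)
    then have "group_lower (Suc N) \<subseteq> {1}" using nil by auto
    moreover have "is_ideal {0}" by (rule is_idealI) (auto intro: zero_mem)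
    ultimately show ?thesis unfolding J_def by (intro ideal_gen_least) (auto simp del: group_lower.simps)
  qed
  ultimately show ?thesis by (rule absorbing_mono)
qed

end

section \<open>Representing a twisted group algebra by endomorphisms\<close>

typedef (overloaded) ('i, 'f) endo =
  "{h :: ('i \<Rightarrow> 'f::field) \<Rightarrow> ('i \<Rightarrow> 'f). \<forall>x y. h (\<lambda>i. x i + y i) = (\<lambda>i. h x i + h y i)}"
  morphisms endo_apply Endo
  by (intro exI[of _ id]) simp

setup_lifting type_definition_endo

instantiation endo :: (type, field) ring_1
begin

lift_definition zero_endo :: "('a, 'b) endo" is "\<lambda>x i. 0" by simp
lift_definition one_endo :: "('a, 'b) endo" is "\<lambda>x. x" by simp
lift_definition plus_endo :: "('a, 'b) endo \<Rightarrow> ('a, 'b) endo \<Rightarrow> ('a, 'b) endo"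
  is "\<lambda>g h x i. g x i + h x i" by (simp add: algebra_simps)
lift_definition minus_endo :: "('a, 'b) endo \<Rightarrow> ('a, 'b) endo \<Rightarrow> ('a, 'b) endo"
  is "\<lambda>g h x i. g x i - h x i" by (simp add: algebra_simps)
lift_definition uminus_endo :: "('a, 'b) endo \<Rightarrow> ('a, 'b) endo" is "\<lambda>h x i. - h x i" by simp
lift_definition times_endo :: "('a, 'b) endo \<Rightarrow> ('a, 'b) endo \<Rightarrow> ('a, 'b) endo"
  is "\<lambda>g h x. g (h x)" by simp

instance
proof
  fix a b c :: "('a, 'b) endo"
  show "a * b * c = a * (b * c)" by transfer simp
  show "(a + b) * c = a * c + b * c" by transfer simp
  show "a * (b + c) = a * b + a * c" by transfer simp
  show "1 * a = a" by transfer simp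
  show "a * 1 = a" by transfer simp
  show "a + b + c = a + (b + c)" by transfer (simp add: algebra_simps)
  show "a + b = b + a" by transfer (simp add: algebra_simps)
  show "0 + a = a" by transfer simp
  show "- a + a = 0" by transfer simp
  show "a - b = a + - b" by transfer simp
  show "(0 :: ('a, 'b) endo) \<noteq> 1"
  proof transfer
    show "(\<lambda>(x :: 'a \<Rightarrow> 'b) i. 0) \<noteq> (\<lambda>x. x)"
    proof
      assume "(\<lambda>(x :: 'a \<Rightarrow> 'b) i. 0) = (\<lambda>x. x)"
      from fun_cong[OF fun_cong[OF this, of "\<lambda>_. 1"]] show False by simp
    qed
  qed
qed

end

lemma endo_apply_simps:
  "endo_apply 0 x i = 0" "endo_apply 1 x i = x i"
  "endo_apply (g + h) x i = endo_apply g x i + endo_apply h x i"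
  "endo_apply (g * h) x i = endo_apply g (endo_apply h x) i"
  by (transfer, simp)+

lemma endo_apply_sum: "endo_apply (sum h S) x i = (\<Sum>s\<in>S. endo_apply (h s) x i)"
  by (induction S rule: infinite_finite_induct) (simp_all add: endo_apply_simps)

lemma endo_apply_of_nat: "endo_apply (of_nat n * h) x i = of_nat n * endo_apply h x i"
  by (induction n) (simp_all add: endo_apply_simps algebra_simps)

lemma endo_eqI: "(\<And>x i. endo_apply g x i = endo_apply h x i) \<Longrightarrow> g = h"
  by (metis endo_apply_inject ext)

lemma of_nat_CHAR_endo: "of_nat CHAR('f) = (0 :: ('i, 'f::field) endo)"
  using endo_apply_of_nat[of "CHAR('f)" "1 :: ('i, 'f) endo"]
  by (intro endo_eqI) (simp add: endo_apply_simps)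

lift_definition weighted_shift :: "('i \<Rightarrow> 'f::field) \<Rightarrow> ('i \<Rightarrow> 'i) \<Rightarrow> ('i, 'f) endo"
  is "\<lambda>c s x i. c i * x (s i)" by (simp add: algebra_simps)

lemma weighted_shift_apply: "endo_apply (weighted_shift c s) x i = c i * x (s i)"
  by transfer simp

text \<open>The type \<open>nat \<times> 'g\<close> is infinite and at least as large as
  \<open>S\<close>, so it absorbs the factor \<open>S\<close>. For \<open>S = carrier G\<close> the
  bijection turns left multiplication on the first coordinate into a free action on the whole type,
  even if the carrier is a proper subset of \<open>'g\<close>.\<close>

lemma free_action_coordinates:
  includes cardinal_syntax
  assumes "S \<noteq> ({} :: 'g set)"
  shows "\<exists>h :: nat \<times> 'g \<Rightarrow> 'g \<times> (nat \<times> 'g). bij_betw h UNIV (S \<times> UNIV)"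
proof -
  have "inj_on (\<lambda>g. (0, g)) S" "(\<lambda>g. (0, g)) ` S \<subseteq> (UNIV :: (nat \<times> 'g) set)"
    by (auto intro: inj_onI)
  then have "|S| \<le>o |UNIV :: (nat \<times> 'g) set|" using card_of_ordLeqI by blast
  moreover have "infinite (UNIV :: (nat \<times> 'g) set)"
    by (simp add: finite_prod)
  ultimately have "|S \<times> (UNIV :: (nat \<times> 'g) set)| =o |UNIV :: (nat \<times> 'g) set|"
    using card_of_Times_infinite[of "UNIV :: (nat \<times> 'g) set" S] assms by simp
  then have "|UNIV :: (nat \<times> 'g) set| =o |S \<times> (UNIV :: (nat \<times> 'g) set)|"
    by (rule ordIso_symmetric)
  then show ?thesis by (rule iffD2[OF card_of_ordIso])
qed

definition single :: "'g \<Rightarrow> 'f \<Rightarrow> 'g \<Rightarrow> 'f::zero" where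
  "single g a = (\<lambda>k. if k = g then a else 0)"

context twisted_system
begin

section \<open>Basis elements acting on functions\<close>

definition talg :: "('g \<Rightarrow> 'f) ring" where "talg = twisted_group_algebra G lam"

lemma twisted_cocycle:
  "\<lbrakk>a \<in> carrier G; b \<in> carrier G; c \<in> carrier G\<rbrakk> \<Longrightarrow>
    lam a (b \<otimes> c) * lam b c = lam (a \<otimes> b) c * lam a b"
  using cocycle[of a b c] by simp

definition coords :: "nat \<times> 'g \<Rightarrow> 'g \<times> (nat \<times> 'g)" where
  "coords = (SOME h. bij_betw h UNIV (carrier G \<times> UNIV))"

definition point :: "'g \<times> (nat \<times> 'g) \<Rightarrow> nat \<times> 'g" where
  "point = inv_into UNIV coords"

lemma coords_bij: "bij_betw coords UNIV (carrier G \<times> UNIV)"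
  unfolding coords_def using free_action_coordinates[of "carrier G"] carrier_not_empty
  by (intro someI_ex[where P = "\<lambda>h. bij_betw h UNIV (carrier G \<times> UNIV)"]) auto

lemma fst_coords: "fst (coords i) \<in> carrier G"
  using bij_betwE[OF coords_bij] by (metis UNIV_I mem_Times_iff)

lemma coords_point: "k \<in> carrier G \<Longrightarrow> coords (point (k, i)) = (k, i)"
  unfolding point_def using coords_bij
  by (intro f_inv_into_f) (simp add: bij_betw_def)

lemma point_coords: "point (coords i) = i"
  unfolding point_def using coords_bij
  by (intro inv_into_f_f) (auto simp: bij_betw_def)

text \<open>The algebra acts from the left on functions on a set on which \<open>G\<close> acts freely, so it becomes a
  ring of additive endomorphisms. The set is a type, hence endomorphisms form an instance of
  \<^class>\<open>ring_1\<close>.\<close>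

definition basis :: "'g \<Rightarrow> 'f \<Rightarrow> (nat \<times> 'g, 'f) endo" where
  "basis g a = weighted_shift (\<lambda>i. lam g (inv g \<otimes> fst (coords i)) * a)
     (\<lambda>i. point (inv g \<otimes> fst (coords i), snd (coords i)))"

lemma basis_apply:
  "endo_apply (basis g a) x i =
    lam g (inv g \<otimes> fst (coords i)) * a * x (point (inv g \<otimes> fst (coords i), snd (coords i)))"
  by (simp add: basis_def weighted_shift_apply)

lemma basis_add: "basis g (a + b) = basis g a + basis g b"
  by (rule endo_eqI) (simp add: basis_apply endo_apply_simps algebra_simps)

lemma basis_zero: "basis g 0 = 0"
  by (rule endo_eqI) (simp add: basis_apply endo_apply_simps)

lemma basis_sum: "basis g (sum c S) = (\<Sum>s\<in>S. basis g (c s))"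
  by (induction S rule: infinite_finite_induct) (simp_all add: basis_zero basis_add)

lemma basis_one: "basis \<one> 1 = 1"
  by (rule endo_eqI) (simp add: basis_apply endo_apply_simps fst_coords normalized point_coords)

lemma basis_mult:
  assumes g: "g \<in> carrier G" and h: "h \<in> carrier G"
  shows "basis g a * basis h b = basis (g \<otimes> h) (lam g h * a * b)"
proof (rule endo_eqI)
  fix x i
  define k where "k = fst (coords i)"
  \<comment> \<open>Over a point with first coordinate \<open>k\<close>, both sides evaluate
    \<open>x\<close> at first coordinate \<open>c\<close>. The product of endomorphisms contributes
    \<open>lam g (h \<otimes> c) * lam h c\<close>, the left side of the cocycle identity.\<close>
  define c where "c = inv (g \<otimes> h) \<otimes> k"
  have k: "k \<in> carrier G" unfolding k_def by (rule fst_coords)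
  then have c: "c \<in> carrier G" unfolding c_def using g h by simp
  have e1: "inv h \<otimes> (inv g \<otimes> k) = c" unfolding c_def using g h k by (simp add: inv_mult_group m_assoc)
  have e2: "inv g \<otimes> k = h \<otimes> c" unfolding c_def using g h k
    by (simp add: inv_mult_group m_assoc inv_solve_left flip: m_assoc[of h])
  have "endo_apply (basis g a * basis h b) x i
      = (lam g (h \<otimes> c) * lam h c) * (a * b * x (point (c, snd (coords i))))"
    using g k e1 by (simp add: endo_apply_simps basis_apply coords_point flip: k_def) (simp add: e2)
  also have "\<dots> = endo_apply (basis (g \<otimes> h) (lam g h * a * b)) x i"
    using twisted_cocycle[OF g h c] by (simp add: basis_apply flip: k_def c_def)
  finally show "endo_apply (basis g a * basis h b) x i = endo_apply (basis (g \<otimes> h) (lam g h * a * b)) x i" .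
qed

section \<open>Faithfulness and multiplicativity of the representation\<close>

definition represent :: "('g \<Rightarrow> 'f) \<Rightarrow> (nat \<times> 'g, 'f) endo" where
  "represent x = (\<Sum>g | x g \<noteq> 0. basis g (x g))"

lemma represent_superset:
  assumes "finite S" "{g. x g \<noteq> 0} \<subseteq> S"
  shows "represent x = (\<Sum>g\<in>S. basis g (x g))"
  unfolding represent_def using assms by (intro sum.mono_neutral_left) (auto simp: basis_zero)

lemma carrier_talg: "x \<in> carrier talg \<longleftrightarrow> finite {g. x g \<noteq> 0} \<and> {g. x g \<noteq> 0} \<subseteq> carrier G"
  by (simp add: talg_def crossed_product_def)

lemma zero_talg: "\<zero>\<^bsub>talg\<^esub> = (\<lambda>k. 0)"
  by (simp add: talg_def crossed_product_def)

lemma add_talg: "x \<oplus>\<^bsub>talg\<^esub> y = (\<lambda>k. x k + y k)"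
  by (simp add: talg_def crossed_product_def)

lemma one_talg: "\<one>\<^bsub>talg\<^esub> = single \<one> 1"
  by (auto simp: talg_def crossed_product_def single_def normalized)

lemma mult_talg: "(x \<otimes>\<^bsub>talg\<^esub> y) k = (\<Sum>(g, h) \<in> {(g, h). x g \<noteq> 0 \<and> y h \<noteq> 0 \<and> g \<otimes> h = k}. lam g h * x g * y h)"
  by (simp add: talg_def crossed_product_def)

text \<open>Applied to a point mass over \<open>\<one>\<close>, the endomorphism displays the
  coefficients of \<open>x\<close> along an orbit, the weight being \<open>lam g \<one> = 1\<close>.
  This is the source of injectivity.\<close>

lemma represent_apply:
  assumes x: "x \<in> carrier talg" and g: "g \<in> carrier G"
  shows "endo_apply (represent x) (\<lambda>j. if j = point (\<one>, i) then 1 else 0) (point (g, i)) = x g"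
proof -
  let ?y = "\<lambda>j. if j = point (\<one>, i) then (1 :: 'f) else 0"
  have eq: "point (inv h \<otimes> g, i) = point (\<one>, i) \<longleftrightarrow> h = g" if "h \<in> carrier G" for h
  proof
    assume "point (inv h \<otimes> g, i) = point (\<one>, i)"
    then have "coords (point (inv h \<otimes> g, i)) = coords (point (\<one>, i))" by simp
    then have "inv h \<otimes> g = \<one>" using that g by (simp add: coords_point)
    then show "h = g" using that g by (metis inv_solve_left one_closed r_one)
  qed (use that in simp)
  have fin: "finite (insert g {h. x h \<noteq> 0})" using x by (simp add: carrier_talg)
  have "represent x = (\<Sum>h\<in>insert g {h. x h \<noteq> 0}. basis h (x h))"
    using fin by (rule represent_superset) auto
  then have "endo_apply (represent x) ?y (point (g, i))
      = (\<Sum>h\<in>insert g {h. x h \<noteq> 0}. endo_apply (basis h (x h)) ?y (point (g, i)))"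
    by (simp only: endo_apply_sum)
  also have "\<dots> = (\<Sum>h\<in>insert g {h. x h \<noteq> 0}. if h = g then x g else 0)"
    using x g normalized eq by (intro sum.cong refl) (auto simp: basis_apply coords_point carrier_talg)
  also have "\<dots> = x g" using fin by simp
  finally show ?thesis .
qed

lemma represent_inject:
  assumes "x \<in> carrier talg" "y \<in> carrier talg" "represent x = represent y"
  shows "x = y"
proof
  fix g show "x g = y g"
  proof (cases "g \<in> carrier G")
    case True then show ?thesis using represent_apply assms by metis
  next
    case False
    then have "x g = 0" "y g = 0" using assms(1,2) by (auto simp: carrier_talg)
    then show ?thesis by simp
  qed
qed

lemma represent_single: "represent (single g a) = basis g a"
  by (subst represent_superset[of "{g}"]) (auto simp: single_def)

lemma single_mem: "g \<in> carrier G \<Longrightarrow> single g a \<in> carrier talg"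
  by (auto simp: carrier_talg single_def)

lemma represent_zero: "represent (\<lambda>k. 0) = 0"
  by (simp add: represent_def)

lemma add_mem_talg:
  assumes "x \<in> carrier talg" "y \<in> carrier talg" shows "(\<lambda>k. x k + y k) \<in> carrier talg"
proof -
  have "{g. x g + y g \<noteq> 0} \<subseteq> {g. x g \<noteq> 0} \<union> {g. y g \<noteq> 0}" by auto
  then show ?thesis using assms unfolding carrier_talg
    by (metis (no_types, lifting) Un_least finite_UnI finite_subset subset_trans)
qed

lemma represent_add:
  assumes x: "x \<in> carrier talg" and y: "y \<in> carrier talg"
  shows "represent (\<lambda>k. x k + y k) = represent x + represent y"
proof -
  let ?S = "{g. x g \<noteq> 0} \<union> {g. y g \<noteq> 0}"
  have fin: "finite ?S" using x y by (simp add: carrier_talg)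
  have "represent (\<lambda>k. x k + y k) = (\<Sum>g\<in>?S. basis g (x g + y g))"
    by (rule represent_superset[OF fin]) auto
  also have "\<dots> = represent x + represent y"
    using represent_superset[OF fin, of x] represent_superset[OF fin, of y]
    by (simp add: basis_add sum.distrib)
  finally show ?thesis .
qed

lemma uminus_mem_talg: "x \<in> carrier talg \<Longrightarrow> (\<lambda>k. - x k) \<in> carrier talg"
  by (simp add: carrier_talg)

lemma represent_uminus:
  assumes x: "x \<in> carrier talg" shows "represent (\<lambda>k. - x k) = - represent x"
proof -
  have "represent x + represent (\<lambda>k. - x k) = 0"
    using represent_add[OF x uminus_mem_talg[OF x]] by (simp add: represent_zero)
  then show ?thesis by (simp add: eq_neg_iff_add_eq_0 add.commute)
qed

lemma mult_mem_talg:
  assumes x: "x \<in> carrier talg" and y: "y \<in> carrier talg" shows "x \<otimes>\<^bsub>talg\<^esub> y \<in> carrier talg"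
proof -
  let ?S = "{g. x g \<noteq> 0} \<times> {h. y h \<noteq> 0}"
  have "k \<in> (\<lambda>(g, h). g \<otimes> h) ` ?S" if "(x \<otimes>\<^bsub>talg\<^esub> y) k \<noteq> 0" for k
  proof (rule ccontr)
    assume "k \<notin> (\<lambda>(g, h). g \<otimes> h) ` ?S"
    then have "{(g, h). x g \<noteq> 0 \<and> y h \<noteq> 0 \<and> g \<otimes> h = k} = {}" by auto
    then have "(x \<otimes>\<^bsub>talg\<^esub> y) k = 0" unfolding mult_talg by (simp only: sum.empty)
    with that show False by blast
  qed
  then have "{k. (x \<otimes>\<^bsub>talg\<^esub> y) k \<noteq> 0} \<subseteq> (\<lambda>(g, h). g \<otimes> h) ` ?S" by blast
  moreover have "finite ((\<lambda>(g, h). g \<otimes> h) ` ?S)" using x y by (simp add: carrier_talg)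
  moreover have "(\<lambda>(g, h). g \<otimes> h) ` ?S \<subseteq> carrier G" using x y by (auto simp: carrier_talg)
  ultimately show ?thesis unfolding carrier_talg by (meson finite_subset subset_trans)
qed

lemma represent_mult:
  assumes x: "x \<in> carrier talg" and y: "y \<in> carrier talg"
  shows "represent (x \<otimes>\<^bsub>talg\<^esub> y) = represent x * represent y"
proof -
  let ?S = "{g. x g \<noteq> 0} \<times> {h. y h \<noteq> 0}"
  let ?m = "\<lambda>p. fst p \<otimes> snd p" and ?c = "\<lambda>p. lam (fst p) (snd p) * x (fst p) * y (snd p)"
  have fin: "finite ?S" using x y by (simp add: carrier_talg)
  have fib: "{(g, h). x g \<noteq> 0 \<and> y h \<noteq> 0 \<and> g \<otimes> h = k} = {p \<in> ?S. ?m p = k}" for k by auto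
  have c: "(x \<otimes>\<^bsub>talg\<^esub> y) k = sum ?c {p \<in> ?S. ?m p = k}" for k
    unfolding mult_talg fib by (simp add: case_prod_unfold)
  have "represent (x \<otimes>\<^bsub>talg\<^esub> y) = (\<Sum>k\<in>?m ` ?S. basis k ((x \<otimes>\<^bsub>talg\<^esub> y) k))"
  proof (rule represent_superset)
    show "{k. (x \<otimes>\<^bsub>talg\<^esub> y) k \<noteq> 0} \<subseteq> ?m ` ?S"
    proof
      fix k assume "k \<in> {k. (x \<otimes>\<^bsub>talg\<^esub> y) k \<noteq> 0}"
      then have "{p \<in> ?S. ?m p = k} \<noteq> {}" unfolding c by (metis (mono_tags) mem_Collect_eq sum.empty)
      then show "k \<in> ?m ` ?S" by blast
    qed
  qed (use fin in simp)
  also have "\<dots> = (\<Sum>k\<in>?m ` ?S. \<Sum>p | p \<in> ?S \<and> ?m p = k. basis (?m p) (?c p))"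
    unfolding c basis_sum by (intro sum.cong refl) auto
  also have "\<dots> = (\<Sum>p\<in>?S. basis (?m p) (?c p))"
    by (rule sum.group[OF fin]) (use fin in auto)
  also have "\<dots> = (\<Sum>p\<in>?S. basis (fst p) (x (fst p)) * basis (snd p) (y (snd p)))"
    using x y by (intro sum.cong refl) (auto simp: carrier_talg intro!: basis_mult[symmetric])
  also have "\<dots> = represent x * represent y"
    by (simp add: represent_def sum_product sum.cartesian_product case_prod_unfold)
  finally show ?thesis .
qed

lemma one_mem_talg: "\<one>\<^bsub>talg\<^esub> \<in> carrier talg"
  by (simp add: one_talg single_mem)

lemma represent_one: "represent \<one>\<^bsub>talg\<^esub> = 1"
  by (simp add: one_talg represent_single basis_one)

text \<open>Associativity and distributivity hold for endomorphisms and are pulled back along the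
  injective map \<open>represent\<close>.\<close>

lemma ring_talg: "ring talg"
proof (rule ringI)
  show "abelian_group talg"
  proof (rule abelian_groupI)
    fix x assume x: "x \<in> carrier talg"
    show "\<exists>y\<in>carrier talg. y \<oplus>\<^bsub>talg\<^esub> x = \<zero>\<^bsub>talg\<^esub>"
      using uminus_mem_talg[OF x] by (intro bexI[of _ "\<lambda>k. - x k"]) (simp_all add: add_talg zero_talg)
  qed (auto simp: add_talg zero_talg add_mem_talg algebra_simps, simp add: carrier_talg)
  show "Group.monoid talg"
    by (rule monoidI)
      (auto intro!: represent_inject simp: mult_mem_talg one_mem_talg represent_mult represent_one mult.assoc)
qed (auto intro!: represent_inject simp: add_talg add_mem_talg mult_mem_talg represent_mult represent_add algebra_simps)

interpretation talg: ring talg by (rule ring_talg)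

lemma a_inv_talg:
  assumes x: "x \<in> carrier talg" shows "\<ominus>\<^bsub>talg\<^esub> x = (\<lambda>k. - x k)"
  using x uminus_mem_talg[OF x] by (intro talg.minus_equality) (auto simp: add_talg zero_talg)

lemma represent_a_minus:
  assumes x: "x \<in> carrier talg" and y: "y \<in> carrier talg"
  shows "represent (x \<ominus>\<^bsub>talg\<^esub> y) = represent x - represent y"
  unfolding a_minus_def a_inv_talg[OF y] add_talg
  using represent_add[OF x uminus_mem_talg[OF y]] represent_uminus[OF y] by simp

lemma represent_bracket:
  assumes x: "x \<in> carrier talg" and y: "y \<in> carrier talg"
  shows "represent (x \<otimes>\<^bsub>talg\<^esub> y \<ominus>\<^bsub>talg\<^esub> y \<otimes>\<^bsub>talg\<^esub> x) = bracket (represent x) (represent y)"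
  using x y by (simp add: represent_a_minus represent_mult bracket_def)

section \<open>The image algebra and its trivial units\<close>

definition alg :: "(nat \<times> 'g, 'f) endo set" where
  "alg = represent ` carrier talg"

definition units :: "(nat \<times> 'g, 'f) endo set" where
  "units = {basis g a | g a. g \<in> carrier G \<and> a \<noteq> 0}"

lemma basis_units: "g \<in> carrier G \<Longrightarrow> a \<noteq> 0 \<Longrightarrow> basis g a \<in> units"
  by (auto simp: units_def)

lemma basis_alg: "g \<in> carrier G \<Longrightarrow> basis g a \<in> alg"
  unfolding alg_def by (metis image_eqI represent_single single_mem)

lemma mult_single:
  assumes x: "x \<in> carrier talg" and k: "k \<in> carrier G" and g: "g \<in> carrier G"
  shows "(x \<otimes>\<^bsub>talg\<^esub> single g a) (k \<otimes> g) = lam k g * x k * a"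
proof -
  have "{(h, h'). x h \<noteq> 0 \<and> single g a h' \<noteq> 0 \<and> h \<otimes> h' = k \<otimes> g}
      = (if x k = 0 \<or> a = 0 then {} else {(k, g)})"
    using x k g by (auto simp: single_def carrier_talg split: if_splits)
  then show ?thesis unfolding mult_talg by (auto simp: single_def)
qed

text \<open>Fix a support point \<open>k\<close> of \<open>w\<close>. If
  \<open>u = basis g a\<close> fixes \<open>w\<close>, then \<open>k \<otimes> g\<close> is again a
  support point, and comparing coefficients there determines \<open>a\<close>. So \<open>u\<close>
  is determined by a point of a finite set.\<close>

lemma finite_right_stabilizer:
  assumes w: "w \<in> alg" "w \<noteq> 0" shows "finite {u \<in> units. w * u = w}"
proof -
  from w(1) obtain x where x: "x \<in> carrier talg" "w = represent x" unfolding alg_def by blast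
  with w(2) have "x \<noteq> (\<lambda>k. 0)" using represent_zero by auto
  then obtain k where k: "x k \<noteq> 0" by blast
  then have kG: "k \<in> carrier G" using x by (auto simp: carrier_talg)
  let ?f = "\<lambda>h. basis (inv k \<otimes> h) (x h / (lam k (inv k \<otimes> h) * x k))"
  have "{u \<in> units. w * u = w} \<subseteq> ?f ` {h. x h \<noteq> 0}"
  proof
    fix u assume "u \<in> {u \<in> units. w * u = w}"
    then obtain g a where g: "g \<in> carrier G" "a \<noteq> 0" and u: "u = basis g a" and wu: "w * u = w"
      unfolding units_def by blast
    have "represent (x \<otimes>\<^bsub>talg\<^esub> single g a) = represent x"
      using wu x g by (simp add: u represent_mult single_mem represent_single)
    then have "x \<otimes>\<^bsub>talg\<^esub> single g a = x" by (intro represent_inject mult_mem_talg single_mem x g)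
    then have e: "x (k \<otimes> g) = lam k g * x k * a" using mult_single[OF x(1) kG g(1)] by metis
    have h: "inv k \<otimes> (k \<otimes> g) = g" using kG g by (simp flip: m_assoc)
    have "u = ?f (k \<otimes> g)" using e k lam_unit[OF kG g(1)] by (simp add: u h)
    moreover have "x (k \<otimes> g) \<noteq> 0" using e k g lam_unit[OF kG g(1)] by simp
    ultimately show "u \<in> ?f ` {h. x h \<noteq> 0}" by blast
  qed
  moreover have "finite {h. x h \<noteq> 0}" using x by (simp add: carrier_talg)
  ultimately show ?thesis by (meson finite_imageI finite_subset)
qed

lemma units_mult:
  assumes "u \<in> units" "v \<in> units" shows "u * v \<in> units"
proof -
  from assms obtain g a h b where "g \<in> carrier G" "a \<noteq> 0" "u = basis g a"
    "h \<in> carrier G" "b \<noteq> 0" "v = basis h b" unfolding units_def by blast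
  then show ?thesis using lam_unit by (simp add: basis_mult basis_units)
qed

lemma units_inverse:
  assumes u: "u \<in> units" shows "\<exists>v\<in>units. u * v = 1 \<and> v * u = 1"
proof -
  from u obtain g a where g: "g \<in> carrier G" "a \<noteq> 0" "u = basis g a" unfolding units_def by blast
  \<comment> \<open>A right and a left inverse with separately computed scalars; associativity makes
    them equal.\<close>
  define v where "v = basis (inv g) (inverse (lam g (inv g) * a))"
  define v' where "v' = basis (inv g) (inverse (lam (inv g) g * a))"
  have "u * v = 1" "v' * u = 1" using g lam_unit
    by (simp_all add: v_def v'_def basis_mult field_simps flip: basis_one)
  moreover from this have "v' = v" using mult.assoc[of v' u v] by simp
  moreover have "v \<in> units" unfolding v_def using g lam_unit by (intro basis_units) auto
  ultimately show ?thesis by auto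
qed

sublocale alg: unit_spanned alg units
proof
  show "1 \<in> alg" using basis_alg[OF one_closed, of 1] by (simp add: basis_one)
  show "x - y \<in> alg" "x * y \<in> alg" if "x \<in> alg" "y \<in> alg" for x y
    using that unfolding alg_def by (auto simp flip: represent_a_minus represent_mult)
  show "1 \<in> units" using basis_units[OF one_closed, of 1] by (simp add: basis_one)
  show "u * v \<in> units" if "u \<in> units" "v \<in> units" for u v using that by (rule units_mult)
  show "\<exists>v\<in>units. u * v = 1 \<and> v * u = 1" if "u \<in> units" for u using that by (rule units_inverse)
  show "finite {u \<in> units. w * u = w}" if "w \<in> alg" "w \<noteq> 0" for w
    using that by (rule finite_right_stabilizer)
  show "alg = add_gen units"
  proof
    show "alg \<subseteq> add_gen units"
    proof
      fix w assume "w \<in> alg"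
      then obtain x where x: "x \<in> carrier talg" "w = represent x" unfolding alg_def by blast
      have "(\<Sum>g\<in>S. basis g (x g)) \<in> add_gen units" if "finite S" "S \<subseteq> {g. x g \<noteq> 0}" for S
        using that
      proof (induction S)
        case (insert g S)
        then have "basis g (x g) \<in> units" using x(1) by (intro basis_units) (auto simp: carrier_talg)
        then show ?case using insert by (auto intro: add_gen_add add_gen_base)
      qed (simp add: add_gen_zero)
      then show "w \<in> add_gen units" using x by (simp add: represent_def carrier_talg)
    qed
    have "x + y \<in> alg" if "x \<in> alg" "y \<in> alg" for x y
      using that unfolding alg_def by (auto simp: add_mem_talg simp flip: represent_add)
    moreover have "0 \<in> alg"
      unfolding alg_def using represent_zero talg.zero_closed by (auto simp: zero_talg image_iff)
    ultimately show "add_gen units \<subseteq> alg" using basis_alg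
      by (intro add_gen_least) (auto simp: units_def)
  qed
qed

section \<open>Comparison with the Lie powers of the algebra of formal sums\<close>

lemma lie_gamma_1: "lie_gamma talg (Suc 0) = carrier talg"
  by (simp add: lie_gamma_def)

lemma upper_lie_power_1: "upper_lie_power talg (Suc 0) = carrier talg"
  by (simp add: upper_lie_power_def)

lemma lie_gamma_Suc: "lie_gamma talg (Suc (Suc n)) = lie_commutators talg (lie_gamma talg (Suc n)) (carrier talg)"
  by (simp add: lie_gamma_def)

lemma upper_lie_power_Suc: "upper_lie_power talg (Suc (Suc n)) =
    additive_product talg (lie_commutators talg (upper_lie_power talg (Suc n)) (carrier talg)) (carrier talg)"
  by (simp add: upper_lie_power_def)

lemma commutators_lie_gamma: "x \<in> alg.commutators n \<Longrightarrow> \<exists>y\<in>carrier talg. y \<in> lie_gamma talg (Suc n) \<and> represent y = x"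
proof (induction n arbitrary: x)
  case 0
  then have "x \<in> alg" by simp
  then show ?case unfolding alg_def lie_gamma_1 by blast
next
  case (Suc n)
  then obtain y r where x: "x = bracket y r" and y: "y \<in> alg.commutators n" and r: "r \<in> alg"
    by (auto simp: alg.commutators.simps)
  from Suc.IH[OF y] obtain y' where y': "y' \<in> carrier talg" "y' \<in> lie_gamma talg (Suc n)" "represent y' = y"
    by blast
  from r obtain r' where r': "r' \<in> carrier talg" "represent r' = r" unfolding alg_def by blast
  have "y' \<otimes>\<^bsub>talg\<^esub> r' \<ominus>\<^bsub>talg\<^esub> r' \<otimes>\<^bsub>talg\<^esub> y' \<in> lie_gamma talg (Suc (Suc n))"
    unfolding lie_gamma_Suc lie_commutators_def using y' r' by (blast intro: generate.incl)
  moreover have "y' \<otimes>\<^bsub>talg\<^esub> r' \<ominus>\<^bsub>talg\<^esub> r' \<otimes>\<^bsub>talg\<^esub> y' \<in> carrier talg" using y' r' by simp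
  moreover have "represent (y' \<otimes>\<^bsub>talg\<^esub> r' \<ominus>\<^bsub>talg\<^esub> r' \<otimes>\<^bsub>talg\<^esub> y') = x"
    using represent_bracket[OF y'(1) r'(1)] by (simp only: x y' r')
  ultimately show ?case by blast
qed

lemma lower_lie_nilpotent_imp:
  assumes "lower_lie_nilpotent talg" obtains n where "alg.lower n = {0}"
proof -
  from assms obtain n where n: "n \<ge> 1" "lower_lie_power talg n = {\<zero>\<^bsub>talg\<^esub>}"
    unfolding lower_lie_nilpotent_def by blast
  then obtain m where m: "n = Suc m" by (cases n) auto
  have "x = 0" if "x \<in> alg.commutators m" for x
  proof -
    from commutators_lie_gamma[OF that] obtain y
      where y: "y \<in> carrier talg" "y \<in> lie_gamma talg n" "represent y = x" unfolding m by blast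
    \<comment> \<open>Multiplying by the identity places an element of \<open>lie_gamma\<close> into
      the lower Lie power.\<close>
    have "y \<otimes>\<^bsub>talg\<^esub> \<one>\<^bsub>talg\<^esub> \<in> lower_lie_power talg n"
      unfolding lower_lie_power_def additive_product_def using y(2) by (blast intro: generate.incl)
    then have "y = \<zero>\<^bsub>talg\<^esub>" using y n by simp
    then show ?thesis using y by (simp add: zero_talg represent_zero)
  qed
  then have "alg.lower m \<subseteq> {0}"
    by (intro alg.ideal_gen_least alg.is_idealI) (auto simp: alg.zero_mem)
  then have "alg.lower m = {0}" using alg.ideal_zero[OF alg.ideal_lower] by blast
  then show ?thesis by (rule that)
qed

text \<open>The preimage of an ideal is an additive subgroup, so an inclusion of generators extends
  to what they generate.\<close>

lemma generate_preimage:
  assumes I: "alg.is_ideal I" and H: "H \<subseteq> {x \<in> carrier talg. represent x \<in> I}"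
  shows "generate (add_monoid talg) H \<subseteq> {x \<in> carrier talg. represent x \<in> I}"
proof -
  have "subgroup {x \<in> carrier talg. represent x \<in> I} (add_monoid talg)"
  proof (rule group.subgroupI[OF talg.a_group])
    show "{x \<in> carrier talg. represent x \<in> I} \<noteq> {}"
      using alg.ideal_zero[OF I] represent_zero talg.zero_closed by (auto simp: zero_talg)
    show "inv\<^bsub>add_monoid talg\<^esub> x \<in> {x \<in> carrier talg. represent x \<in> I}"
      if x: "x \<in> {x \<in> carrier talg. represent x \<in> I}" for x
    proof -
      from x have "inv\<^bsub>add_monoid talg\<^esub> x = (\<lambda>k. - x k)" using a_inv_talg by (simp only: a_inv_def) simp
      with x show ?thesis using alg.ideal_uminus[OF I] by (simp add: uminus_mem_talg represent_uminus)
    qed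
  qed (auto simp: add_talg add_mem_talg represent_add alg.ideal_add[OF I])
  then show ?thesis using group.generate_subgroup_incl[OF talg.a_group H] by blast
qed

text \<open>The products of the Lie powers with the ring map into the two-sided ideals
  \<open>alg.upper n\<close>; vanishing of such an ideal is thereby passed on to the Lie
  power.\<close>

lemma upper_lie_power_sub: "upper_lie_power talg (Suc n) \<subseteq> {x \<in> carrier talg. represent x \<in> alg.upper n}"
proof (induction n)
  case 0
  have "represent x \<in> alg" if "x \<in> carrier talg" for x using that by (simp add: alg_def)
  then show ?case unfolding upper_lie_power_1 alg.upper.simps by blast
next
  case (Suc n)
  note I = alg.ideal_upper[of "Suc n"]
  have alg: "represent y \<in> alg" if "y \<in> carrier talg" for y using that by (simp add: alg_def)
  have comm: "x \<otimes>\<^bsub>talg\<^esub> y \<ominus>\<^bsub>talg\<^esub> y \<otimes>\<^bsub>talg\<^esub> x \<in> {x \<in> carrier talg. represent x \<in> alg.upper (Suc n)}"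
    if x: "x \<in> upper_lie_power talg (Suc n)" and y: "y \<in> carrier talg" for x y
  proof -
    from x Suc have x: "x \<in> carrier talg" "represent x \<in> alg.upper n" by auto
    have "bracket (represent x) (represent y) \<in> alg.upper (Suc n)"
      using alg.upper_bracket[OF x(2) alg[OF y]] .
    then show ?thesis using x y by (simp add: represent_bracket)
  qed
  have "lie_commutators talg (upper_lie_power talg (Suc n)) (carrier talg) \<subseteq> {x \<in> carrier talg. represent x \<in> alg.upper (Suc n)}"
    unfolding lie_commutators_def using comm by (intro generate_preimage[OF I]) blast
  then have "x \<otimes>\<^bsub>talg\<^esub> y \<in> {x \<in> carrier talg. represent x \<in> alg.upper (Suc n)}"
    if "x \<in> lie_commutators talg (upper_lie_power talg (Suc n)) (carrier talg)" "y \<in> carrier talg" for x y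
    using that alg.ideal_right[OF I alg[of y], of "represent x"] by (auto simp: represent_mult)
  then show ?case
    unfolding upper_lie_power_Suc additive_product_def by (intro generate_preimage[OF I]) blast
qed

lemma upper_lie_nilpotentI:
  assumes "alg.upper n = {0}" shows "upper_lie_nilpotent talg"
proof -
  have "x = \<zero>\<^bsub>talg\<^esub>" if "x \<in> upper_lie_power talg (Suc n)" for x
    using upper_lie_power_sub[of n] that assms represent_inject[of x "\<zero>\<^bsub>talg\<^esub>"]
    by (auto simp: zero_talg represent_zero talg.zero_closed[unfolded zero_talg])
  moreover have "\<zero>\<^bsub>talg\<^esub> \<in> upper_lie_power talg (Suc n)"
  proof (cases n)
    case 0 then show ?thesis by (simp add: upper_lie_power_def)
  next
    case (Suc m)
    then show ?thesis unfolding Suc upper_lie_power_Suc additive_product_def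
      using generate.one[of "add_monoid talg"] by simp
  qed
  ultimately have "upper_lie_power talg (Suc n) = {\<zero>\<^bsub>talg\<^esub>}" by blast
  then show ?thesis unfolding upper_lie_nilpotent_def by (intro exI[of _ "Suc n"]) simp
qed

lemma lie_gamma_sub: "lie_gamma talg (Suc n) \<subseteq> upper_lie_power talg (Suc n)"
proof (induction n)
  case 0 then show ?case by (simp add: lie_gamma_def upper_lie_power_def)
next
  case (Suc n)
  let ?L = "lie_commutators talg (upper_lie_power talg (Suc n)) (carrier talg)"
  have "lie_gamma talg (Suc (Suc n)) \<subseteq> ?L"
    unfolding lie_gamma_Suc lie_commutators_def using Suc
    by (intro group.mono_generate[OF talg.a_group]) blast
  also have "?L \<subseteq> additive_product talg ?L (carrier talg)"
  proof
    fix x assume x: "x \<in> ?L"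
    have "upper_lie_power talg (Suc n) \<subseteq> carrier talg" using upper_lie_power_sub by blast
    then have "{x \<otimes>\<^bsub>talg\<^esub> y \<ominus>\<^bsub>talg\<^esub> y \<otimes>\<^bsub>talg\<^esub> x | x y. x \<in> upper_lie_power talg (Suc n) \<and> y \<in> carrier talg}
        \<subseteq> carrier (add_monoid talg)" by auto
    then have "?L \<subseteq> carrier (add_monoid talg)"
      unfolding lie_commutators_def by (rule group.generate_incl[OF talg.a_group])
    then have "x = x \<otimes>\<^bsub>talg\<^esub> \<one>\<^bsub>talg\<^esub>" using x by auto
    then show "x \<in> additive_product talg ?L (carrier talg)"
      unfolding additive_product_def using x by (blast intro: generate.incl)
  qed
  finally show ?case unfolding upper_lie_power_Suc .
qed

lemma upper_imp_lower_lie_nilpotent: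
  assumes "upper_lie_nilpotent talg" shows "lower_lie_nilpotent talg"
proof -
  from assms obtain n where n: "n \<ge> 1" "upper_lie_power talg n = {\<zero>\<^bsub>talg\<^esub>}"
    unfolding upper_lie_nilpotent_def by blast
  then have g: "lie_gamma talg n \<subseteq> {\<zero>\<^bsub>talg\<^esub>}" using lie_gamma_sub[of "n - 1"] by simp
  have "lower_lie_power talg n \<subseteq> generate (add_monoid talg) {\<zero>\<^bsub>talg\<^esub>}"
    unfolding lower_lie_power_def additive_product_def using g
    by (intro group.mono_generate[OF talg.a_group]) auto
  also have "\<dots> = {\<zero>\<^bsub>talg\<^esub>}" using group.generate_one[OF talg.a_group] by simp
  finally have "lower_lie_power talg n = {\<zero>\<^bsub>talg\<^esub>}"
    unfolding lower_lie_power_def additive_product_def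
    using generate.one[of "add_monoid talg"] by auto
  then show ?thesis unfolding lower_lie_nilpotent_def using n by blast
qed

lemma cring_iff: "cring talg \<longleftrightarrow> alg.lower 1 = {0}"
proof
  assume "cring talg"
  then interpret C: cring talg .
  have "bracket x y = 0" if "x \<in> alg" "y \<in> alg" for x y
    using that C.m_comm unfolding alg_def
    by (auto simp: bracket_def simp flip: represent_mult)
  then have "alg.lower 1 \<subseteq> {0}"
    by (intro alg.ideal_gen_least alg.is_idealI) (auto simp: alg.zero_mem alg.commutators.simps)
  then show "alg.lower 1 = {0}" using alg.ideal_zero[OF alg.ideal_lower] by blast
next
  assume "alg.lower 1 = {0}"
  then have c: "bracket x y = 0" if "x \<in> alg" "y \<in> alg" for x y
    using alg.lower_bracket[of x 0 y] that by simp
  have "x \<otimes>\<^bsub>talg\<^esub> y = y \<otimes>\<^bsub>talg\<^esub> x" if "x \<in> carrier talg" "y \<in> carrier talg" for x y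
    using that c[of "represent x" "represent y"]
    by (intro represent_inject) (auto simp: alg_def represent_mult bracket_def)
  then show "cring talg" by (intro cring.intro ring_talg talg.monoid_comm_monoidI)
qed

end

section \<open>Twisted group algebras\<close>

text \<open>Another prime divisor \<open>q\<close> of the order would produce a subgroup of order
  \<open>q\<close>, and a nontrivial element of it would have an order dividing both
  \<open>q\<close> and a power of \<open>p\<close>.\<close>

lemma (in group) prime_power_card:
  assumes p: "prime p" and S: "subgroup S G" "finite S"
    and tors: "\<And>x. x \<in> S \<Longrightarrow> \<exists>k::nat. x [^] (p ^ k) = \<one>"
  shows "\<exists>n. card S = p ^ n"
proof (rule ccontr)
  assume neg: "\<nexists>n. card S = p ^ n"
  interpret K: group "G\<lparr>carrier := S\<rparr>" by (rule subgroup_imp_group[OF S(1)])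
  have "card S \<noteq> 0" using S subgroup.one_closed by auto
  then obtain r where r: "card S = p ^ multiplicity p (card S) * r" "\<not> p dvd r"
    using multiplicity_decompose'[of "card S" p] p by (metis not_prime_unit)
  then have "r \<noteq> 1" using neg by (metis mult.right_neutral)
  then obtain q where q: "prime q" "q dvd r" using prime_factor_nat by blast
  then have "q \<noteq> p" using r(2) by blast
  then have cop: "coprime q (p ^ k)" for k using p q(1) by (simp add: primes_coprime)
  from q(2) r(1) have "q dvd card S" by (metis dvd_mult)
  \<comment> \<open>With exponent 1, Sylow's theorem becomes Cauchy's theorem.\<close>
  then obtain m where "card S = q ^ 1 * m" by (auto elim: dvdE)
  then obtain H where H: "subgroup H (G\<lparr>carrier := S\<rparr>)" "card H = q"
    using sylow_thm[OF q(1) K.is_group, of 1 m] S(2) by (auto simp: Coset.order_def)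
  then have "finite H" "card H > 1" using prime_gt_1_nat[OF q(1)] card.infinite by fastforce+
  then obtain x where x: "x \<in> H" "x \<noteq> \<one>"
    by (metis card_le_Suc0_iff_eq leD One_nat_def)
  have xS: "x \<in> S" using subgroup.subset[OF H(1)] x(1) by auto
  then have xG: "x \<in> carrier G" using subgroup.subset[OF S(1)] by blast
  interpret L: group "G\<lparr>carrier := H\<rparr>" using K.subgroup_imp_group[OF H(1)] by simp
  have pow: "x [^]\<^bsub>G\<lparr>carrier := H\<rparr>\<^esub> n = x [^] n" for n :: nat
    by (induction n) simp_all
  have "x [^] q = \<one>"
    using L.pow_order_eq_1[of x] x(1) H(2) by (simp add: Coset.order_def pow)
  moreover from tors[OF xS] obtain k where "x [^] (p ^ k) = \<one>" by blast
  ultimately have "ord x dvd q" "ord x dvd p ^ k" using pow_eq_id[OF xG] by auto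
  then have "ord x = 1" using cop[of k] by (metis coprime_common_divisor_nat)
  then show False using ord_eq_1[OF xG] x(2) by simp
qed

lemma (in group) inv_cancel_left:
  assumes "x \<in> carrier G" "y \<in> carrier G"
  shows "x \<otimes> (inv x \<otimes> y) = y" "inv x \<otimes> (x \<otimes> y) = y"
  using assms by (simp_all flip: m_assoc)

lemma (in group) group_commutator_derived:
  assumes "a \<in> carrier G" "b \<in> carrier G"
  shows "group_commutator G a b \<in> derived G (carrier G)"
proof -
  \<comment> \<open>The elements of \<open>derived_set\<close> have the form
    \<open>x y x^-1 y^-1\<close>, so \<open>(a, b)\<close> occurs there for the inverses of
    \<open>a\<close> and \<open>b\<close>.\<close>
  have "inv a \<otimes> inv b \<otimes> inv (inv a) \<otimes> inv (inv b) \<in> derived_set G (carrier G)"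
    using assms inv_closed by blast
  then show ?thesis using assms unfolding derived_def group_commutator_def
    by (auto intro: generate.incl)
qed

context twisted_system
begin

interpretation talg: ring talg by (rule ring_talg)

section \<open>Commutators and powers of trivial units\<close>

lemma basis_inject:
  assumes "g \<in> carrier G" "h \<in> carrier G" "a \<noteq> 0" "basis g a = basis h b"
  shows "g = h" "a = b"
proof -
  have "single g a = single h b"
    using assms by (intro represent_inject) (simp_all add: single_mem represent_single)
  from fun_cong[OF this, of g] assms(3) show "g = h" "a = b"
    by (auto simp: single_def split: if_splits)
qed

lemma unit_inv_basis:
  assumes g: "g \<in> carrier G" and a: "a \<noteq> 0"
  obtains b where "b \<noteq> 0" "unit_inv (basis g a) = basis (inv g) b"
proof -
  from alg.unit_inv(1)[OF basis_units[OF g a]] obtain h b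
    where h: "h \<in> carrier G" "b \<noteq> 0" "unit_inv (basis g a) = basis h b" unfolding units_def by blast
  have "basis (g \<otimes> h) (lam g h * a * b) = basis \<one> 1"
    using alg.unit_inv(2)[OF basis_units[OF g a]] g h by (simp add: basis_mult basis_one)
  then have "g \<otimes> h = \<one>" using g h a lam_unit by (intro basis_inject(1)) auto
  then have "h = inv g" using inv_equality[of h g] g h(1) inv_comm by metis
  with h show ?thesis using that by blast
qed

lemma unit_commutator_basis:
  assumes g: "g \<in> carrier G" "a \<noteq> 0" and h: "h \<in> carrier G" "b \<noteq> 0"
  obtains k where "k \<noteq> 0" "unit_commutator (basis g a) (basis h b) = basis (group_commutator G g h) k"
proof -
  from unit_inv_basis[OF g] unit_inv_basis[OF h] obtain a' b'
    where "a' \<noteq> 0" "unit_inv (basis g a) = basis (inv g) a'"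
      "b' \<noteq> 0" "unit_inv (basis h b) = basis (inv h) b'" by metis
  then show ?thesis using g h lam_unit
    by (intro that[of "lam (inv g \<otimes> inv h \<otimes> g) h * (lam (inv g \<otimes> inv h) g * (lam (inv g) (inv h) * a' * b') * a) * b"])
      (simp_all add: unit_commutator_def group_commutator_def basis_mult)
qed

text \<open>Scalars are central, so they cancel from the commutator. Its value is verified through
  \<open>v u x = u v\<close>, which determines \<open>x\<close>, and this avoids computing the
  scalars of the inverses.\<close>

lemma unit_commutator_eq:
  assumes a: "a \<in> carrier G" "\<alpha> \<noteq> 0" and b: "b \<in> carrier G" "\<beta> \<noteq> 0"
  shows "unit_commutator (basis b \<beta>) (basis a \<alpha>)
    = basis (group_commutator G b a) (commutator_coeff G lam a b)"
proof -
  define c where "c = group_commutator G a b"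
  define c' where "c' = group_commutator G b a"
  define \<kappa> where "\<kappa> = commutator_coeff G lam a b"
  have [simp]: "c \<in> carrier G" "c' \<in> carrier G" "a \<in> carrier G" "b \<in> carrier G"
    using a b by (simp_all add: c_def c'_def group_commutator_def)
  have cc': "c \<otimes> c' = \<one>" "c' \<otimes> c = \<one>"
    by (simp_all add: c_def c'_def group_commutator_def m_assoc inv_cancel_left)
  have ac: "a \<otimes> c = inv b \<otimes> a \<otimes> b"
    by (simp add: c_def group_commutator_def m_assoc inv_cancel_left)
  have bac: "b \<otimes> a \<otimes> c = a \<otimes> b"
    by (simp add: c_def group_commutator_def m_assoc inv_cancel_left)
  have abc': "a \<otimes> b \<otimes> c' = b \<otimes> a"
    using cc'(1) by (simp add: m_assoc flip: bac)
  \<comment> \<open>Of the three cocycle relations, \<open>e1\<close> treats the factors occurring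
    in the coefficient, while \<open>e2\<close> and \<open>e3\<close> use that \<open>c\<close> and
    \<open>c'\<close> are mutually inverse, so that normalization removes the values of
    \<open>lam\<close> at \<open>\<one>\<close>.\<close>
  have e1: "lam b (a \<otimes> c) * lam a c = lam (b \<otimes> a) c * lam b a"
    by (rule twisted_cocycle) simp_all
  have e2: "lam c c' = lam (a \<otimes> b) c' * lam (b \<otimes> a) c"
    using twisted_cocycle[of "b \<otimes> a" c c'] by (simp add: cc' bac normalized)
  have e3: "lam c' c = lam c c'"
    using twisted_cocycle[of c c' c] by (simp add: cc' normalized)
  have \<kappa>: "\<kappa> * lam a b * lam c' c = lam b (a \<otimes> c) * lam a c"
    using lam_unit[of a b] lam_unit[of c' c]
    by (simp add: \<kappa>_def commutator_coeff_def ac field_simps flip: c_def c'_def)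
  have "(lam (a \<otimes> b) c' * lam a b * \<kappa>) * lam c' c = lam b a * lam c' c"
  proof -
    have "(lam (a \<otimes> b) c' * lam a b * \<kappa>) * lam c' c = lam (a \<otimes> b) c' * (\<kappa> * lam a b * lam c' c)"
      by (simp add: ac_simps)
    also have "\<dots> = lam (a \<otimes> b) c' * (lam (b \<otimes> a) c * lam b a)" by (simp only: \<kappa> e1)
    also have "\<dots> = lam b a * lam c' c" by (simp only: e3 e2 ac_simps)
    finally show ?thesis .
  qed
  then have key: "lam (a \<otimes> b) c' * lam a b * \<kappa> = lam b a"
    using lam_unit[of c' c] by simp
  let ?u = "basis b \<beta>" and ?v = "basis a \<alpha>"
  have "?v * ?u * basis c' \<kappa> = basis (b \<otimes> a) ((lam (a \<otimes> b) c' * lam a b * \<kappa>) * (\<alpha> * \<beta>))"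
    by (simp add: basis_mult abc' ac_simps)
  also have "\<dots> = ?u * ?v" unfolding key by (simp add: basis_mult ac_simps)
  also have "\<dots> = ?v * ?u * unit_commutator ?u ?v"
    using alg.mult_commutator[of ?u ?v] a b by (simp add: basis_units)
  finally have "basis c' \<kappa> = unit_commutator ?u ?v"
    using alg.unit_inv_cancel(2)[of "?v * ?u"] a b
    by (metis basis_units units_mult)
  then show ?thesis by (simp add: c'_def \<kappa>_def)
qed

lemma basis_power:
  assumes g: "g \<in> carrier G"
  shows "basis g a ^ Suc n = basis (g [^] Suc n) (a ^ Suc n * (\<Prod>i = 1..<Suc n. lam (g [^] i) g))"
proof (induction n)
  case 0 then show ?case using g by simp
next
  case (Suc n)
  have "basis g a ^ Suc (Suc n) = basis g a ^ Suc n * basis g a" by (rule power_Suc2)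
  also have "\<dots> = basis (g [^] Suc (Suc n)) (a ^ Suc (Suc n) * (\<Prod>i = 1..<Suc (Suc n). lam (g [^] i) g))"
    unfolding Suc using g by (simp add: basis_mult ac_simps del: power_Suc) (simp add: ac_simps)
  finally show ?case .
qed

lemma basis_power_twist:
  assumes g: "g \<in> carrier G" and "ord g > 0"
  shows "basis g a ^ ord g = basis \<one> (a ^ ord g * twist G lam g)"
proof -
  from assms(2) obtain n where n: "ord g = Suc n" by (metis gr0_implies_Suc)
  then show ?thesis using basis_power[OF g, of a n] pow_ord_eq_1[OF g] by (simp add: twist_def)
qed

lemma basis_power_ex:
  assumes g: "g \<in> carrier G" and a: "a \<noteq> 0"
  obtains b where "b \<noteq> 0" "basis g a ^ n = basis (g [^] n) b"
proof (cases n)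
  case 0 then show ?thesis using that[of 1] g by (simp add: basis_one)
next
  case (Suc m)
  have "a ^ n * (\<Prod>i = 1..<n. lam (g [^] i) g) \<noteq> 0" using g a lam_unit by simp
  then show ?thesis using that basis_power[OF g, of a m] Suc by blast
qed

lemma basis_power_one:
  assumes g: "g \<in> carrier G" and a: "a \<noteq> 0" and "basis g a ^ n = 1"
  shows "g [^] n = \<one>"
proof -
  from basis_power_ex[OF g a] obtain b where b: "b \<noteq> 0" "basis g a ^ n = basis (g [^] n) b" .
  then show ?thesis using assms g basis_inject(1)[of "g [^] n" \<one> b 1] by (simp add: basis_one)
qed

lemma scalar_power: "basis \<one> c ^ n = basis \<one> (c ^ n)"
  by (induction n) (simp_all add: basis_one basis_mult normalized)

text \<open>The Frobenius rule rewrites the power as \<open>1 + (c - 1) ^ (CHAR('f) ^ k)\<close>,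
  and a field has no nonzero nilpotent elements.\<close>

lemma prime_power_root_one:
  assumes p: "prime CHAR('f)" and c: "c ^ (CHAR('f) ^ k) = (1 :: 'f)"
  shows "c = 1"
  using one_plus_prime_power[OF p of_nat_CHAR, of "c - 1" k] c by simp

lemma scalar_torsion:
  assumes p: "prime CHAR('f)" and c: "basis \<one> c ^ (CHAR('f) ^ k) = 1"
  shows "c = 1"
proof -
  have "basis \<one> 1 = basis \<one> (c ^ (CHAR('f) ^ k))" using c by (simp add: scalar_power basis_one)
  then have "c ^ (CHAR('f) ^ k) = 1" using basis_inject(2)[of \<one> \<one> 1] by simp
  then show ?thesis by (rule prime_power_root_one[OF p])
qed

text \<open>The power with exponent \<open>ord g\<close> is a scalar whose order is a power of the
  characteristic, hence it is one. A torsion lift of this kind therefore has exactly the order of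
  \<open>g\<close>.\<close>

lemma basis_power_ord:
  assumes p: "prime CHAR('f)" and g: "g \<in> carrier G" and a: "a \<noteq> 0"
    and k: "basis g a ^ (CHAR('f) ^ k) = 1"
  obtains m where "ord g = CHAR('f) ^ m" "basis g a ^ ord g = 1"
proof -
  have "g [^] (CHAR('f) ^ k) = \<one>" using g a k by (rule basis_power_one)
  then have "ord g dvd CHAR('f) ^ k" using g pow_eq_id by blast
  then obtain m where m: "ord g = CHAR('f) ^ m" "m \<le> k" using p divides_primepow_nat by blast
  from basis_power_ex[OF g a] obtain b where b: "basis g a ^ ord g = basis (g [^] ord g) b" .
  have "(basis g a ^ ord g) ^ (CHAR('f) ^ (k - m)) = 1"
    using k m by (simp flip: power_mult power_add)
  then have "b = 1" using b g by (intro scalar_torsion[OF p]) simp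
  then show ?thesis using that[OF m(1)] b g by (simp add: basis_one)
qed

section \<open>Untwisted \<open>p\<close>-elements\<close>

lemma single_Units:
  assumes g: "g \<in> carrier G" and a: "a \<noteq> 0" shows "single g a \<in> Units talg"
proof -
  from units_inverse[OF basis_units[OF g a]] obtain h b where h: "h \<in> carrier G"
    and b: "basis g a * basis h b = 1" "basis h b * basis g a = 1" unfolding units_def by blast
  have "single h b \<otimes>\<^bsub>talg\<^esub> single g a = \<one>\<^bsub>talg\<^esub>" "single g a \<otimes>\<^bsub>talg\<^esub> single h b = \<one>\<^bsub>talg\<^esub>"
    using g h b by (auto intro!: represent_inject simp: mult_mem_talg single_mem represent_mult represent_single represent_one)
  then show ?thesis using g h single_mem unfolding Units_def by blast
qed

lemma single_power:
  assumes g: "g \<in> carrier G" and a: "a \<noteq> 0"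
  shows "single g a [^]\<^bsub>units_of talg\<^esub> (n :: nat) = \<one>\<^bsub>units_of talg\<^esub> \<longleftrightarrow> basis g a ^ n = 1"
proof -
  interpret M: group "units_of talg" by (rule talg.units_group)
  have s: "single g a \<in> carrier (units_of talg)" using single_Units[OF g a] by (simp add: units_of_carrier)
  have carr: "single g a [^]\<^bsub>units_of talg\<^esub> n \<in> carrier talg" for n :: nat
    using M.nat_pow_closed[OF s, of n] by (simp add: units_of_carrier talg.Units_closed)
  have "represent (single g a [^]\<^bsub>units_of talg\<^esub> n) = basis g a ^ n"
  proof (induction n)
    case 0 then show ?case by (simp add: units_of_one represent_one)
  next
    case (Suc n)
    have "represent (single g a [^]\<^bsub>units_of talg\<^esub> Suc n) = basis g a ^ n * basis g a"
      unfolding M.nat_pow_Suc units_of_mult represent_mult[OF carr single_mem[OF g]] Suc represent_single ..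
    then show ?case by (simp only: power_Suc2)
  qed
  then show ?thesis
    using represent_inject[OF carr one_mem_talg, of n] by (auto simp: units_of_one represent_one)
qed

text \<open>The equality of orders in the definition is traded for mere \<open>p\<close>-power
  torsion of a lift; \<open>basis_power_ord\<close> recovers the exact order.\<close>

lemma untwisted_iff:
  assumes p: "prime CHAR('f)"
  shows "untwisted_p_element G lam CHAR('f) u \<longleftrightarrow>
    u \<in> carrier G \<and> (\<exists>a k. a \<noteq> 0 \<and> basis u a ^ (CHAR('f) ^ k) = 1)"
proof
  interpret M: group "units_of talg" by (rule talg.units_group)
  have mem: "single g a \<in> carrier (units_of talg)" if "g \<in> carrier G" "a \<noteq> 0" for g a
    using single_Units[OF that] by (simp add: units_of_carrier)
  show "u \<in> carrier G \<and> (\<exists>a k. a \<noteq> 0 \<and> basis u a ^ (CHAR('f) ^ k) = 1)"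
    if "untwisted_p_element G lam CHAR('f) u"
  proof -
    from that obtain m a where u: "u \<in> carrier G" and m: "ord u = CHAR('f) ^ m"
      and a: "a \<noteq> 0" "M.ord (single u a) = ord u"
      unfolding untwisted_p_element_def p_element_def talg_def single_def by blast
    have "basis u a ^ (CHAR('f) ^ m) = 1"
      using M.pow_ord_eq_1[OF mem[OF u a(1)]] single_power[OF u a(1)] a(2) m by simp
    with u a show ?thesis by blast
  qed
  assume "u \<in> carrier G \<and> (\<exists>a k. a \<noteq> 0 \<and> basis u a ^ (CHAR('f) ^ k) = 1)"
  then obtain a k where u: "u \<in> carrier G" and a: "a \<noteq> 0" and k: "basis u a ^ (CHAR('f) ^ k) = 1" by blast
  from basis_power_ord[OF p u a k] obtain m where m: "ord u = CHAR('f) ^ m" "basis u a ^ ord u = 1" .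
  have "basis u a ^ n = 1 \<longleftrightarrow> ord u dvd n" for n
    using basis_power_one[OF u a] pow_eq_id[OF u] m(2) by (auto simp: dvd_def power_mult)
  then have "M.ord (single u a) = ord u"
    using M.ord_unique[OF mem[OF u a]] single_power[OF u a] by blast
  then show "untwisted_p_element G lam CHAR('f) u"
    unfolding untwisted_p_element_def p_element_def talg_def[symmetric] using u m a
    by (auto simp: single_def)
qed

section \<open>From Lie nilpotency to the conditions on the group\<close>

lemma lower_nilpotent_cases:
  assumes nil: "alg.lower n = {0}" and noncomm: "alg.lower 1 \<noteq> {0}"
  obtains w where "w \<in> alg" "w \<noteq> 0"
    "\<And>u v. u \<in> units \<Longrightarrow> v \<in> units \<Longrightarrow> w * unit_commutator u v = w"
    "alg.absorbing {0}" "prime CHAR('f)"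
proof -
  from alg.ex_annihilator[OF nil noncomm] obtain w where w: "w \<in> alg" "w \<noteq> 0"
    "\<And>u v. u \<in> units \<Longrightarrow> v \<in> units \<Longrightarrow> w * bracket u v = 0" by blast
  have stab: "w * unit_commutator u v = w" if uv: "u \<in> units" "v \<in> units" for u v
  proof -
    \<comment> \<open>The bracket of the inverses is brought to the left end, where \<open>w\<close>
      annihilates it.\<close>
    have "unit_commutator u v - 1 = bracket (unit_inv u) (unit_inv v) * (u * v)"
      using alg.unit_inv[OF uv(1)] alg.unit_inv[OF uv(2)] alg.unit_inv_cancel[OF uv(1)]
      by (simp add: unit_commutator_def bracket_def left_diff_distrib mult.assoc)
    then have "w * (unit_commutator u v - 1) = w * bracket (unit_inv u) (unit_inv v) * (u * v)"
      by (simp add: mult.assoc)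
    then show ?thesis using w(3) alg.unit_inv(1) uv by (simp add: right_diff_distrib)
  qed
  have "alg.group_commutators \<subseteq> {u \<in> units. w * u = w}"
    using stab alg.unit_commutator_mem by (auto simp: alg.group_commutators_def)
  then have "finite alg.group_commutators"
    using alg.finite_stabilizer[OF w(1,2)] finite_subset by blast
  then have abs: "alg.absorbing {0}" using nil by (rule alg.finite_commutators_absorbing)
  have "\<exists>u\<in>units. \<exists>v\<in>units. bracket u v \<noteq> 0"
  proof (rule ccontr)
    assume "\<not> ?thesis"
    moreover have I: "alg.is_ideal {0}" by (rule alg.is_idealI) (auto simp: alg.zero_mem)
    ultimately have "bracket r s \<in> {0}" if "r \<in> alg" "s \<in> alg" for r s
      using alg.bracket_span2[OF I _ that] by blast
    then have "alg.lower 1 \<subseteq> {0}"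
      by (intro alg.ideal_gen_least[OF I]) (auto simp: alg.commutators.simps)
    then show False using noncomm alg.ideal_zero[OF alg.ideal_lower] by blast
  qed
  then obtain u v where uv: "u \<in> units" "v \<in> units" "bracket u v \<noteq> 0" by blast
  \<comment> \<open>This commutator is nontrivial and of finite order, and \<open>c - 1\<close> is
    nilpotent. By \<open>unipotent_torsion\<close> the ring has additive torsion, which excludes
    characteristic zero.\<close>
  define c where "c = unit_commutator u v"
  have c: "c \<in> units" unfolding c_def using uv by (intro alg.unit_commutator_mem)
  have c1: "c - 1 \<noteq> 0" using uv alg.bracket_commutator[OF uv(1,2)] by (auto simp: c_def)
  have "w * c = w" unfolding c_def using stab uv by blast
  then obtain m where m: "m > 0" "c ^ m = 1" by (rule alg.unipotent_finite_order[OF w(1,2) c])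
  have "c - 1 \<in> alg.upper 1"
    unfolding c_def using alg.unipotent_commutator[OF uv(1,2), of 0] alg.U_sub[OF uv(1)]
    by (simp add: alg.mem)
  with abs obtain k where k: "(c - 1) ^ k = 0" unfolding alg.absorbing_def by blast
  have "(1 + (c - 1)) ^ m = 1" using m(2) by simp
  from unipotent_torsion[OF k c1 this] obtain y :: "(nat \<times> 'g, 'f) endo" where y: "y \<noteq> 0" "of_nat m * y = 0" .
  have "CHAR('f) \<noteq> 0"
  proof
    assume "CHAR('f) = 0"
    then have "of_nat m \<noteq> (0 :: 'f)" using m(1) by (simp add: of_nat_eq_0_iff_char_dvd)
    then have "endo_apply y x i = 0" for x i
      using endo_apply_of_nat[of m y x i] y(2) by (simp add: endo_apply_simps)
    then have "y = 0" by (intro endo_eqI) (simp add: endo_apply_simps)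
    with y show False by simp
  qed
  then have "prime CHAR('f)" by (intro prime_CHAR_semidom) simp
  then show ?thesis using that w stab abs by blast
qed

text \<open>Projecting \<open>basis g a\<close> to \<open>g\<close> carries groups of trivial units
  to subgroups of \<open>G\<close>. It serves to show that the elements having a lift of a
  prescribed kind form a subgroup.\<close>

lemma unipotent_subgroup:
  assumes sub: "S \<subseteq> units" and one: "1 \<in> S" and mult: "\<And>u v. u \<in> S \<Longrightarrow> v \<in> S \<Longrightarrow> u * v \<in> S"
    and inv: "\<And>u. u \<in> S \<Longrightarrow> unit_inv u \<in> S"
  shows "subgroup {g \<in> carrier G. \<exists>a. a \<noteq> 0 \<and> basis g a \<in> S} G"
proof (rule subgroupI)
  have "basis \<one> 1 \<in> S" using one by (simp add: basis_one)
  then have "\<one> \<in> {g \<in> carrier G. \<exists>a. a \<noteq> 0 \<and> basis g a \<in> S}"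
    using one_closed by (intro CollectI conjI exI[of _ 1]) simp_all
  then show "{g \<in> carrier G. \<exists>a. a \<noteq> 0 \<and> basis g a \<in> S} \<noteq> {}" by blast
next
  fix g assume "g \<in> {g \<in> carrier G. \<exists>a. a \<noteq> 0 \<and> basis g a \<in> S}"
  then obtain a where g: "g \<in> carrier G" "a \<noteq> 0" "basis g a \<in> S" by blast
  from unit_inv_basis[OF g(1,2)] obtain b where "b \<noteq> 0" "unit_inv (basis g a) = basis (inv g) b" .
  then show "inv g \<in> {g \<in> carrier G. \<exists>a. a \<noteq> 0 \<and> basis g a \<in> S}" using inv[OF g(3)] g(1) by auto
next
  fix g h assume "g \<in> {g \<in> carrier G. \<exists>a. a \<noteq> 0 \<and> basis g a \<in> S}"
    "h \<in> {g \<in> carrier G. \<exists>a. a \<noteq> 0 \<and> basis g a \<in> S}"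
  then obtain a b where g: "g \<in> carrier G" "a \<noteq> 0" "basis g a \<in> S"
    and h: "h \<in> carrier G" "b \<noteq> 0" "basis h b \<in> S" by blast
  then have "basis (g \<otimes> h) (lam g h * a * b) \<in> S" "lam g h * a * b \<noteq> 0"
    using mult[OF g(3) h(3)] lam_unit by (simp_all add: basis_mult)
  then show "g \<otimes> h \<in> {g \<in> carrier G. \<exists>a. a \<noteq> 0 \<and> basis g a \<in> S}" using g h by blast
qed auto

lemma unipotent_upper_closed:
  shows "1 - 1 \<in> alg.upper n"
    and "u \<in> units \<Longrightarrow> v \<in> units \<Longrightarrow> u - 1 \<in> alg.upper n \<Longrightarrow> v - 1 \<in> alg.upper n \<Longrightarrow> u * v - 1 \<in> alg.upper n"
    and "u \<in> units \<Longrightarrow> u - 1 \<in> alg.upper n \<Longrightarrow> unit_inv u - 1 \<in> alg.upper n"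
proof -
  show "1 - 1 \<in> alg.upper n" using alg.ideal_zero[OF alg.ideal_upper] by simp
  show "u * v - 1 \<in> alg.upper n" if "v \<in> units" "u - 1 \<in> alg.upper n" "v - 1 \<in> alg.upper n"
    by (rule alg.unipotent_mult[OF alg.ideal_upper that(2,3) alg.U_sub[OF that(1)]])
  show "unit_inv u - 1 \<in> alg.upper n" if "u \<in> units" "u - 1 \<in> alg.upper n"
    by (rule alg.unipotent_inv[OF alg.ideal_upper that(2,1)])
qed

text \<open>The elements with a lift congruent to 1 modulo \<open>alg.upper (Suc n)\<close> form a
  subgroup, so only single commutators have to be lifted. Both series start at index 0.\<close>

lemma lower_central_unipotent:
  "g \<in> lower_central G n \<Longrightarrow> g \<in> carrier G \<and> (\<exists>a. a \<noteq> 0 \<and> basis g a - 1 \<in> alg.upper n)"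
proof (induction n arbitrary: g)
  case 0
  then have "basis g 1 - 1 \<in> alg.upper 0" using basis_alg by (auto intro: alg.mem)
  with 0 show ?case by (metis lower_central.simps(1) zero_neq_one)
next
  case (Suc n)
  let ?S = "{u \<in> units. u - 1 \<in> alg.upper (Suc n)}"
  have S: "subgroup {g \<in> carrier G. \<exists>a. a \<noteq> 0 \<and> basis g a \<in> ?S} G"
    using unipotent_upper_closed(1)[of "Suc n"]
      unipotent_upper_closed(2,3)[where n = "Suc n"]
      alg.U_one units_mult alg.unit_inv(1)
    by (intro unipotent_subgroup) auto
  have "{group_commutator G x y | x y. x \<in> lower_central G n \<and> y \<in> carrier G}
      \<subseteq> {g \<in> carrier G. \<exists>a. a \<noteq> 0 \<and> basis g a \<in> ?S}"
  proof safe
    fix x y assume x: "x \<in> lower_central G n" and y: "y \<in> carrier G"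
    from Suc.IH[OF x] obtain a where a: "x \<in> carrier G" "a \<noteq> 0" "basis x a - 1 \<in> alg.upper n" by blast
    then show "group_commutator G x y \<in> carrier G" using y by (simp add: group_commutator_def)
    from unit_commutator_basis[OF a(1,2) y, of 1] obtain k where k: "k \<noteq> 0"
      "unit_commutator (basis x a) (basis y 1) = basis (group_commutator G x y) k" by auto
    have u: "basis x a \<in> units" "basis y 1 \<in> units" using a y by (auto intro: basis_units)
    have "basis (group_commutator G x y) k \<in> ?S"
      using alg.unipotent_commutator[OF u a(3)] alg.unit_commutator_mem[OF u] k by simp
    with k(1) show "\<exists>a. a \<noteq> 0 \<and> basis (group_commutator G x y) a \<in> ?S" by blast
  qed
  then have "lower_central G (Suc n) \<subseteq> {g \<in> carrier G. \<exists>a. a \<noteq> 0 \<and> basis g a \<in> ?S}"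
    unfolding lower_central.simps by (rule generate_subgroup_incl[OF _ S])
  with Suc.prems show ?case by blast
qed

lemma upper_nilpotent_group:
  assumes "alg.absorbing {0}" shows "nilpotent_group G"
proof -
  from assms obtain n where n: "alg.upper n \<subseteq> {0}" unfolding alg.absorbing_def by blast
  have "g = \<one>" if g: "g \<in> lower_central G n" for g
  proof -
    \<comment> \<open>Where \<open>alg.upper n\<close> vanishes, the lift of \<open>g\<close> is the
      identity.\<close>
    from lower_central_unipotent[OF g] n obtain a
      where "g \<in> carrier G" "a \<noteq> 0" "basis g a = basis \<one> 1" by (auto simp: basis_one)
    then show ?thesis using basis_inject(1) one_closed by blast
  qed
  moreover have "\<one> \<in> lower_central G n" by (cases n) (auto intro: generate.one)
  ultimately show ?thesis unfolding nilpotent_group_def using is_group by blast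
qed

text \<open>Two properties of the lifts are carried along: fixing \<open>w\<close> bounds their
  number, and congruence to 1 modulo \<open>alg.upper 1\<close> yields \<open>p\<close>-power
  torsion.\<close>

lemma derived_unipotent:
  assumes w: "w \<in> alg" "w \<noteq> 0" "\<And>u v. u \<in> units \<Longrightarrow> v \<in> units \<Longrightarrow> w * unit_commutator u v = w"
    and g: "g \<in> derived G (carrier G)"
  shows "g \<in> carrier G \<and> (\<exists>a. a \<noteq> 0 \<and> w * basis g a = w \<and> basis g a - 1 \<in> alg.upper 1)"
proof -
  let ?S = "{u \<in> units. w * u = w \<and> u - 1 \<in> alg.upper 1}"
  have inv: "w * unit_inv u = w" if "u \<in> units" "w * u = w" for u
    using alg.unit_inv(2)[OF that(1)] that(2) by (metis mult.assoc mult_1_right)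
  have S: "subgroup {g \<in> carrier G. \<exists>a. a \<noteq> 0 \<and> basis g a \<in> ?S} G"
    using unipotent_upper_closed(1)[of 1]
      unipotent_upper_closed(2,3)[where n = 1]
      alg.U_one units_mult alg.unit_inv(1) inv
    by (intro unipotent_subgroup) (auto simp flip: mult.assoc)
  have "derived_set G (carrier G) \<subseteq> {g \<in> carrier G. \<exists>a. a \<noteq> 0 \<and> basis g a \<in> ?S}"
  proof
    fix z assume "z \<in> derived_set G (carrier G)"
    then obtain x y where x: "x \<in> carrier G" and y: "y \<in> carrier G"
      and z: "z = x \<otimes> y \<otimes> inv x \<otimes> inv y" by blast
    have z': "z = group_commutator G (inv x) (inv y)" using x y by (simp add: z group_commutator_def)
    from unit_commutator_basis[of "inv x" 1 "inv y" 1] x y obtain k where k: "k \<noteq> 0"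
      "unit_commutator (basis (inv x) 1) (basis (inv y) 1) = basis z k" unfolding z' by auto
    have u: "basis (inv x) 1 \<in> units" "basis (inv y) 1 \<in> units" using x y by (auto intro: basis_units)
    have "basis (inv x) 1 - 1 \<in> alg.upper 0" using alg.U_sub[OF u(1)] by (simp add: alg.mem)
    then have "basis z k - 1 \<in> alg.upper 1"
      using alg.unipotent_commutator[OF u, of 0] k by simp
    then have "basis z k \<in> ?S" using alg.unit_commutator_mem[OF u] w(3)[OF u] k by simp
    then show "z \<in> {g \<in> carrier G. \<exists>a. a \<noteq> 0 \<and> basis g a \<in> ?S}" using k(1) x y by (auto simp: z)
  qed
  then have "derived G (carrier G) \<subseteq> {g \<in> carrier G. \<exists>a. a \<noteq> 0 \<and> basis g a \<in> ?S}"
    unfolding derived_def by (rule generate_subgroup_incl[OF _ S])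
  with g show ?thesis by blast
qed

lemma unipotent_untwisted:
  assumes "prime CHAR('f)" "alg.absorbing {0}" "u \<in> units" "u - 1 \<in> alg.upper 1"
  obtains k where "u ^ (CHAR('f) ^ k) = 1"
  using alg.unipotent_prime_power_order[OF assms(1) of_nat_CHAR_endo assms(2,4)] by blast

lemma finite_derived:
  assumes w: "w \<in> alg" "w \<noteq> 0" "\<And>u v. u \<in> units \<Longrightarrow> v \<in> units \<Longrightarrow> w * unit_commutator u v = w"
  shows "finite (derived G (carrier G))"
proof -
  have carr: "g \<in> carrier G" if "g \<in> derived G (carrier G)" for g
    using derived_unipotent[OF w that] by blast
  have "\<forall>g\<in>derived G (carrier G). \<exists>a. basis g a \<in> {u \<in> units. w * u = w}"
    using derived_unipotent[OF w] basis_units by blast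
  from bchoice[OF this] obtain a
    where a: "\<And>g. g \<in> derived G (carrier G) \<Longrightarrow> basis g (a g) \<in> {u \<in> units. w * u = w}" by blast
  \<comment> \<open>The choice above does not record that the scalar is nonzero; a zero scalar would
    force \<open>w = 0\<close>.\<close>
  have "a g \<noteq> 0" if "g \<in> derived G (carrier G)" for g
  proof
    assume "a g = 0"
    then have "w = 0" using a[OF that] by (simp add: basis_zero)
    with w show False by simp
  qed
  then have "inj_on (\<lambda>g. basis g (a g)) (derived G (carrier G))"
    using carr basis_inject(1) by (intro inj_onI) blast
  moreover have "finite ((\<lambda>g. basis g (a g)) ` derived G (carrier G))"
    using alg.finite_stabilizer[OF w(1,2)] a by (meson finite_subset image_subsetI)
  ultimately show ?thesis by (rule finite_imageD[rotated])
qed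

text \<open>The algebra is commutative modulo \<open>alg.upper 1\<close>. For a common exponent
  \<open>q\<close> of two torsion lifts, the \<open>q\<close>-th power of their product is therefore
  congruent to 1, and such a unit is itself of \<open>p\<close>-power order.\<close>

lemma untwisted_subgroup:
  assumes p: "prime CHAR('f)" and abs: "alg.absorbing {0}"
  shows "subgroup {u. untwisted_p_element G lam CHAR('f) u} G"
proof -
  let ?p = "CHAR('f)"
  let ?S = "{u \<in> units. \<exists>k. u ^ (?p ^ k) = 1}"
  have "{u. untwisted_p_element G lam ?p u} = {g \<in> carrier G. \<exists>a. a \<noteq> 0 \<and> basis g a \<in> ?S}"
    using untwisted_iff[OF p] basis_units by blast
  also have "subgroup \<dots> G"
  proof (rule unipotent_subgroup)
    fix u v assume "u \<in> ?S" "v \<in> ?S"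
    then obtain k l where u: "u \<in> units" "u ^ (?p ^ k) = 1" and v: "v \<in> units" "v ^ (?p ^ l) = 1" by blast
    define q where "q = ?p ^ (k + l)"
    have "q = ?p ^ k * ?p ^ l" "q = ?p ^ l * ?p ^ k" by (simp_all add: q_def power_add)
    then have uq: "u ^ q = 1" "v ^ q = 1"
      using u v by (metis power_mult power_one)+
    have pow: "x ^ n \<in> alg" if "x \<in> units" for x n using that alg.U_sub by (simp add: alg.mem)
    have step: "(u * v) ^ n - u ^ n * v ^ n \<in> alg.upper 1" for n
    proof (induction n)
      case 0 then show ?case by (simp add: alg.ideal_zero[OF alg.ideal_upper])
    next
      case (Suc n)
      have "bracket (v ^ n) (u * v) \<in> alg.upper (Suc 0)"
        using pow v u alg.U_sub by (intro alg.upper_bracket) (auto intro: alg.mem)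
      then have "((u * v) ^ n - u ^ n * v ^ n) * (u * v) + u ^ n * bracket (v ^ n) (u * v) \<in> alg.upper 1"
        using Suc pow[OF u(1)] alg.U_sub[OF units_mult[OF u(1) v(1)]]
        by (intro alg.ideal_add[OF alg.ideal_upper] alg.ideal_right[OF alg.ideal_upper _ Suc]
            alg.ideal_left[OF alg.ideal_upper]) simp_all
      also have "((u * v) ^ n - u ^ n * v ^ n) * (u * v) + u ^ n * bracket (v ^ n) (u * v)
        = (u * v) ^ Suc n - u ^ Suc n * v ^ Suc n"
        by (simp only: power_Suc2[of "u * v"] power_Suc2[of u] power_Suc[of v])
           (simp add: bracket_def algebra_simps)
      finally show ?case .
    qed
    have qU: "(u * v) ^ q \<in> units" using u v by (induction q) (auto intro: alg.U_one units_mult)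
    have "(u * v) ^ q - 1 \<in> alg.upper 1" using step[of q] by (simp add: uq)
    from unipotent_untwisted[OF p abs qU this] obtain j where "((u * v) ^ q) ^ (?p ^ j) = 1" .
    then have "(u * v) ^ (?p ^ (k + l + j)) = 1" by (simp add: q_def power_add power_mult)
    then show "u * v \<in> ?S" using u v units_mult by blast
  next
    fix u assume "u \<in> ?S"
    then obtain k where u: "u \<in> units" "u ^ (?p ^ k) = 1" by blast
    have "u ^ n * unit_inv u ^ n = 1" for n
    proof (induction n)
      case (Suc n)
      have "u ^ Suc n * unit_inv u ^ Suc n = u ^ n * (u * unit_inv u) * unit_inv u ^ n"
        by (simp only: power_Suc2[of u] power_Suc[of "unit_inv u"] mult.assoc)
      then show ?case using Suc alg.unit_inv(2)[OF u(1)] by simp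
    qed simp
    from this[of "?p ^ k"] have "unit_inv u ^ (?p ^ k) = 1" using u by simp
    then show "unit_inv u \<in> ?S" using alg.unit_inv(1)[OF u(1)] by blast
  qed (auto simp: alg.U_one)
  finally show ?thesis .
qed

section \<open>The condition on twists\<close>

lemma group_commutator_inv:
  assumes "a \<in> carrier G" "b \<in> carrier G"
  shows "group_commutator G b a = inv (group_commutator G a b)"
  using assms by (simp add: group_commutator_def inv_mult_group m_assoc)

lemma commutator_coeff_nonzero:
  assumes "a \<in> carrier G" "b \<in> carrier G"
  shows "commutator_coeff G lam a b \<noteq> 0"
  using assms lam_unit by (simp add: commutator_coeff_def group_commutator_def)

text \<open>The two commutators are inverse to each other and share their order \<open>q\<close>;
  the \<open>q\<close>-th power of the lift is the scalar \<kappa>^q \<mu>((b,a)), with \<kappa> the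
  commutator coefficient.\<close>

lemma twist_condition_iff:
  assumes p: "prime CHAR('f)" and a: "a \<in> carrier G" and b: "b \<in> carrier G"
    and m: "ord (group_commutator G a b) = CHAR('f) ^ m"
  shows "commutator_coeff G lam a b powi (- int (CHAR('f) ^ m)) = twist G lam (group_commutator G b a) \<longleftrightarrow>
    basis (group_commutator G b a) (commutator_coeff G lam a b) ^ (CHAR('f) ^ m) = 1"
proof -
  let ?c = "group_commutator G b a" and ?k = "commutator_coeff G lam a b" and ?q = "CHAR('f) ^ m"
  have c: "?c \<in> carrier G" "group_commutator G a b \<in> carrier G" using a b by (simp_all add: group_commutator_def)
  have o: "ord ?c = ?q" using m c group_commutator_inv[OF a b] by simp
  have "basis ?c ?k ^ ?q = basis \<one> (?k ^ ?q * twist G lam ?c)"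
    using basis_power_twist[OF c(1), of ?k] o prime_gt_0_nat[OF p] by simp
  then have "basis ?c ?k ^ ?q = 1 \<longleftrightarrow> ?k ^ ?q * twist G lam ?c = 1"
    using basis_inject(2)[of \<one> \<one> 1] by (metis basis_one one_closed zero_neq_one)
  also have "\<dots> \<longleftrightarrow> inverse (?k ^ ?q) = twist G lam ?c"
  proof -
    have "x * t = 1 \<longleftrightarrow> inverse x = t" if "x \<noteq> 0" for x t :: 'f using that by (auto simp: field_simps)
    then show ?thesis using commutator_coeff_nonzero[OF a b] by simp
  qed
  also have "inverse (?k ^ ?q) = ?k powi (- int ?q)" by (simp only: power_int_minus power_int_of_nat)
  finally show ?thesis by blast
qed

lemma lower_nilpotent_conditions:
  assumes nil: "alg.lower n = {0}" and noncomm: "alg.lower 1 \<noteq> {0}"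
  shows "prime CHAR('f) \<and> nilpotent_group G \<and> finite (derived G (carrier G)) \<and>
    (\<exists>n. card (derived G (carrier G)) = CHAR('f) ^ n) \<and>
    subgroup {u. untwisted_p_element G lam CHAR('f) u} G \<and>
    (\<forall>a \<in> carrier G. \<forall>b \<in> carrier G.
       untwisted_p_element G lam CHAR('f) (group_commutator G a b) \<and>
       (\<forall>m. ord (group_commutator G a b) = CHAR('f) ^ m \<longrightarrow>
          commutator_coeff G lam a b powi (- int (CHAR('f) ^ m)) = twist G lam (group_commutator G b a)))"
proof -
  from lower_nilpotent_cases[OF nil noncomm] obtain w where w: "w \<in> alg" "w \<noteq> 0"
    "\<And>u v. u \<in> units \<Longrightarrow> v \<in> units \<Longrightarrow> w * unit_commutator u v = w"
    and abs: "alg.absorbing {0}" and p: "prime CHAR('f)" by blast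
  have fin: "finite (derived G (carrier G))" by (rule finite_derived[OF w])
  have tors: "\<exists>a k. a \<noteq> 0 \<and> basis g a ^ (CHAR('f) ^ k) = 1" "g \<in> carrier G"
    if g: "g \<in> derived G (carrier G)" for g
  proof -
    from derived_unipotent[OF w g] obtain a where a: "g \<in> carrier G" "a \<noteq> 0" "basis g a - 1 \<in> alg.upper 1"
      by blast
    then show "g \<in> carrier G" "\<exists>a k. a \<noteq> 0 \<and> basis g a ^ (CHAR('f) ^ k) = 1"
      using unipotent_untwisted[OF p abs basis_units] by metis+
  qed
  have card: "\<exists>n. card (derived G (carrier G)) = CHAR('f) ^ n"
    using derived_is_subgroup[of "carrier G"] tors basis_power_one
    by (intro prime_power_card[OF p _ fin]) blast+
  have unt: "untwisted_p_element G lam CHAR('f) (group_commutator G a b)"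
    if "a \<in> carrier G" "b \<in> carrier G" for a b
    using tors[OF group_commutator_derived[OF that]] untwisted_iff[OF p] by blast
  have tw: "commutator_coeff G lam a b powi (- int (CHAR('f) ^ m)) = twist G lam (group_commutator G b a)"
    if a: "a \<in> carrier G" and b: "b \<in> carrier G" and m: "ord (group_commutator G a b) = CHAR('f) ^ m" for a b m
  proof -
    let ?c = "group_commutator G b a" and ?k = "commutator_coeff G lam a b"
    have c: "?c \<in> carrier G" "group_commutator G a b \<in> carrier G" using a b by (simp_all add: group_commutator_def)
    have o: "ord ?c = CHAR('f) ^ m" using m c group_commutator_inv[OF a b] by simp
    have u: "basis b 1 \<in> units" "basis a 1 \<in> units" using a b by (auto intro: basis_units)
    have eq: "unit_commutator (basis b 1) (basis a 1) = basis ?c ?k"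
      using a b by (intro unit_commutator_eq) auto
    have "basis b 1 - 1 \<in> alg.upper 0" using alg.U_sub[OF u(1)] by (simp add: alg.mem)
    then have "basis ?c ?k - 1 \<in> alg.upper 1" using alg.unipotent_commutator[OF u, of 0] eq by simp
    moreover have "basis ?c ?k \<in> units" using commutator_coeff_nonzero[OF a b] c by (intro basis_units)
    ultimately obtain j where "basis ?c ?k ^ (CHAR('f) ^ j) = 1"
      using unipotent_untwisted[OF p abs] by blast
    \<comment> \<open>Torsion is sharpened to the exponent \<open>ord ?c\<close>, the one in which
      the twist condition is stated.\<close>
    then have "basis ?c ?k ^ ord ?c = 1"
      using basis_power_ord[OF p c(1) commutator_coeff_nonzero[OF a b]] by blast
    then show ?thesis using twist_condition_iff[OF p a b m] o by simp
  qed
  show ?thesis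
    using p upper_nilpotent_group[OF abs] fin card untwisted_subgroup[OF p abs] unt tw by blast
qed

section \<open>From the conditions to Lie nilpotency\<close>

lemma group_lower_central:
  "x \<in> alg.group_lower n \<Longrightarrow> \<exists>g\<in>lower_central G n. \<exists>a. g \<in> carrier G \<and> a \<noteq> 0 \<and> x = basis g a"
proof (induction n arbitrary: x)
  case 0
  then have "x \<in> units" by simp
  then show ?case unfolding units_def by auto
next
  case (Suc n)
  then obtain y u where x: "x = unit_commutator y u" "y \<in> alg.group_lower n" "u \<in> units" by auto
  from Suc.IH[OF x(2)] obtain g a where g: "g \<in> lower_central G n" "g \<in> carrier G" "a \<noteq> 0" "y = basis g a"
    by blast
  from x(3) obtain h b where h: "h \<in> carrier G" "b \<noteq> 0" "u = basis h b" unfolding units_def by blast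
  from unit_commutator_basis[OF g(2,3) h(1,2)] obtain k where
    "k \<noteq> 0" "x = basis (group_commutator G g h) k" using x g h by metis
  moreover have "group_commutator G g h \<in> lower_central G (Suc n)"
    using g h by (auto intro: generate.incl)
  moreover have "group_commutator G g h \<in> carrier G" using g h by (simp add: group_commutator_def)
  ultimately show ?case by blast
qed

lemma conditions_absorbing:
  assumes p: "prime CHAR('f)" and nil: "nilpotent_group G" and fin: "finite (derived G (carrier G))"
    and untw: "\<And>a b. a \<in> carrier G \<Longrightarrow> b \<in> carrier G \<Longrightarrow>
        untwisted_p_element G lam CHAR('f) (group_commutator G a b)"
    and tw: "\<And>a b m. a \<in> carrier G \<Longrightarrow> b \<in> carrier G \<Longrightarrow> ord (group_commutator G a b) = CHAR('f) ^ m \<Longrightarrow>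
        commutator_coeff G lam a b powi (- int (CHAR('f) ^ m)) = twist G lam (group_commutator G b a)"
  shows "alg.absorbing {0}"
proof -
  have comm: "\<exists>g\<in>derived G (carrier G). \<exists>k j. g \<in> carrier G \<and> k \<noteq> 0 \<and> c = basis g k \<and> c ^ (CHAR('f) ^ j) = 1"
    if "c \<in> alg.group_commutators" for c
  proof -
    from that obtain u v where uv: "u \<in> units" "v \<in> units" "c = unit_commutator u v"
      unfolding alg.group_commutators_def by blast
    \<comment> \<open>Here \<open>v\<close> lies over \<open>a\<close> and \<open>u\<close> over
      \<open>b\<close>, so that the commutator lies over \<open>(b, a)\<close> with coefficient
      \<open>commutator_coeff G lam a b\<close>.\<close>
    from uv(2) obtain a \<alpha> where a: "a \<in> carrier G" "\<alpha> \<noteq> 0" "v = basis a \<alpha>"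
      unfolding units_def by blast
    from uv(1) obtain b \<beta> where b: "b \<in> carrier G" "\<beta> \<noteq> 0" "u = basis b \<beta>"
      unfolding units_def by blast
    from untw[OF a(1) b(1)] obtain m where m: "ord (group_commutator G a b) = CHAR('f) ^ m"
      unfolding untwisted_p_element_def p_element_def by blast
    have c': "c = basis (group_commutator G b a) (commutator_coeff G lam a b)"
      unfolding uv(3) a(3) b(3) by (rule unit_commutator_eq[OF a(1,2) b(1,2)])
    then have "c ^ (CHAR('f) ^ m) = 1"
      using twist_condition_iff[OF p a(1) b(1) m] tw[OF a(1) b(1) m] by simp
    moreover have "group_commutator G b a \<in> carrier G" using a b by (simp add: group_commutator_def)
    ultimately show ?thesis
      using c' commutator_coeff_nonzero[OF a(1) b(1)] group_commutator_derived[OF b(1) a(1)] by blast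
  qed
  then obtain f where f: "\<And>c. c \<in> alg.group_commutators \<Longrightarrow> f c \<in> derived G (carrier G) \<and>
      (\<exists>k j. f c \<in> carrier G \<and> k \<noteq> 0 \<and> c = basis (f c) k \<and> c ^ (CHAR('f) ^ j) = 1)" by metis
  \<comment> \<open>Two commutators over the same \<open>g\<close> both have trivial power with
    exponent \<open>ord g\<close>. Dividing cancels the twist, so the quotient of their scalars is a
    \<open>p\<close>-power root of one, hence 1. The commutators thus embed into the finite derived
    subgroup.\<close>
  have "inj_on f alg.group_commutators"
  proof (rule inj_onI)
    fix c d assume "c \<in> alg.group_commutators" "d \<in> alg.group_commutators" "f c = f d"
    then obtain g k l i j where g: "g \<in> carrier G" and k: "k \<noteq> 0" "c = basis g k" "c ^ (CHAR('f) ^ i) = 1"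
      and l: "l \<noteq> 0" "d = basis g l" "d ^ (CHAR('f) ^ j) = 1" using f by metis
    have one: "c ^ ord g = 1" "d ^ ord g = 1"
      using basis_power_ord[OF p g k(1), of i] basis_power_ord[OF p g l(1), of j] k l by metis+
    from basis_power_ord[OF p g k(1), of i] k obtain m where m: "ord g = CHAR('f) ^ m" by metis
    have "ord g > 0" using m p by (simp add: prime_gt_0_nat)
    then have "basis \<one> (k ^ ord g * twist G lam g) = basis \<one> 1" "basis \<one> (l ^ ord g * twist G lam g) = basis \<one> 1"
      using basis_power_twist[OF g] one k(2) l(2) by (simp_all add: basis_one)
    then have "k ^ ord g * twist G lam g = 1" "l ^ ord g * twist G lam g = 1"
      using basis_inject(2)[of \<one> \<one> 1] one_closed by (metis zero_neq_one)+
    then have "k ^ ord g * twist G lam g = l ^ ord g * twist G lam g" "twist G lam g \<noteq> 0" by auto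
    then have "k ^ ord g = l ^ ord g" by simp
    then have "(k / l) ^ ord g = 1" using l(1) by (simp add: power_divide)
    then have "k / l = 1" unfolding m by (rule prime_power_root_one[OF p])
    then show "c = d" using k l by simp
  qed
  then have finc: "finite alg.group_commutators"
    using finite_imageD[of f] finite_subset[OF _ fin] f by blast
  from nil obtain N where N: "lower_central G N = {\<one>}" unfolding nilpotent_group_def by blast
  have one: "1 \<in> alg.group_lower n" for n
  proof (induction n)
    case (Suc n)
    then show ?case using alg.unit_commutator_right_one[OF alg.U_one] alg.U_one by force
  qed (simp add: alg.U_one)
  \<comment> \<open>Over the trivial term of the lower central series,
    \<open>alg.group_lower N\<close> can still contain scalars other than 1; these are central, so
    one more commutator removes them.\<close>
  have "x = 1" if x: "x \<in> alg.group_lower (Suc N)" for x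
  proof -
    from x obtain y u where yu: "x = unit_commutator y u" "y \<in> alg.group_lower N" "u \<in> units" by auto
    from group_lower_central[OF yu(2)] N obtain a where a: "a \<noteq> 0" "y = basis \<one> a" by auto
    from yu(3) obtain h b where h: "h \<in> carrier G" "b \<noteq> 0" "u = basis h b" unfolding units_def by blast
    have y: "y \<in> units" using a by (simp add: basis_units)
    have "y * u = u * y" using a h by (simp add: basis_mult normalized ac_simps)
    then have "u * y * x = u * y * 1" using alg.mult_commutator[OF y yu(3)] yu(1) by simp
    then show ?thesis using alg.unit_inv_cancel(2)[OF units_mult[OF yu(3) y]] by metis
  qed
  with one have "alg.group_lower (Suc N) = {1}" by blast
  with comm show ?thesis
    by (intro alg.group_nilpotent_absorbing[OF p of_nat_CHAR_endo finc]) blast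
qed

text \<open>Lower Lie nilpotency implies the right-hand side, which implies upper Lie nilpotency,
  which implies lower. This cycle settles both notions at once.\<close>

lemma lie_nilpotent_iff:
  assumes "lie_nilpotent \<in> {lower_lie_nilpotent, upper_lie_nilpotent}"
  shows "lie_nilpotent (twisted_group_algebra G lam) \<longleftrightarrow>
    cring (twisted_group_algebra G lam) \<or>
    (\<exists>p. prime p \<and> CHAR('f) = p \<and>
       nilpotent_group G \<and>
       finite (derived G (carrier G)) \<and>
       (\<exists>n. card (derived G (carrier G)) = p ^ n) \<and>
       subgroup {u. untwisted_p_element G lam p u} G \<and>
       (\<forall>a \<in> carrier G. \<forall>b \<in> carrier G.
          untwisted_p_element G lam p (group_commutator G a b) \<and>
          (\<forall>m. group.ord G (group_commutator G a b) = p ^ m \<longrightarrow>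
             commutator_coeff G lam a b powi (- int (p ^ m)) = twist G lam (group_commutator G b a))))"
    (is "_ \<longleftrightarrow> _ \<or> ?cond")
proof
  assume "lie_nilpotent (twisted_group_algebra G lam)"
  then have "lower_lie_nilpotent talg"
    using assms upper_imp_lower_lie_nilpotent unfolding talg_def[symmetric] by blast
  then obtain n where n: "alg.lower n = {0}" by (rule lower_lie_nilpotent_imp)
  show "cring (twisted_group_algebra G lam) \<or> ?cond"
  proof (cases "alg.lower 1 = {0}")
    case True then show ?thesis using cring_iff unfolding talg_def by blast
  next
    case False
    from lower_nilpotent_conditions[OF n False] show ?thesis by blast
  qed
next
  assume "cring (twisted_group_algebra G lam) \<or> ?cond"
  then have "\<exists>n. alg.upper n \<subseteq> {0}"
  proof
    assume "cring (twisted_group_algebra G lam)"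
    then have "alg.upper 1 = {0}" using cring_iff unfolding talg_def[symmetric] alg.upper_1 by blast
    then show ?thesis by blast
  next
    assume ?cond
    then have "alg.absorbing {0}" by (intro conditions_absorbing) blast+
    then show ?thesis unfolding alg.absorbing_def by blast
  qed
  then obtain n where "alg.upper n = {0}" using alg.ideal_zero[OF alg.ideal_upper] by blast
  then have "upper_lie_nilpotent talg" by (rule upper_lie_nilpotentI)
  then show "lie_nilpotent (twisted_group_algebra G lam)"
    using assms upper_imp_lower_lie_nilpotent unfolding talg_def[symmetric] by blast
qed

end

section \<open>Crossed products with nontrivial action\<close>

context crossed_system
begin

definition crossed_ring :: "('g \<Rightarrow> 'f) ring" where "crossed_ring = crossed_product G \<sigma> lam"

section \<open>Cocycle values at the identity and brackets with scalars\<close>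

lemma sigma_simps:
  assumes "g \<in> carrier G"
  shows "\<sigma> g (x * y) = \<sigma> g x * \<sigma> g y" "\<sigma> g x = \<sigma> g y \<longleftrightarrow> x = y" "\<sigma> g 0 = 0"
proof -
  note f = automorphism[OF assms, unfolded field_automorphism_def]
  show "\<sigma> g (x * y) = \<sigma> g x * \<sigma> g y" using f by blast
  have "inj (\<sigma> g)" using f by (simp add: bij_is_inj)
  then show "\<sigma> g x = \<sigma> g y \<longleftrightarrow> x = y" by (rule inj_eq)
  have "\<sigma> g (u + v) = \<sigma> g u + \<sigma> g v" for u v using f by blast
  from this[of 0 0] have "\<sigma> g 0 = \<sigma> g 0 + \<sigma> g 0" by (simp only: add_0_left)
  then show "\<sigma> g 0 = 0" by (simp only: add_cancel_right_right)
qed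

lemma sigma_one: "\<sigma> \<one> x = x"
proof -
  have "\<sigma> \<one> (\<sigma> \<one> x) = \<sigma> \<one> x" using action[of \<one> \<one> x] by simp
  then show ?thesis by (rule iffD1[OF sigma_simps(2)[OF one_closed]])
qed

lemma lam_right_one:
  assumes g: "g \<in> carrier G" shows "lam g \<one> = lam \<one> \<one>"
proof -
  have "lam g \<one> * lam \<one> \<one> = lam g \<one> * lam g \<one>"
    using cocycle[OF g one_closed one_closed] g by (simp add: sigma_one)
  then show ?thesis using lam_unit[OF g one_closed] by simp
qed

lemma lam_left_one:
  assumes g: "g \<in> carrier G" shows "lam \<one> g = \<sigma> g (lam \<one> \<one>)"
proof -
  have "lam \<one> g * lam \<one> g = lam \<one> g * \<sigma> g (lam \<one> \<one>)"
    using cocycle[OF one_closed one_closed g] g by simp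
  then show ?thesis using lam_unit[OF one_closed g] by simp
qed

lemma single_carrier: "g \<in> carrier G \<Longrightarrow> single g a \<in> carrier crossed_ring"
  by (auto simp: crossed_ring_def crossed_product_def single_def)

lemma crossed_single_mult:
  assumes g: "g \<in> carrier G" and h: "h \<in> carrier G"
  shows "single g a \<otimes>\<^bsub>crossed_ring\<^esub> single h b = single (g \<otimes> h) (lam g h * \<sigma> h a * b)"
proof
  fix k
  have "{(x, y). single g a x \<noteq> 0 \<and> single h b y \<noteq> 0 \<and> x \<otimes> y = k}
      = (if a = 0 \<or> b = 0 \<or> k \<noteq> g \<otimes> h then {} else {(g, h)})"
    by (auto simp: single_def split: if_splits)
  then show "(single g a \<otimes>\<^bsub>crossed_ring\<^esub> single h b) k = single (g \<otimes> h) (lam g h * \<sigma> h a * b) k"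
    using sigma_simps(3)[OF h] by (auto simp: crossed_ring_def crossed_product_def single_def)
qed

lemma crossed_a_minus:
  assumes y: "y \<in> carrier crossed_ring" shows "x \<ominus>\<^bsub>crossed_ring\<^esub> y = (\<lambda>k. x k - y k)"
proof -
  have "(\<lambda>k. - y k) \<in> carrier crossed_ring" using y by (simp add: crossed_ring_def crossed_product_def)
  then have "\<ominus>\<^bsub>crossed_ring\<^esub> y = (\<lambda>k. - y k)"
    unfolding a_inv_def m_inv_def
    by (intro the_equality) (auto simp: crossed_ring_def crossed_product_def fun_eq_iff eq_neg_iff_add_eq_0 add.commute)
  then show ?thesis by (simp add: a_minus_def) (simp add: crossed_ring_def crossed_product_def)
qed

text \<open>The ring identity is \<open>single \<one> (inverse (lam \<one> \<one>))\<close>, so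
  \<open>single \<one> (a / lam \<one> \<one>)\<close> is the scalar \<open>a\<close>. Its bracket
  with the basis element of \<open>g\<close> measures how far \<open>\<sigma> g\<close> moves
  \<open>a\<close>.\<close>

lemma single_bracket:
  assumes g: "g \<in> carrier G"
  shows "single g d \<otimes>\<^bsub>crossed_ring\<^esub> single \<one> (a / lam \<one> \<one>) \<ominus>\<^bsub>crossed_ring\<^esub> single \<one> (a / lam \<one> \<one>) \<otimes>\<^bsub>crossed_ring\<^esub> single g d
    = single g ((a - \<sigma> g a) * d)"
proof -
  have "\<sigma> g (lam \<one> \<one>) * \<sigma> g (a / lam \<one> \<one>) = \<sigma> g a"
    using lam_unit[of \<one> \<one>] by (simp flip: sigma_simps(1)[OF g])
  then have "single \<one> (a / lam \<one> \<one>) \<otimes>\<^bsub>crossed_ring\<^esub> single g d = single g (\<sigma> g a * d)"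
    using g by (simp add: crossed_single_mult lam_left_one[OF g])
  moreover have "single g d \<otimes>\<^bsub>crossed_ring\<^esub> single \<one> (a / lam \<one> \<one>) = single g (d * a)"
    using g lam_unit[of \<one> \<one>] by (simp add: crossed_single_mult lam_right_one[OF g] sigma_one)
  ultimately show ?thesis using single_carrier[OF g]
    by (simp add: crossed_a_minus) (auto simp: single_def algebra_simps)
qed

text \<open>Iterated commutators with a scalar moved by \<open>\<sigma> g\<close> multiply the basis element of \<open>g\<close> by nonzero
  scalars.\<close>

lemma lie_nilpotent_trivial_action:
  assumes nil: "upper_lie_nilpotent crossed_ring \<or> lower_lie_nilpotent crossed_ring" and g: "g \<in> carrier G"
  shows "\<sigma> g = id"
proof (rule ccontr)
  assume "\<sigma> g \<noteq> id"
  then obtain a where a: "\<sigma> g a \<noteq> a" by (auto simp: fun_eq_iff)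
  \<comment> \<open>The factor \<open>single \<one> 1\<close> need not be the identity, but it only
    contributes the nonzero scalar \<open>lam g \<one>\<close>.\<close>
  have right: "single g d \<otimes>\<^bsub>crossed_ring\<^esub> single \<one> 1 = single g (lam g \<one> * d)" for d
    using g by (simp add: crossed_single_mult sigma_one)
  have step: "single g ((a - \<sigma> g a) * d) \<in> lie_commutators crossed_ring S (carrier crossed_ring)" if "single g d \<in> S" for d S
    unfolding lie_commutators_def single_bracket[OF g, symmetric]
    using that single_carrier[OF one_closed] by (blast intro: generate.incl)
  have prod: "single g (lam g \<one> * d) \<in> additive_product crossed_ring S (carrier crossed_ring)" if "single g d \<in> S" for d S
    unfolding additive_product_def right[symmetric]
    using that single_carrier[OF one_closed] by (blast intro: generate.incl)
  have gamma: "\<exists>d. d \<noteq> 0 \<and> single g d \<in> lie_gamma crossed_ring (Suc n)" for n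
  proof (induction n)
    case 0 then show ?case using single_carrier[OF g] by (intro exI[of _ 1]) (simp add: lie_gamma_def)
  next
    case (Suc n)
    then obtain d where d: "d \<noteq> 0" "single g d \<in> lie_gamma crossed_ring (Suc n)" by blast
    have "single g ((a - \<sigma> g a) * d) \<in> lie_gamma crossed_ring (Suc (Suc n))"
      using step[OF d(2)] by (simp add: lie_gamma_def)
    moreover have "(a - \<sigma> g a) * d \<noteq> 0" using a d by simp
    ultimately show ?case by blast
  qed
  have lower: "\<exists>d. d \<noteq> 0 \<and> single g d \<in> lower_lie_power crossed_ring (Suc n)" for n
  proof -
    from gamma obtain d where d: "d \<noteq> 0" "single g d \<in> lie_gamma crossed_ring (Suc n)" by blast
    have "lam g \<one> * d \<noteq> 0" using d(1) lam_unit[OF g one_closed] by simp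
    then show ?thesis unfolding lower_lie_power_def using prod[OF d(2)] by blast
  qed
  have upper: "\<exists>d. d \<noteq> 0 \<and> single g d \<in> upper_lie_power crossed_ring (Suc n)" for n
  proof (induction n)
    case 0 then show ?case using single_carrier[OF g] by (intro exI[of _ 1]) (simp add: upper_lie_power_def)
  next
    case (Suc n)
    then obtain d where d: "d \<noteq> 0" "single g d \<in> upper_lie_power crossed_ring (Suc n)" by blast
    have "single g (lam g \<one> * ((a - \<sigma> g a) * d)) \<in> upper_lie_power crossed_ring (Suc (Suc n))"
      using prod[OF step[OF d(2)]] by (simp add: upper_lie_power_def)
    moreover have "lam g \<one> * ((a - \<sigma> g a) * d) \<noteq> 0" using a d lam_unit[OF g one_closed] by simp
    ultimately show ?case by blast
  qed
  have "single g d \<noteq> \<zero>\<^bsub>crossed_ring\<^esub>" if "d \<noteq> 0" for d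
    using that by (auto simp: crossed_ring_def crossed_product_def single_def fun_eq_iff)
  then have "upper_lie_power crossed_ring (Suc n) \<noteq> {\<zero>\<^bsub>crossed_ring\<^esub>}" "lower_lie_power crossed_ring (Suc n) \<noteq> {\<zero>\<^bsub>crossed_ring\<^esub>}" for n
    using upper[of n] lower[of n] by blast+
  then show False using nil unfolding upper_lie_nilpotent_def lower_lie_nilpotent_def
    by (metis One_nat_def Suc_le_D)
qed

end

theorem theorem1:
  fixes G :: "('g, 'm) monoid_scheme"
  assumes "group G"
  shows "(\<forall>(\<sigma> :: 'g \<Rightarrow> 'f::field \<Rightarrow> 'f) (lam :: 'g \<Rightarrow> 'g \<Rightarrow> 'f).
            crossed_system G \<sigma> lam \<longrightarrow>
            upper_lie_nilpotent (crossed_product G \<sigma> lam) \<or>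
            lower_lie_nilpotent (crossed_product G \<sigma> lam) \<longrightarrow>
            (\<forall>g \<in> carrier G. \<sigma> g = id)) \<and>
         (\<forall>lam :: 'g \<Rightarrow> 'g \<Rightarrow> 'f.
            twisted_system G lam \<longrightarrow>
            (\<forall>lie_nilpotent \<in> {lower_lie_nilpotent, upper_lie_nilpotent}.
               lie_nilpotent (twisted_group_algebra G lam) \<longleftrightarrow>
               cring (twisted_group_algebra G lam) \<or>
               (\<exists>p. Factorial_Ring.prime p \<and> CHAR('f) = p \<and>
                  nilpotent_group G \<and>
                  finite (derived G (carrier G)) \<and>
                  (\<exists>n. card (derived G (carrier G)) = p ^ n) \<and>
                  subgroup {u. untwisted_p_element G lam p u} G \<and>
                  (\<forall>a \<in> carrier G. \<forall>b \<in> carrier G.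
                     untwisted_p_element G lam p (group_commutator G a b) \<and>
                     (\<forall>m. group.ord G (group_commutator G a b) = p ^ m \<longrightarrow>
                        commutator_coeff G lam a b powi (- int (p ^ m)) =
                        twist G lam (group_commutator G b a))))))"
proof (intro conjI allI impI ballI)
  fix \<sigma> :: "'g \<Rightarrow> 'f \<Rightarrow> 'f" and lam :: "'g \<Rightarrow> 'g \<Rightarrow> 'f" and g
  assume "crossed_system G \<sigma> lam" "g \<in> carrier G"
    "upper_lie_nilpotent (crossed_product G \<sigma> lam) \<or> lower_lie_nilpotent (crossed_product G \<sigma> lam)"
  then show "\<sigma> g = id"
    using crossed_system.lie_nilpotent_trivial_action crossed_system.crossed_ring_def by metis
next
  fix lam :: "'g \<Rightarrow> 'g \<Rightarrow> 'f" and lie_nilpotent :: "('g \<Rightarrow> 'f) ring \<Rightarrow> bool"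
  assume "twisted_system G lam" "lie_nilpotent \<in> {lower_lie_nilpotent, upper_lie_nilpotent}"
  then show "lie_nilpotent (twisted_group_algebra G lam) \<longleftrightarrow>
               cring (twisted_group_algebra G lam) \<or>
               (\<exists>p. Factorial_Ring.prime p \<and> CHAR('f) = p \<and>
                  nilpotent_group G \<and>
                  finite (derived G (carrier G)) \<and>
                  (\<exists>n. card (derived G (carrier G)) = p ^ n) \<and>
                  subgroup {u. untwisted_p_element G lam p u} G \<and>
                  (\<forall>a \<in> carrier G. \<forall>b \<in> carrier G.
                     untwisted_p_element G lam p (group_commutator G a b) \<and>
                     (\<forall>m. group.ord G (group_commutator G a b) = p ^ m \<longrightarrow>
                        commutator_coeff G lam a b powi (- int (p ^ m)) =
                        twist G lam (group_commutator G b a))))"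
    by (rule twisted_system.lie_nilpotent_iff)
qed

end
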